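(* There exist compact quantum groups whose underlying CQG algebra is finitely presented (as a complex algebra) and whose complexified fusion algebra is not finitely generated (as a complex algebra).
   Context: The CQG algebra of a compact quantum group $G$ is the dense Hopf $*$-algebra spanned by matrix coefficients of the finite-dimensional unitary representations of $G$. The fusion ring $R$ of $G$ is the Grothendieck ring of the category of finite-dimensional representations of $G$ (equivalently, finite-dimensional comodules over the CQG algebra), with multiplication induced by the tensor product; the complexified fusion algebra is $R_{\mathbb C}=\mathbb{C}\otimes_{\mathbb Z}R$. *)

theory Defs
  imports
    "HOL-Analysis.Infinite_Sum"
    "HOL-Library.Poly_Mapping"
    "HOL-Library.Function_Algebras"
    "HOL-Algebra.QuotRing"
    "HOL-Algebra.Generated_Groups"
    "Jordan_Normal_Form.Matrix_Kernel"
begin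

section \<open>Bounded operators on the Hilbert space of square-summable families\<close>

text \<open>
  Vectors are functions \<open>'i \<Rightarrow> complex\<close>, added pointwise.  A bounded operator is only meaningful on
  \<open>ell2\<close> and is required to vanish outside it, so that equality of operators is equality of
  functions.
\<close>

type_synonym 'i op = "('i \<Rightarrow> complex) \<Rightarrow> 'i \<Rightarrow> complex"

definition ell2 :: "('i \<Rightarrow> complex) set" where
  "ell2 = {x. (\<lambda>i. (cmod (x i))\<^sup>2) summable_on UNIV}"

definition ell2_norm :: "('i \<Rightarrow> complex) \<Rightarrow> real" where
  "ell2_norm x = sqrt (\<Sum>\<^sub>\<infinity>i. (cmod (x i))\<^sup>2)"

definition ell2_inner :: "('i \<Rightarrow> complex) \<Rightarrow> ('i \<Rightarrow> complex) \<Rightarrow> complex" where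
  "ell2_inner x y = (\<Sum>\<^sub>\<infinity>i. cnj (x i) * y i)"

definition bounded_ops :: "'i op set" where
  "bounded_ops = {T.
     (\<forall>x\<in>ell2. T x \<in> ell2) \<and>
     (\<forall>x\<in>ell2. \<forall>y\<in>ell2. T (x + y) = T x + T y) \<and>
     (\<forall>c. \<forall>x\<in>ell2. T (\<lambda>i. c * x i) = (\<lambda>i. c * T x i)) \<and>
     (\<exists>C. \<forall>x\<in>ell2. ell2_norm (T x) \<le> C * ell2_norm x) \<and>
     (\<forall>x. x \<notin> ell2 \<longrightarrow> T x = 0)}"

definition id_op :: "'i op" where
  "id_op x = (if x \<in> ell2 then x else 0)"

definition op_scale :: "complex \<Rightarrow> 'i op \<Rightarrow> 'i op" where
  "op_scale c T = (\<lambda>x i. c * T x i)"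

definition op_adj :: "'i op \<Rightarrow> 'i op" where
  "op_adj T = (THE T'. T' \<in> bounded_ops \<and>
     (\<forall>x\<in>ell2. \<forall>y\<in>ell2. ell2_inner (T x) y = ell2_inner x (T' y)))"

interpretation ops: vector_space "op_scale :: complex \<Rightarrow> 'i op \<Rightarrow> 'i op"
  by unfold_locales (auto simp: op_scale_def fun_eq_iff algebra_simps)

text \<open>Closure in the operator norm.\<close>

definition op_closure :: "'i op set \<Rightarrow> 'i op set" where
  "op_closure S = {T \<in> bounded_ops. \<forall>e>0. \<exists>T'\<in>S. \<forall>x\<in>ell2. ell2_norm (T x - T' x) \<le> e * ell2_norm x}"

text \<open>
  The operator \<open>S \<otimes> T\<close>, computed as \<open>(S \<otimes> 1) (1 \<otimes> T)\<close>: first \<open>T\<close> acts on the second coordinate,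
  then \<open>S\<close> on the first.
\<close>

definition op_tensor :: "'i op \<Rightarrow> 'j op \<Rightarrow> ('i \<times> 'j) op" where
  "op_tensor S T = (\<lambda>z. if z \<in> ell2 then (\<lambda>(i, j). S (\<lambda>i'. T (\<lambda>j'. z (i', j')) j) i) else 0)"

text \<open>Transport of operators along the identification of \<open>('i \<times> 'j) \<times> 'k\<close> with \<open>'i \<times> 'j \<times> 'k\<close>.\<close>

definition op_assoc :: "(('i \<times> 'j) \<times> 'k) op \<Rightarrow> ('i \<times> 'j \<times> 'k) op" where
  "op_assoc T = (\<lambda>z (i, j, k). T (\<lambda>((i', j'), k'). z (i', j', k')) ((i, j), k))"


section \<open>C*-algebras and compact quantum groups\<close>

definition unital_cstar_algebra :: "'i op set \<Rightarrow> bool" where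
  "unital_cstar_algebra A \<longleftrightarrow>
     A \<subseteq> bounded_ops \<and> id_op \<in> A \<and>
     (\<forall>S\<in>A. \<forall>T\<in>A. S + T \<in> A) \<and> (\<forall>c. \<forall>T\<in>A. op_scale c T \<in> A) \<and>
     (\<forall>S\<in>A. \<forall>T\<in>A. S \<circ> T \<in> A) \<and> (\<forall>T\<in>A. op_adj T \<in> A) \<and>
     op_closure A \<subseteq> A"

text \<open>The minimal (spatial) tensor product of two concrete C*-algebras.\<close>

definition cstar_tensor :: "'i op set \<Rightarrow> 'j op set \<Rightarrow> ('i \<times> 'j) op set" where
  "cstar_tensor A B = op_closure (ops.span {op_tensor S T | S T. S \<in> A \<and> T \<in> B})"

definition unital_star_hom :: "'i op set \<Rightarrow> 'j op set \<Rightarrow> ('i op \<Rightarrow> 'j op) \<Rightarrow> bool" where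
  "unital_star_hom A B f \<longleftrightarrow>
     f ` A \<subseteq> B \<and> f id_op = id_op \<and>
     (\<forall>S\<in>A. \<forall>T\<in>A. f (S + T) = f S + f T) \<and> (\<forall>c. \<forall>T\<in>A. f (op_scale c T) = op_scale c (f T)) \<and>
     (\<forall>S\<in>A. \<forall>T\<in>A. f (S \<circ> T) = f S \<circ> f T) \<and> (\<forall>T\<in>A. f (op_adj T) = op_adj (f T))"

text \<open>
  Woronowicz's definition.  In the coassociativity axiom, \<open>\<Phi>\<close> and \<open>\<Psi>\<close> are \<open>\<Delta> \<otimes> id\<close> and \<open>id \<otimes> \<Delta>\<close>;
  *-homomorphisms of C*-algebras are continuous, so these are determined by their values on
  elementary tensors.  The last two axioms are the density (cancellation) conditions.
\<close>

locale compact_quantum_group =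
  fixes A :: "'i op set" and \<Delta> :: "'i op \<Rightarrow> ('i \<times> 'i) op"
  assumes cstar: "unital_cstar_algebra A"
    and comult: "unital_star_hom A (cstar_tensor A A) \<Delta>"
    and coassoc: "\<exists>\<Phi> \<Psi>.
      unital_star_hom (cstar_tensor A A) (cstar_tensor (cstar_tensor A A) A) \<Phi> \<and>
      (\<forall>S\<in>A. \<forall>T\<in>A. \<Phi> (op_tensor S T) = op_tensor (\<Delta> S) T) \<and>
      unital_star_hom (cstar_tensor A A) (cstar_tensor A (cstar_tensor A A)) \<Psi> \<and>
      (\<forall>S\<in>A. \<forall>T\<in>A. \<Psi> (op_tensor S T) = op_tensor S (\<Delta> T)) \<and>
      (\<forall>T\<in>A. op_assoc (\<Phi> (\<Delta> T)) = \<Psi> (\<Delta> T))"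
    and dense_left:
      "cstar_tensor A A \<subseteq> op_closure (ops.span {op_tensor S id_op \<circ> \<Delta> T | S T. S \<in> A \<and> T \<in> A})"
    and dense_right:
      "cstar_tensor A A \<subseteq> op_closure (ops.span {op_tensor id_op S \<circ> \<Delta> T | S T. S \<in> A \<and> T \<in> A})"


section \<open>Finite-dimensional representations\<close>

text \<open>
  A representation on \<open>\<complex>\<^sup>n\<close> is an \<open>n \<times> n\<close> matrix \<open>u\<close> over \<open>A\<close>, invertible in the algebra of matrices
  over \<open>A\<close>, with \<open>\<Delta> u\<^sub>i\<^sub>j = \<Sum>\<^sub>k u\<^sub>i\<^sub>k \<otimes> u\<^sub>k\<^sub>j\<close>.  The case \<open>n = 0\<close> (the zero representation) is included.
\<close>

definition opmat_mult :: "'i op mat \<Rightarrow> 'i op mat \<Rightarrow> 'i op mat" where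
  "opmat_mult u v = mat (dim_row u) (dim_col v) (\<lambda>(i, j). \<Sum>k<dim_col u. u $$ (i, k) \<circ> v $$ (k, j))"

definition opmat_one :: "nat \<Rightarrow> 'i op mat" where
  "opmat_one n = mat n n (\<lambda>(i, j). if i = j then id_op else 0)"

definition opmat_adj :: "'i op mat \<Rightarrow> 'i op mat" where
  "opmat_adj u = mat (dim_col u) (dim_row u) (\<lambda>(i, j). op_adj (u $$ (j, i)))"

definition fd_rep :: "'i op set \<Rightarrow> ('i op \<Rightarrow> ('i \<times> 'i) op) \<Rightarrow> 'i op mat \<Rightarrow> bool" where
  "fd_rep A \<Delta> u \<longleftrightarrow> (let n = dim_row u in
     u \<in> carrier_mat n n \<and> elements_mat u \<subseteq> A \<and>
     (\<forall>i<n. \<forall>j<n. \<Delta> (u $$ (i, j)) = (\<Sum>k<n. op_tensor (u $$ (i, k)) (u $$ (k, j)))) \<and>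
     (\<exists>w \<in> carrier_mat n n. elements_mat w \<subseteq> A \<and>
        opmat_mult u w = opmat_one n \<and> opmat_mult w u = opmat_one n))"

definition unitary_fd_rep :: "'i op set \<Rightarrow> ('i op \<Rightarrow> ('i \<times> 'i) op) \<Rightarrow> 'i op mat \<Rightarrow> bool" where
  "unitary_fd_rep A \<Delta> u \<longleftrightarrow> fd_rep A \<Delta> u \<and>
     opmat_mult u (opmat_adj u) = opmat_one (dim_row u) \<and>
     opmat_mult (opmat_adj u) u = opmat_one (dim_row u)"

definition intertwiner :: "'i op mat \<Rightarrow> 'i op mat \<Rightarrow> complex mat \<Rightarrow> bool" where
  "intertwiner u v T \<longleftrightarrow> T \<in> carrier_mat (dim_row v) (dim_row u) \<and>
     (\<forall>i<dim_row v. \<forall>j<dim_row u.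
        (\<Sum>k<dim_row u. op_scale (T $$ (i, k)) (u $$ (k, j))) =
        (\<Sum>k<dim_row v. op_scale (T $$ (k, j)) (v $$ (i, k))))"

definition mat_image :: "complex mat \<Rightarrow> complex vec set" where
  "mat_image T = (\<lambda>x. T *\<^sub>v x) ` carrier_vec (dim_col T)"

text \<open>\<open>0 \<rightarrow> u' \<rightarrow> u \<rightarrow> u'' \<rightarrow> 0\<close> is exact for some choice of morphisms.\<close>

definition short_exact :: "'i op mat \<Rightarrow> 'i op mat \<Rightarrow> 'i op mat \<Rightarrow> bool" where
  "short_exact u' u u'' \<longleftrightarrow> (\<exists>S T. intertwiner u' u S \<and> intertwiner u u'' T \<and>
     mat_kernel S = {0\<^sub>v (dim_row u')} \<and> mat_image S = mat_kernel T \<and>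
     mat_image T = carrier_vec (dim_row u''))"

text \<open>
  The tensor product of representations on \<open>\<complex>\<^sup>n \<otimes> \<complex>\<^sup>m\<close>, with the basis vector \<open>e\<^sub>i \<otimes> e\<^sub>k\<close> numbered
  \<open>i * m + k\<close>.  With this numbering the product is strictly associative and unital.
\<close>

definition rep_tensor :: "'i op mat \<Rightarrow> 'i op mat \<Rightarrow> 'i op mat" where
  "rep_tensor u v = (let n = dim_row u; m = dim_row v in
     mat (n * m) (n * m) (\<lambda>(p, q). u $$ (p div m, q div m) \<circ> v $$ (p mod m, q mod m)))"

definition rep_monoid :: "'i op set \<Rightarrow> ('i op \<Rightarrow> ('i \<times> 'i) op) \<Rightarrow> 'i op mat monoid" where
  "rep_monoid A \<Delta> = \<lparr>carrier = {u. fd_rep A \<Delta> u}, mult = rep_tensor, one = opmat_one 1\<rparr>"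


section \<open>Associative algebras\<close>

text \<open>
  An algebra over \<open>'k\<close> is represented by a record \<open>('k, 'a) module\<close>, that is, a (not necessarily
  commutative) ring together with a scalar multiplication.
\<close>

definition monoid_algebra :: "('m, 'b) monoid_scheme \<Rightarrow> ('k::comm_ring_1, 'm \<Rightarrow>\<^sub>0 'k) module" where
  "monoid_algebra M =
     \<lparr>carrier = {f. Poly_Mapping.keys f \<subseteq> carrier M},
      mult = (\<lambda>f g. \<Sum>a\<in>Poly_Mapping.keys f. \<Sum>b\<in>Poly_Mapping.keys g.
         Poly_Mapping.single (a \<otimes>\<^bsub>M\<^esub> b) (Poly_Mapping.lookup f a * Poly_Mapping.lookup g b)),
      one = Poly_Mapping.single \<one>\<^bsub>M\<^esub> 1,
      zero = 0,
      add = (+),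
      smult = (\<lambda>c. Poly_Mapping.map ((*) c))\<rparr>"

definition quotient_algebra :: "('k, 'a) module \<Rightarrow> 'a set \<Rightarrow> ('k, 'a set) module" where
  "quotient_algebra B I =
     ring.extend (B Quot I) \<lparr>smult = (\<lambda>c X. \<Union>x\<in>X. I +>\<^bsub>B\<^esub> (c \<odot>\<^bsub>B\<^esub> x))\<rparr>"

inductive_set generated_subalgebra :: "('k, 'a) module \<Rightarrow> 'a set \<Rightarrow> 'a set" for B S where
  incl: "x \<in> S \<Longrightarrow> x \<in> generated_subalgebra B S"
| one: "\<one>\<^bsub>B\<^esub> \<in> generated_subalgebra B S"
| add: "x \<in> generated_subalgebra B S \<Longrightarrow> y \<in> generated_subalgebra B S \<Longrightarrow>
    x \<oplus>\<^bsub>B\<^esub> y \<in> generated_subalgebra B S"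
| mult: "x \<in> generated_subalgebra B S \<Longrightarrow> y \<in> generated_subalgebra B S \<Longrightarrow>
    x \<otimes>\<^bsub>B\<^esub> y \<in> generated_subalgebra B S"
| smult: "x \<in> generated_subalgebra B S \<Longrightarrow> c \<odot>\<^bsub>B\<^esub> x \<in> generated_subalgebra B S"

definition finitely_generated_algebra :: "('k, 'a) module \<Rightarrow> bool" where
  "finitely_generated_algebra B \<longleftrightarrow>
     (\<exists>S. finite S \<and> S \<subseteq> carrier B \<and> generated_subalgebra B S = carrier B)"

definition algebra_hom :: "('k, 'a) module \<Rightarrow> ('k, 'b) module \<Rightarrow> ('a \<Rightarrow> 'b) set" where
  "algebra_hom B C =
     {f \<in> Ring.ring_hom B C. \<forall>c. \<forall>x\<in>carrier B. f (c \<odot>\<^bsub>B\<^esub> x) = c \<odot>\<^bsub>C\<^esub> f x}"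

text \<open>The free algebra on \<open>n\<close> noncommuting generators is the algebra of the monoid of words.\<close>

definition free_algebra :: "nat \<Rightarrow> ('k::comm_ring_1, nat list \<Rightarrow>\<^sub>0 'k) module" where
  "free_algebra n = monoid_algebra \<lparr>carrier = lists {..<n}, mult = (@), one = []\<rparr>"

definition finitely_presented_algebra :: "('k::comm_ring_1, 'a) module \<Rightarrow> bool" where
  "finitely_presented_algebra B \<longleftrightarrow>
     (\<exists>n F. \<exists>\<phi> \<in> algebra_hom (free_algebra n) B.
        \<phi> ` carrier (free_algebra n :: ('k, _) module) = carrier B \<and>
        finite F \<and> F \<subseteq> carrier (free_algebra n) \<and>
        a_kernel (free_algebra n) B \<phi> = Idl\<^bsub>free_algebra n\<^esub> F)"

text \<open>
  For a ring \<open>R\<close>, \<open>\<complex> \<otimes>\<^sub>\<int> R\<close> is presented by the symbols \<open>c \<otimes> x = single x c\<close>.  Additivity in \<open>c\<close>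
  and the multiplication \<open>(c \<otimes> x) (d \<otimes> y) = c d \<otimes> x y\<close> are built into the monoid algebra of the
  multiplicative monoid of \<open>R\<close>; additivity in \<open>x\<close> is imposed by the quotient.
\<close>

definition complexification :: "('r, 'b) ring_scheme \<Rightarrow> (complex, ('r \<Rightarrow>\<^sub>0 complex) set) module" where
  "complexification R = quotient_algebra (monoid_algebra R)
     (generate (add_monoid (monoid_algebra R))
       {Poly_Mapping.single (x \<oplus>\<^bsub>R\<^esub> y) c - Poly_Mapping.single x c - Poly_Mapping.single y c
         | x y c. x \<in> carrier R \<and> y \<in> carrier R})"


section \<open>The CQG algebra and the fusion ring\<close>

definition cqg_algebra ::
    "'i op set \<Rightarrow> ('i op \<Rightarrow> ('i \<times> 'i) op) \<Rightarrow> (complex, 'i op) module" where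
  "cqg_algebra A \<Delta> =
     \<lparr>carrier = ops.span (\<Union>u\<in>{u. unitary_fd_rep A \<Delta> u}. elements_mat u),
      mult = (\<circ>), one = id_op, zero = 0, add = (+), smult = op_scale\<rparr>"

text \<open>
  The Grothendieck group: the free abelian group on the representations modulo \<open>[u] = [u'] + [u'']\<close>
  for every short exact sequence.  Isomorphic representations are identified by the sequences with
  \<open>u'\<close> the zero representation.
\<close>

definition fusion_ring ::
    "'i op set \<Rightarrow> ('i op \<Rightarrow> ('i \<times> 'i) op) \<Rightarrow> ('i op mat \<Rightarrow>\<^sub>0 int) set ring" where
  "fusion_ring A \<Delta> = monoid_algebra (rep_monoid A \<Delta>) Quot
     generate (add_monoid (monoid_algebra (rep_monoid A \<Delta>) :: (int, _) module))
       {Poly_Mapping.single u 1 - Poly_Mapping.single u' 1 - Poly_Mapping.single u'' 1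
         | u' u u''. fd_rep A \<Delta> u' \<and> fd_rep A \<Delta> u \<and> fd_rep A \<Delta> u'' \<and> short_exact u' u u''}"

end

theory Submission
  imports Defs "HOL-Analysis.L2_Norm"
begin

text \<open>
  Let \<open>W\<close> be the free product of three groups of order two, with generators \<open>a\<close>, \<open>b\<close>, \<open>x\<close>, and let \<open>\<sigma>\<close> be the
  automorphism that exchanges \<open>a\<close> and \<open>b\<close>.  The group of order two acts through \<open>\<sigma>\<close> on the compact quantum
  group dual to \<open>W\<close>, and the example is the resulting semidirect product.  Its C*-algebra is
  \<open>C*(W) \<otimes> \<complex>\<^sup>2\<close>, with the reduced group C*-algebra, generated by elements \<open>\<lambda>\<^sub>g \<delta>\<^sub>k\<close> with \<open>g\<close> in \<open>W\<close> and \<open>k\<close> in \<open>\<int>/2\<close>,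
  and only the comultiplication
  \<open>\<Delta> (\<lambda>\<^sub>g \<delta>\<^sub>k) = \<Sum>a + b = k. \<lambda>\<^sub>g \<delta>\<^sub>a \<otimes> \<lambda>\<^bsub>\<sigma>\<^sup>a g\<^esub> \<delta>\<^sub>b\<close> involves \<open>\<sigma>\<close>.

  The CQG algebra is the linear span of the elements \<open>\<lambda>\<^sub>g \<delta>\<^sub>k\<close> (\<open>cqg_carrier\<close>).  The Fourier coefficients of a
  representation at \<open>k = 0\<close> are orthogonal idempotent matrices \<open>P\<^sub>g\<close>; a nonzero idempotent has an entry bounded
  away from zero, and the coefficients are square-summable, so only finitely many \<open>P\<^sub>g\<close> are nonzero.  As an
  algebra this span is the group algebra of \<open>W \<times> \<int>/2\<close>, and \<open>W\<close> is finitely presented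
  (\<open>finitely_presented_cqg_algebra\<close>).

  A representation amounts to a \<open>\<sigma>\<close>-equivariant vector bundle over \<open>W\<close> with finite support, so the fusion algebra
  maps onto the \<open>\<sigma>\<close>-invariants of the group algebra \<open>\<complex>[W]\<close> by taking \<open>u\<close> to \<open>\<Sum>g. tr P\<^sub>g g\<close>.  This algebra of
  invariants is not finitely generated.  Let \<open>q\<close> be a function on \<open>W\<close> with values in \<open>\<complex>[s]\<close> such that
  \<open>q (g h) + q (g (\<sigma> h)) = 2 q g + 2 q h\<close>.  Then \<open>E g = 1 + q g\<close> satisfies d'Alembert's equation
  \<open>E (g h) + E (g (\<sigma> h)) = 2 E g E h\<close> in the ring \<open>\<complex> \<oplus> \<complex>[s]\<close> in which products of elements of \<open>\<complex>[s]\<close> vanish, and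
  this equation says exactly that \<open>E\<close> extends to a ring homomorphism on the invariants.  The image of a finitely
  generated algebra in this ring has bounded degree.  Hence it is enough to find \<open>q\<close> of unbounded degree
  (\<open>fusion_algebra_not_finitely_generated\<close>).  Such a \<open>q\<close> comes from a cocycle \<open>c\<close> on \<open>W\<close> with values in a
  representation of the infinite dihedral group over \<open>\<complex>[s]\<close> and with \<open>c (\<sigma> g) = - c g\<close>
  (\<open>spherical_dAlembert\<close>, \<open>spherical_unbounded\<close>).
\<close>

section \<open>Square-summable families and bounded operators\<close>

abbreviation l2_on :: "'i set \<Rightarrow> ('i \<Rightarrow> complex) \<Rightarrow> real" where
  "l2_on F x \<equiv> L2_set (\<lambda>i. cmod (x i)) F"

lemma ell2_norm_nonneg [simp]: "0 \<le> ell2_norm x"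
  by (simp add: ell2_norm_def infsum_nonneg)

text \<open>Norms are estimated on finite sets of coordinates, where the classical inequalities apply
  without regard to convergence.\<close>

lemma ell2_norm_le:
  assumes "\<And>F. finite F \<Longrightarrow> l2_on F x \<le> C"
  shows "x \<in> ell2" and "ell2_norm x \<le> C"
proof -
  have C: "0 \<le> C"
    using assms[of "{}"] by simp
  have bound: "(\<Sum>i\<in>F. (cmod (x i))\<^sup>2) \<le> C\<^sup>2" if "finite F" for F
    using assms[OF that] C unfolding L2_set_def by (metis real_sqrt_le_iff real_sqrt_abs abs_of_nonneg)
  have sm: "(\<lambda>i. (cmod (x i))\<^sup>2) summable_on UNIV"
    by (rule nonneg_bdd_above_summable_on) (auto intro!: bdd_aboveI2 bound)
  then show "x \<in> ell2"
    by (simp add: ell2_def)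
  have "(\<Sum>\<^sub>\<infinity>i. (cmod (x i))\<^sup>2) \<le> C\<^sup>2"
    by (rule infsum_le_finite_sums[OF sm]) (auto intro: bound)
  then show "ell2_norm x \<le> C"
    unfolding ell2_norm_def using C by (metis real_sqrt_le_iff real_sqrt_abs abs_of_nonneg)
qed

lemma l2_on_le_norm:
  assumes "x \<in> ell2" "finite F"
  shows "l2_on F x \<le> ell2_norm x"
  unfolding L2_set_def ell2_norm_def real_sqrt_le_iff
  using assms by (intro finite_sum_le_infsum) (auto simp: ell2_def)

lemma cmod_le_ell2_norm:
  assumes "x \<in> ell2"
  shows "cmod (x i) \<le> ell2_norm x"
  using l2_on_le_norm[OF assms, of "{i}"] by simp

lemma l2_on_add: "l2_on F (\<lambda>i. x i + y i) \<le> l2_on F x + l2_on F y"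
proof -
  have "l2_on F (\<lambda>i. x i + y i) \<le> L2_set (\<lambda>i. cmod (x i) + cmod (y i)) F"
    by (rule L2_set_mono) (auto simp: norm_triangle_ineq)
  also have "\<dots> \<le> l2_on F x + l2_on F y"
    by (rule L2_set_triangle_ineq)
  finally show ?thesis .
qed

lemma ell2_add:
  assumes "x \<in> ell2" "y \<in> ell2"
  shows "x + y \<in> ell2" and "ell2_norm (x + y) \<le> ell2_norm x + ell2_norm y"
proof -
  have "l2_on F (x + y) \<le> ell2_norm x + ell2_norm y" if "finite F" for F
    using l2_on_add[of x y F] l2_on_le_norm[OF assms(1) that] l2_on_le_norm[OF assms(2) that] by (simp add: plus_fun_def)
  then show "x + y \<in> ell2" "ell2_norm (x + y) \<le> ell2_norm x + ell2_norm y"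
    by (intro ell2_norm_le; blast)+
qed

lemma l2_on_scale: "l2_on F (\<lambda>i. c * x i) = cmod c * l2_on F x"
  by (simp add: L2_set_right_distrib norm_mult)

lemma ell2_scale:
  assumes "x \<in> ell2"
  shows "(\<lambda>i. c * x i) \<in> ell2" and "ell2_norm (\<lambda>i. c * x i) = cmod c * ell2_norm x"
proof -
  have le: "(\<lambda>i. d * z i) \<in> ell2 \<and> ell2_norm (\<lambda>i. d * z i) \<le> cmod d * ell2_norm z"
    if "z \<in> ell2" for d and z :: "'a \<Rightarrow> complex"
  proof -
    have "l2_on F (\<lambda>i. d * z i) \<le> cmod d * ell2_norm z" if "finite F" for F
      using l2_on_le_norm[OF \<open>z \<in> ell2\<close> that] by (simp add: l2_on_scale mult_left_mono)
    then show ?thesis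
      by (intro conjI ell2_norm_le)
  qed
  show "(\<lambda>i. c * x i) \<in> ell2"
    using le[OF assms] by blast
  show "ell2_norm (\<lambda>i. c * x i) = cmod c * ell2_norm x"
  proof (cases "c = 0")
    case True
    then show ?thesis by (simp add: ell2_norm_def)
  next
    case False
    have "ell2_norm x \<le> cmod (inverse c) * ell2_norm (\<lambda>i. c * x i)"
      using le[of "\<lambda>i. c * x i" "inverse c"] le[OF assms, of c] False by (simp add: mult.assoc[symmetric])
    then have "cmod c * ell2_norm x \<le> ell2_norm (\<lambda>i. c * x i)"
      using False by (simp add: norm_inverse norm_divide field_simps)
    then show ?thesis
      using le[OF assms, of c] by auto
  qed
qed

lemma ell2_zero [simp]: "0 \<in> ell2" "(\<lambda>i. 0) \<in> ell2" "ell2_norm 0 = 0" "ell2_norm (\<lambda>i. 0) = 0"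
  by (simp_all add: ell2_def ell2_norm_def)

lemma ell2_uminus:
  assumes "x \<in> ell2"
  shows "- x \<in> ell2" and "ell2_norm (- x) = ell2_norm x"
  using ell2_scale[OF assms, of "-1"] by (simp_all add: fun_Compl_def)

lemma ell2_diff:
  assumes "x \<in> ell2" "y \<in> ell2"
  shows "x - y \<in> ell2" and "ell2_norm (x - y) \<le> ell2_norm x + ell2_norm y"
  using ell2_add[OF assms(1) ell2_uminus(1)[OF assms(2)]] ell2_uminus(2)[OF assms(2)] by auto

lemma ell2_sum: "(\<And>j. j \<in> F \<Longrightarrow> f j \<in> ell2) \<Longrightarrow> sum f F \<in> ell2"
  by (induction F rule: infinite_finite_induct) (auto intro: ell2_add)

definition delta :: "'i \<Rightarrow> 'i \<Rightarrow> complex" where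
  "delta j = (\<lambda>i. if i = j then 1 else 0)"

lemma delta_apply: "delta j i = (if i = j then 1 else 0)"
  by (simp add: delta_def)

definition restrict_to :: "'i set \<Rightarrow> ('i \<Rightarrow> complex) \<Rightarrow> 'i \<Rightarrow> complex" where
  "restrict_to F x = (\<lambda>i. if i \<in> F then x i else 0)"

lemma l2_on_mono_set: "F \<subseteq> G \<Longrightarrow> finite G \<Longrightarrow> l2_on F x \<le> l2_on G x"
  unfolding L2_set_def by (auto intro: sum_mono2)

lemma restrict_to_finite:
  assumes "finite F"
  shows "restrict_to F x \<in> ell2" and "ell2_norm (restrict_to F x) = l2_on F x"
proof -
  have "l2_on G (restrict_to F x) \<le> l2_on F x" if "finite G" for G
  proof -
    have "l2_on G (restrict_to F x) \<le> l2_on (G \<union> F) (restrict_to F x)"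
      using assms that by (intro l2_on_mono_set) auto
    also have "\<dots> = l2_on F x"
      unfolding L2_set_def restrict_to_def using assms that
      by (intro arg_cong[where f = sqrt] sum.mono_neutral_cong_right) auto
    finally show ?thesis .
  qed
  then show 1: "restrict_to F x \<in> ell2" and "ell2_norm (restrict_to F x) = l2_on F x"
    using ell2_norm_le[of "restrict_to F x" "l2_on F x"] l2_on_le_norm[OF _ assms, of "restrict_to F x"]
    by (auto simp: restrict_to_def cong: L2_set_cong intro!: antisym)
qed

lemma delta_ell2 [simp]: "delta j \<in> ell2" and norm_delta [simp]: "ell2_norm (delta j) = 1"
proof -
  have "delta j = restrict_to {j} (\<lambda>_. 1)"
    by (auto simp: delta_def restrict_to_def)
  then show "delta j \<in> ell2" "ell2_norm (delta j) = 1"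
    using restrict_to_finite[of "{j}" "\<lambda>_. 1"] by simp_all
qed

lemma sum_apply: "(sum f F) i = (\<Sum>j\<in>F. f j i)"
  by (induction F rule: infinite_finite_induct) auto

lemma restrict_to_sum: "finite F \<Longrightarrow> restrict_to F x = (\<Sum>j\<in>F. (\<lambda>i. x j * delta j i))"
  by (simp add: restrict_to_def delta_def fun_eq_iff sum_apply if_distrib cong: if_cong)

lemma restrict_to_approx:
  assumes "x \<in> ell2" "0 < e"
  obtains F where "finite F" "ell2_norm (x - restrict_to F x) \<le> e"
proof -
  have sm: "(\<lambda>i. (cmod (x i))\<^sup>2) summable_on UNIV"
    using assms(1) by (simp add: ell2_def)
  obtain F where F: "finite F" and near: "dist (\<Sum>i\<in>F. (cmod (x i))\<^sup>2) (\<Sum>\<^sub>\<infinity>i. (cmod (x i))\<^sup>2) \<le> e\<^sup>2"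
    using infsum_finite_approximation[OF sm, of "e\<^sup>2"] assms(2) by auto
  have "l2_on G (x - restrict_to F x) \<le> e" if G: "finite G" for G
  proof -
    have "(\<Sum>i\<in>G. (cmod ((x - restrict_to F x) i))\<^sup>2) = (\<Sum>i\<in>G - F. (cmod (x i))\<^sup>2)"
      using G by (intro sum.mono_neutral_cong_right) (auto simp: restrict_to_def)
    also have "\<dots> = (\<Sum>i\<in>G \<union> F. (cmod (x i))\<^sup>2) - (\<Sum>i\<in>F. (cmod (x i))\<^sup>2)"
      using sum.union_disjoint[of "G - F" F "\<lambda>i. (cmod (x i))\<^sup>2"] G F by (simp add: Un_Diff_cancel2 Diff_disjoint inf_commute)
    also have "\<dots> \<le> (\<Sum>\<^sub>\<infinity>i. (cmod (x i))\<^sup>2) - (\<Sum>i\<in>F. (cmod (x i))\<^sup>2)"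
      using finite_sum_le_infsum[OF sm, of "G \<union> F"] G F by simp
    also have "\<dots> \<le> e\<^sup>2"
      using near by (simp add: dist_real_def)
    finally show ?thesis
      unfolding L2_set_def using assms(2) by (simp add: real_le_lsqrt sum_nonneg)
  qed
  then show ?thesis
    by (intro that[OF F] ell2_norm_le)
qed

lemma inner_summable:
  assumes "x \<in> ell2" "y \<in> ell2"
  shows "(\<lambda>i. cnj (x i) * y i) summable_on UNIV" and "cmod (ell2_inner x y) \<le> ell2_norm x * ell2_norm y"
proof -
  have bound: "(\<Sum>i\<in>F. norm (cnj (x i) * y i)) \<le> ell2_norm x * ell2_norm y" if "finite F" for F
  proof -
    have "(\<Sum>i\<in>F. norm (cnj (x i) * y i)) = (\<Sum>i\<in>F. \<bar>cmod (x i)\<bar> * \<bar>cmod (y i)\<bar>)"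
      by (simp add: norm_mult)
    also have "\<dots> \<le> l2_on F x * l2_on F y"
      by (rule L2_set_mult_ineq)
    also have "\<dots> \<le> ell2_norm x * ell2_norm y"
      using l2_on_le_norm assms that by (intro mult_mono) auto
    finally show ?thesis .
  qed
  have abs: "(\<lambda>i. norm (cnj (x i) * y i)) summable_on UNIV"
    by (rule nonneg_bdd_above_summable_on) (auto intro!: bdd_aboveI2[where M = "ell2_norm x * ell2_norm y"] bound)
  then show "(\<lambda>i. cnj (x i) * y i) summable_on UNIV"
    by (rule abs_summable_summable)
  have "cmod (ell2_inner x y) \<le> (\<Sum>\<^sub>\<infinity>i. norm (cnj (x i) * y i))"
    unfolding ell2_inner_def by (rule norm_infsum_bound[OF abs])
  also have "\<dots> \<le> ell2_norm x * ell2_norm y"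
    by (rule infsum_le_finite_sums[OF abs]) (auto intro: bound)
  finally show "cmod (ell2_inner x y) \<le> ell2_norm x * ell2_norm y" .
qed

lemma inner_add_left:
  "x \<in> ell2 \<Longrightarrow> x' \<in> ell2 \<Longrightarrow> y \<in> ell2 \<Longrightarrow> ell2_inner (x + x') y = ell2_inner x y + ell2_inner x' y"
  unfolding ell2_inner_def by (simp add: distrib_right infsum_add inner_summable)

lemma inner_add_right:
  "x \<in> ell2 \<Longrightarrow> y \<in> ell2 \<Longrightarrow> y' \<in> ell2 \<Longrightarrow> ell2_inner x (y + y') = ell2_inner x y + ell2_inner x y'"
  unfolding ell2_inner_def by (simp add: distrib_left infsum_add inner_summable)

lemma inner_scale_left: "ell2_inner (\<lambda>i. c * x i) y = cnj c * ell2_inner x y"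
  unfolding ell2_inner_def by (simp add: mult.assoc infsum_cmult_right')

lemma inner_scale_right: "ell2_inner x (\<lambda>i. c * y i) = c * ell2_inner x y"
  unfolding ell2_inner_def by (simp add: mult.left_commute infsum_cmult_right')

lemma inner_zero_left [simp]: "ell2_inner 0 y = 0"
  by (simp add: ell2_inner_def)

lemma inner_sum_left:
  "(\<And>j. j \<in> F \<Longrightarrow> f j \<in> ell2) \<Longrightarrow> y \<in> ell2 \<Longrightarrow> ell2_inner (sum f F) y = (\<Sum>j\<in>F. ell2_inner (f j) y)"
  by (induction F rule: infinite_finite_induct) (auto simp: inner_add_left ell2_sum)

lemma inner_delta_left [simp]: "ell2_inner (delta j) y = y j"
proof -
  have "ell2_inner (delta j) y = (\<Sum>\<^sub>\<infinity>i\<in>{j}. cnj (delta j i) * y i)"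
    unfolding ell2_inner_def by (rule infsum_cong_neutral) (auto simp: delta_def)
  then show ?thesis by (simp add: delta_def)
qed

lemma inner_delta_right [simp]: "ell2_inner x (delta j) = cnj (x j)"
proof -
  have "ell2_inner x (delta j) = (\<Sum>\<^sub>\<infinity>i\<in>{j}. cnj (x i) * delta j i)"
    unfolding ell2_inner_def by (rule infsum_cong_neutral) (auto simp: delta_def)
  then show ?thesis by (simp add: delta_def)
qed

text \<open>The bound is carried along because the operators at hand have no convenient norm: that \<open>S\<close> and \<open>T\<close>
  are \<open>e\<close>-close is \<open>bounded_by e (S - T)\<close>.\<close>

definition bounded_by :: "real \<Rightarrow> 'i op \<Rightarrow> bool" where
  "bounded_by C T \<longleftrightarrow> T \<in> bounded_ops \<and> 0 \<le> C \<and> (\<forall>x\<in>ell2. ell2_norm (T x) \<le> C * ell2_norm x)"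

lemma bounded_opsD:
  assumes "T \<in> bounded_ops"
  shows "x \<in> ell2 \<Longrightarrow> T x \<in> ell2"
    and "x \<in> ell2 \<Longrightarrow> y \<in> ell2 \<Longrightarrow> T (x + y) = T x + T y"
    and "x \<in> ell2 \<Longrightarrow> T (\<lambda>i. c * x i) = (\<lambda>i. c * T x i)"
    and "x \<notin> ell2 \<Longrightarrow> T x = 0"
  using assms by (auto simp: bounded_ops_def)

lemma bounded_byE:
  assumes "T \<in> bounded_ops"
  obtains C where "bounded_by C T"
proof -
  obtain C where C: "\<forall>x\<in>ell2. ell2_norm (T x) \<le> C * ell2_norm x"
    using assms by (auto simp: bounded_ops_def)
  have "ell2_norm (T x) \<le> max C 0 * ell2_norm x" if "x \<in> ell2" for x
    using C that mult_right_mono[of C "max C 0" "ell2_norm x"] by force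
  then show ?thesis
    using that[of "max C 0"] assms by (auto simp: bounded_by_def)
qed

lemma bounded_byI:
  assumes "\<And>x. x \<in> ell2 \<Longrightarrow> T x \<in> ell2"
    and "\<And>x y. x \<in> ell2 \<Longrightarrow> y \<in> ell2 \<Longrightarrow> T (x + y) = T x + T y"
    and "\<And>c x. x \<in> ell2 \<Longrightarrow> T (\<lambda>i. c * x i) = (\<lambda>i. c * T x i)"
    and "\<And>x. x \<notin> ell2 \<Longrightarrow> T x = 0"
    and "0 \<le> C" "\<And>x. x \<in> ell2 \<Longrightarrow> ell2_norm (T x) \<le> C * ell2_norm x"
  shows "bounded_by C T"
  using assms unfolding bounded_by_def bounded_ops_def by blast

lemma bounded_byD:
  assumes "bounded_by C T"
  shows "T \<in> bounded_ops" "0 \<le> C" "x \<in> ell2 \<Longrightarrow> ell2_norm (T x) \<le> C * ell2_norm x"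
  using assms by (auto simp: bounded_by_def)

lemma op_zero [simp]:
  assumes "T \<in> bounded_ops"
  shows "T 0 = 0" "T (\<lambda>_. 0) = 0"
  using bounded_opsD(3)[OF assms ell2_zero(1), of 0] by (simp_all add: zero_fun_def)

lemma op_sum:
  assumes "T \<in> bounded_ops"
  shows "(\<And>j. j \<in> F \<Longrightarrow> f j \<in> ell2) \<Longrightarrow> T (sum f F) = (\<Sum>j\<in>F. T (f j))"
  by (induction F rule: infinite_finite_induct) (auto simp: assms bounded_opsD(2)[OF assms] ell2_sum)

lemma op_restrict_to:
  assumes "T \<in> bounded_ops" "finite F"
  shows "T (restrict_to F x) = (\<Sum>j\<in>F. (\<lambda>i. x j * T (delta j) i))"
  using assms by (simp add: restrict_to_sum op_sum ell2_scale bounded_opsD(3))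

lemma bounded_by_add:
  assumes "bounded_by C S" "bounded_by D T"
  shows "bounded_by (C + D) (S + T)"
proof (rule bounded_byI)
  have B: "S \<in> bounded_ops" "T \<in> bounded_ops"
    using assms by (auto dest: bounded_byD)
  fix x :: "'a \<Rightarrow> complex" and y c
  show "x \<notin> ell2 \<Longrightarrow> (S + T) x = 0"
    using B by (simp add: bounded_opsD(4) fun_eq_iff)
  assume x: "x \<in> ell2"
  show "(S + T) x \<in> ell2"
    using B x by (simp add: bounded_opsD ell2_add)
  show "y \<in> ell2 \<Longrightarrow> (S + T) (x + y) = (S + T) x + (S + T) y"
    using B x by (simp add: bounded_opsD(2) fun_eq_iff)
  show "(S + T) (\<lambda>i. c * x i) = (\<lambda>i. c * (S + T) x i)"
    using B x by (simp add: bounded_opsD(3) plus_fun_def distrib_left)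
  have "ell2_norm ((S + T) x) \<le> ell2_norm (S x) + ell2_norm (T x)"
    using B x by (simp add: bounded_opsD(1) ell2_add)
  then show "ell2_norm ((S + T) x) \<le> (C + D) * ell2_norm x"
    using bounded_byD(3)[OF assms(1) x] bounded_byD(3)[OF assms(2) x] by (simp add: distrib_right)
qed (use assms in \<open>simp add: bounded_byD(2)\<close>)

lemma bounded_by_scale:
  assumes "bounded_by C T"
  shows "bounded_by (cmod c * C) (op_scale c T)"
proof (rule bounded_byI)
  have B: "T \<in> bounded_ops"
    using assms by (auto dest: bounded_byD)
  fix x :: "'a \<Rightarrow> complex" and y d
  show "x \<notin> ell2 \<Longrightarrow> op_scale c T x = 0"
    using B by (simp add: bounded_opsD(4) op_scale_def fun_eq_iff)
  assume x: "x \<in> ell2"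
  show "op_scale c T x \<in> ell2"
    using B x by (simp add: bounded_opsD ell2_scale op_scale_def)
  show "y \<in> ell2 \<Longrightarrow> op_scale c T (x + y) = op_scale c T x + op_scale c T y"
    using B x by (simp add: bounded_opsD(2) op_scale_def fun_eq_iff distrib_left)
  show "op_scale c T (\<lambda>i. d * x i) = (\<lambda>i. d * op_scale c T x i)"
    using B x by (simp add: bounded_opsD(3) op_scale_def mult.left_commute)
  show "ell2_norm (op_scale c T x) \<le> cmod c * C * ell2_norm x"
    using bounded_byD(3)[OF assms x] B x
    by (simp add: op_scale_def ell2_scale bounded_opsD(1) mult.assoc mult_left_mono)
qed (use assms in \<open>simp add: bounded_byD(2)\<close>)

lemma op_scale_apply: "op_scale c T x i = c * T x i"
  by (simp add: op_scale_def)

lemma op_scale_minus1: "op_scale (- 1) T = - T"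
  by (simp add: op_scale_def fun_eq_iff)

lemma bounded_by_uminus:
  assumes "bounded_by C T"
  shows "bounded_by C (- T)"
  using bounded_by_scale[OF assms, of "-1"] by (simp add: op_scale_minus1)

lemma bounded_by_diff:
  assumes "bounded_by C S" "bounded_by D T"
  shows "bounded_by (C + D) (S - T)"
  using bounded_by_add[OF assms(1) bounded_by_uminus[OF assms(2)]] by simp

lemma bounded_by_comp:
  assumes "bounded_by C S" "bounded_by D T"
  shows "bounded_by (C * D) (S \<circ> T)"
proof (rule bounded_byI)
  have B: "S \<in> bounded_ops" "T \<in> bounded_ops"
    using assms by (auto dest: bounded_byD)
  fix x :: "'a \<Rightarrow> complex" and y c
  show "x \<notin> ell2 \<Longrightarrow> (S \<circ> T) x = 0"
    using B by (simp add: bounded_opsD(4) fun_eq_iff)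
  assume x: "x \<in> ell2"
  show "(S \<circ> T) x \<in> ell2"
    using B x by (simp add: bounded_opsD)
  show "y \<in> ell2 \<Longrightarrow> (S \<circ> T) (x + y) = (S \<circ> T) x + (S \<circ> T) y"
    using B x by (simp only: o_apply bounded_opsD)
  show "(S \<circ> T) (\<lambda>i. c * x i) = (\<lambda>i. c * (S \<circ> T) x i)"
    using B x by (simp add: bounded_opsD)
  show "ell2_norm ((S \<circ> T) x) \<le> C * D * ell2_norm x"
    using bounded_byD(3)[OF assms(1), of "T x"] bounded_byD(3)[OF assms(2) x] B x
      mult_left_mono[of "ell2_norm (T x)" "D * ell2_norm x" C] bounded_byD(2)[OF assms(1)]
    by (simp add: bounded_opsD(1) mult.assoc)
qed (use assms in \<open>simp add: bounded_byD(2)\<close>)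

lemma bounded_by_id: "bounded_by 1 id_op"
  by (rule bounded_byI) (auto simp: id_op_def ell2_add ell2_scale)

lemma bounded_by_zero: "bounded_by 0 0"
  by (rule bounded_byI) (auto simp: fun_eq_iff)

lemma bounded_by_mono: "bounded_by C T \<Longrightarrow> C \<le> D \<Longrightarrow> bounded_by D T"
  unfolding bounded_by_def by (meson dual_order.trans ell2_norm_nonneg mult_right_mono)

lemma bounded_ops_closed [simp, intro]:
  "S \<in> bounded_ops \<Longrightarrow> T \<in> bounded_ops \<Longrightarrow> S + T \<in> bounded_ops"
  "S \<in> bounded_ops \<Longrightarrow> T \<in> bounded_ops \<Longrightarrow> S - T \<in> bounded_ops"
  "S \<in> bounded_ops \<Longrightarrow> T \<in> bounded_ops \<Longrightarrow> S \<circ> T \<in> bounded_ops"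
  "T \<in> bounded_ops \<Longrightarrow> op_scale c T \<in> bounded_ops"
  "id_op \<in> bounded_ops"
  "0 \<in> bounded_ops"
proof -
  show "id_op \<in> bounded_ops" "0 \<in> bounded_ops"
    by (rule bounded_byD[OF bounded_by_id], rule bounded_byD[OF bounded_by_zero])
  show "op_scale c T \<in> bounded_ops" if "T \<in> bounded_ops"
    by (rule bounded_byE[OF that]) (rule bounded_byD[OF bounded_by_scale])
  show "S + T \<in> bounded_ops" "S - T \<in> bounded_ops" "S \<circ> T \<in> bounded_ops"
    if S: "S \<in> bounded_ops" and T: "T \<in> bounded_ops"
  proof -
    obtain C D where CD: "bounded_by C S" "bounded_by D T"
      using bounded_byE[OF S] bounded_byE[OF T] by metis
    show "S + T \<in> bounded_ops" "S - T \<in> bounded_ops" "S \<circ> T \<in> bounded_ops"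
      using bounded_by_add[OF CD] bounded_by_diff[OF CD] bounded_by_comp[OF CD] by (auto dest: bounded_byD(1))
  qed
qed

lemma bounded_ops_subspace: "ops.subspace bounded_ops"
  by (rule ops.subspaceI) auto

lemma op_span_bounded: "B \<subseteq> bounded_ops \<Longrightarrow> ops.span B \<subseteq> bounded_ops"
  by (rule ops.span_minimal) (auto intro: bounded_ops_subspace)

lemma comp_add_left: "(S + S') \<circ> T = (S \<circ> T) + (S' \<circ> T)" for S S' T :: "'i op"
  by (simp add: fun_eq_iff)

lemma comp_scale_left: "op_scale c S \<circ> T = op_scale c (S \<circ> T)"
  by (simp add: fun_eq_iff op_scale_def)

lemma comp_add_right:
  assumes "S \<in> bounded_ops" "T \<in> bounded_ops" "T' \<in> bounded_ops"
  shows "S \<circ> (T + T') = (S \<circ> T) + (S \<circ> T')"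
proof
  fix x
  have "T x \<in> ell2" "T' x \<in> ell2"
    using assms by (cases "x \<in> ell2"; simp add: bounded_opsD)+
  then have "S (T x + T' x) = S (T x) + S (T' x)"
    by (rule bounded_opsD(2)[OF assms(1)])
  then show "(S \<circ> (T + T')) x = ((S \<circ> T) + (S \<circ> T')) x"
    by simp
qed

lemma comp_scale_right:
  assumes "S \<in> bounded_ops" "T \<in> bounded_ops"
  shows "S \<circ> op_scale c T = op_scale c (S \<circ> T)"
proof
  fix x
  have "T x \<in> ell2"
    using assms by (cases "x \<in> ell2") (simp_all add: bounded_opsD)
  then show "(S \<circ> op_scale c T) x = op_scale c (S \<circ> T) x"
    using assms by (simp add: op_scale_def bounded_opsD)
qed

lemma comp_id_op:
  assumes "T \<in> bounded_ops"
  shows "T \<circ> id_op = T" "id_op \<circ> T = T"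
proof -
  have "T x \<in> ell2" for x
    using assms by (cases "x \<in> ell2") (simp_all add: bounded_opsD)
  then show "T \<circ> id_op = T" "id_op \<circ> T = T"
    using assms by (simp_all add: fun_eq_iff id_op_def bounded_opsD(4))
qed

text \<open>The finitely supported vectors are dense.\<close>

lemma functional_eq_0:
  assumes x: "x \<in> ell2"
    and add: "\<And>x y. x \<in> ell2 \<Longrightarrow> y \<in> ell2 \<Longrightarrow> f (x + y) = f x + f y"
    and scale: "\<And>c x. x \<in> ell2 \<Longrightarrow> f (\<lambda>i. c * x i) = c * f x"
    and bound: "\<And>x. x \<in> ell2 \<Longrightarrow> cmod (f x) \<le> C * ell2_norm x"
    and zero: "\<And>j. f (delta j) = 0"
  shows "f x = (0 :: complex)"
proof -
  have "f (\<lambda>i. 0 * delta undefined i) = 0 * f (delta undefined)"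
    by (rule scale) simp
  then have f0: "f 0 = 0"
    by (simp add: zero_fun_def)
  have fin: "f (restrict_to F x) = 0" if F: "finite F" for F
  proof -
    have "f (\<Sum>j\<in>F. (\<lambda>i. x j * delta j i)) = 0"
      using F
    proof (induction F rule: finite_induct)
      case empty
      show ?case unfolding sum.empty by (rule f0)
    next
      case (insert j F)
      have "(\<lambda>i. x j * delta j i) \<in> ell2" "(\<Sum>j\<in>F. (\<lambda>i. x j * delta j i)) \<in> ell2"
        by (intro ell2_scale ell2_sum delta_ell2)+
      then show ?case
        unfolding sum.insert[OF insert.hyps] by (simp only: add insert.IH scale[OF delta_ell2] zero mult_zero_right add_0)
    qed
    then show ?thesis
      by (simp only: restrict_to_sum[OF F])
  qed
  have "cmod (f x) \<le> 0 + e" if e: "0 < e" for e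
  proof -
    have C: "0 < \<bar>C\<bar> + 1" by simp
    then obtain F where F: "finite F" "ell2_norm (x - restrict_to F x) \<le> e / (\<bar>C\<bar> + 1)"
      using restrict_to_approx[OF x, of "e / (\<bar>C\<bar> + 1)"] e by auto
    have d: "x - restrict_to F x \<in> ell2"
      by (simp add: x F restrict_to_finite ell2_diff)
    have "f (x - restrict_to F x + restrict_to F x) = f (x - restrict_to F x) + f (restrict_to F x)"
      by (rule add[OF d restrict_to_finite(1)[OF F(1)]])
    then have "cmod (f x) \<le> C * ell2_norm (x - restrict_to F x)"
      using bound[OF d] fin[OF F(1)] by simp
    also have "\<dots> \<le> (\<bar>C\<bar> + 1) * (e / (\<bar>C\<bar> + 1))"
      using F(2) by (intro mult_mono) auto
    finally show ?thesis
      using C by simp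
  qed
  then have "cmod (f x) \<le> 0"
    by (rule field_le_epsilon)
  then show ?thesis by simp
qed

lemma op_eqI:
  assumes S: "S \<in> bounded_ops" and T: "T \<in> bounded_ops"
    and eq: "\<And>i j. S (delta j) i = T (delta j) i"
  shows "S = T"
proof
  fix x show "S x = T x"
  proof (cases "x \<in> ell2")
    case x: True
    obtain C where C: "bounded_by C (S - T)"
      using S T bounded_byE[of "S - T"] by auto
    have B: "S - T \<in> bounded_ops"
      using S T by blast
    have "(S - T) x i = 0" for i
    proof (rule functional_eq_0[OF x])
      fix x y :: "'a \<Rightarrow> complex" and c
      assume x: "x \<in> ell2"
      show "y \<in> ell2 \<Longrightarrow> (S - T) (x + y) i = (S - T) x i + (S - T) y i"
        unfolding bounded_opsD(2)[OF B x] by simp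
      show "(S - T) (\<lambda>i. c * x i) i = c * (S - T) x i"
        unfolding bounded_opsD(3)[OF B x] by simp
      show "cmod ((S - T) x i) \<le> C * ell2_norm x"
        using cmod_le_ell2_norm[OF bounded_opsD(1)[OF B x]] bounded_byD(3)[OF C x] by (rule order_trans)
    qed (simp add: eq)
    then show ?thesis
      by (auto simp: fun_eq_iff)
  next
    case False
    then show ?thesis
      using S T by (simp add: bounded_opsD)
  qed
qed

text \<open>
  The adjoint exists: the family of the numbers \<open>\<langle>T (delta i), y\<rangle>\<close> is square-summable, because
  over a finite set \<open>F\<close> the sum of its squares is the pairing of \<open>y\<close> with the image under \<open>T\<close> of
  the family itself, restricted to \<open>F\<close>.
\<close>

lemma adjoint_exists:
  assumes T: "bounded_by C T"
  obtains T' where "bounded_by C T'" "\<And>x y. x \<in> ell2 \<Longrightarrow> y \<in> ell2 \<Longrightarrow> ell2_inner (T x) y = ell2_inner x (T' y)"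
proof -
  have TB: "T \<in> bounded_ops"
    using T by (rule bounded_byD)
  define T' where "T' y = (if y \<in> ell2 then (\<lambda>i. ell2_inner (T (delta i)) y) else 0)" for y
  have T'_le: "T' y \<in> ell2 \<and> ell2_norm (T' y) \<le> C * ell2_norm y" if y: "y \<in> ell2" for y
  proof -
    have "l2_on F (T' y) \<le> C * ell2_norm y" if F: "finite F" for F
    proof -
      let ?z = "T' y"
      have "complex_of_real ((l2_on F ?z)\<^sup>2) = (\<Sum>i\<in>F. cnj (?z i) * ?z i)"
        by (simp add: L2_set_def sum_nonneg complex_norm_square mult.commute flip: of_real_power)
      also have "\<dots> = (\<Sum>i\<in>F. ell2_inner (\<lambda>j. ?z i * T (delta i) j) y)"
        using y by (simp add: inner_scale_left T'_def)
      also have "\<dots> = ell2_inner (T (restrict_to F ?z)) y"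
        using TB F y by (simp add: op_restrict_to inner_sum_left ell2_scale bounded_opsD(1))
      finally have "(l2_on F ?z)\<^sup>2 \<le> cmod (ell2_inner (T (restrict_to F ?z)) y)"
        by (metis norm_of_real abs_ge_self)
      also have "\<dots> \<le> ell2_norm (T (restrict_to F ?z)) * ell2_norm y"
        using TB F y by (intro inner_summable) (auto simp: bounded_opsD restrict_to_finite)
      also have "\<dots> \<le> (C * l2_on F ?z) * ell2_norm y"
        using bounded_byD(3)[OF T, of "restrict_to F ?z"] F
        by (intro mult_right_mono) (auto simp: restrict_to_finite)
      finally have "l2_on F ?z * l2_on F ?z \<le> (C * ell2_norm y) * l2_on F ?z"
        by (simp add: power2_eq_square algebra_simps)
      then show ?thesis
        using bounded_byD(2)[OF T] L2_set_nonneg[of "\<lambda>i. cmod (?z i)" F]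
        by (cases "l2_on F ?z = 0") (auto dest: mult_right_le_imp_le)
    qed
    then show ?thesis
      by (intro conjI ell2_norm_le)
  qed
  have 1: "bounded_by C T'"
  proof (rule bounded_byI)
    fix x :: "'a \<Rightarrow> complex" and y c
    show "x \<notin> ell2 \<Longrightarrow> T' x = 0"
      by (simp add: T'_def)
    assume x: "x \<in> ell2"
    show "T' x \<in> ell2" "ell2_norm (T' x) \<le> C * ell2_norm x"
      using T'_le[OF x] by auto
    show "y \<in> ell2 \<Longrightarrow> T' (x + y) = T' x + T' y"
      using x by (simp add: T'_def ell2_add(1) inner_add_right bounded_opsD(1)[OF TB] fun_eq_iff)
    show "T' (\<lambda>i. c * x i) = (\<lambda>i. c * T' x i)"
      using x by (simp add: T'_def ell2_scale inner_scale_right)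
  qed (rule bounded_byD(2)[OF T])
  have T'B: "T' \<in> bounded_ops"
    using 1 by (rule bounded_byD)
  have 2: "ell2_inner (T x) y = ell2_inner x (T' y)" if x: "x \<in> ell2" and y: "y \<in> ell2" for x y
  proof -
    have "cnj (ell2_inner (T x) y - ell2_inner x (T' y)) = 0"
    proof (rule functional_eq_0[OF x])
      fix x x' :: "'a \<Rightarrow> complex" and c
      assume x: "x \<in> ell2"
      note mem = x y bounded_opsD(1)[OF TB x] bounded_opsD(1)[OF T'B y]
      show "cnj (ell2_inner (T (x + x')) y - ell2_inner (x + x') (T' y)) =
          cnj (ell2_inner (T x) y - ell2_inner x (T' y)) + cnj (ell2_inner (T x') y - ell2_inner x' (T' y))" if "x' \<in> ell2"
        using that mem by (simp add: bounded_opsD(1,2)[OF TB] inner_add_left del: plus_fun_apply)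
      show "cnj (ell2_inner (T (\<lambda>i. c * x i)) y - ell2_inner (\<lambda>i. c * x i) (T' y)) =
          c * cnj (ell2_inner (T x) y - ell2_inner x (T' y))"
        using mem by (simp add: bounded_opsD(3)[OF TB] inner_scale_left right_diff_distrib)
      have "cmod (ell2_inner (T x) y) \<le> (C * ell2_norm x) * ell2_norm y"
        using inner_summable(2)[OF mem(3,2)] mult_right_mono[OF bounded_byD(3)[OF T x], of "ell2_norm y"] by simp
      moreover have "cmod (ell2_inner x (T' y)) \<le> ell2_norm x * (C * ell2_norm y)"
        using inner_summable(2)[OF mem(1,4)] mult_left_mono[OF bounded_byD(3)[OF 1 y], of "ell2_norm x"] by simp
      ultimately show "cmod (cnj (ell2_inner (T x) y - ell2_inner x (T' y))) \<le> (2 * C * ell2_norm y) * ell2_norm x"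
        using norm_triangle_ineq4[of "ell2_inner (T x) y" "ell2_inner x (T' y)"]
        by (simp only: complex_mod_cnj) (simp add: algebra_simps)
    qed (use y in \<open>simp add: T'_def\<close>)
    then show ?thesis by simp
  qed
  show ?thesis
    using that 1 2 by blast
qed

lemma op_adj_props:
  assumes T: "bounded_by C T"
  shows "bounded_by C (op_adj T)" and "op_adj T (delta j) i = cnj (T (delta i) j)"
proof -
  obtain T' where T': "bounded_by C T'"
    and adj: "\<And>x y. x \<in> ell2 \<Longrightarrow> y \<in> ell2 \<Longrightarrow> ell2_inner (T x) y = ell2_inner x (T' y)"
    using adjoint_exists[OF T] by blast
  have "op_adj T = T'"
    unfolding op_adj_def
  proof (rule the_equality)
    fix U assume U: "U \<in> bounded_ops \<and> (\<forall>x\<in>ell2. \<forall>y\<in>ell2. ell2_inner (T x) y = ell2_inner x (U y))"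
    have "ell2_inner (delta i) (U (delta j)) = ell2_inner (delta i) (T' (delta j))" for i j
      using U adj by (metis delta_ell2)
    then show "U = T'"
      using U bounded_byD(1)[OF T'] by (intro op_eqI) auto
  qed (use T' adj in \<open>auto dest: bounded_byD\<close>)
  then show "bounded_by C (op_adj T)" "op_adj T (delta j) i = cnj (T (delta i) j)"
    using T' adj[of "delta i" "delta j"] by simp_all
qed

lemma op_adj_bounded [simp, intro]: "T \<in> bounded_ops \<Longrightarrow> op_adj T \<in> bounded_ops"
  by (blast elim: bounded_byE dest: op_adj_props(1) bounded_byD(1))

lemma op_adj_entry: "T \<in> bounded_ops \<Longrightarrow> op_adj T (delta j) i = cnj (T (delta i) j)"
  by (blast elim: bounded_byE dest: op_adj_props(2))

lemma op_adj_eqI: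
  assumes "T \<in> bounded_ops" "T' \<in> bounded_ops" "\<And>i j. T' (delta j) i = cnj (T (delta i) j)"
  shows "op_adj T = T'"
  using assms by (intro op_eqI) (auto simp: op_adj_entry)

lemma op_adj_add: "S \<in> bounded_ops \<Longrightarrow> T \<in> bounded_ops \<Longrightarrow> op_adj (S + T) = op_adj S + op_adj T"
  by (rule op_adj_eqI) (auto simp: op_adj_entry)

lemma op_adj_scale: "T \<in> bounded_ops \<Longrightarrow> op_adj (op_scale c T) = op_scale (cnj c) (op_adj T)"
  by (rule op_adj_eqI) (auto simp: op_adj_entry op_scale_apply)

lemma op_adj_diff: "S \<in> bounded_ops \<Longrightarrow> T \<in> bounded_ops \<Longrightarrow> op_adj (S - T) = op_adj S - op_adj T"
  by (rule op_adj_eqI) (auto simp: op_adj_entry)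

lemma op_entry_bound: "bounded_by C T \<Longrightarrow> cmod (T (delta j) i) \<le> C"
  using bounded_byD(3)[of C T "delta j"] cmod_le_ell2_norm[of "T (delta j)" i]
    bounded_opsD(1)[OF bounded_byD(1), of C T "delta j"] by force

section \<open>Norm closures of operator algebras\<close>

lemma op_closure_bounded: "op_closure S \<subseteq> bounded_ops"
  by (auto simp: op_closure_def)

lemma op_closureI:
  assumes "T \<in> bounded_ops" "\<And>e. 0 < e \<Longrightarrow> \<exists>T'\<in>S. bounded_by e (T - T')"
  shows "T \<in> op_closure S"
  using assms unfolding op_closure_def bounded_by_def by fastforce

lemma op_closureE:
  assumes "T \<in> op_closure S" "S \<subseteq> bounded_ops" "0 < e"
  obtains T' where "T' \<in> S" "bounded_by e (T - T')"
proof -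
  obtain T' where "T' \<in> S" "\<forall>x\<in>ell2. ell2_norm (T x - T' x) \<le> e * ell2_norm x"
    using assms unfolding op_closure_def by blast
  moreover have "T \<in> bounded_ops"
    using assms by (auto simp: op_closure_def)
  ultimately show ?thesis
    using that[of T'] assms by (auto simp: bounded_by_def)
qed

lemma op_closure_incl: "S \<subseteq> bounded_ops \<Longrightarrow> S \<subseteq> op_closure S"
  by (auto intro!: op_closureI bexI bounded_by_mono[OF bounded_by_zero])

lemma op_closure_mono: "S \<subseteq> T \<Longrightarrow> op_closure S \<subseteq> op_closure T"
  by (force simp: op_closure_def)

lemma op_closure_idem:
  assumes "S \<subseteq> bounded_ops"
  shows "op_closure (op_closure S) \<subseteq> op_closure S"
proof
  fix T assume T: "T \<in> op_closure (op_closure S)"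
  show "T \<in> op_closure S"
  proof (rule op_closureI)
    show "T \<in> bounded_ops"
      using T op_closure_bounded by blast
    fix e :: real assume e: "0 < e"
    obtain T1 where T1: "T1 \<in> op_closure S" "bounded_by (e/2) (T - T1)"
      using op_closureE[OF T op_closure_bounded, of "e/2"] e by auto
    obtain T2 where T2: "T2 \<in> S" "bounded_by (e/2) (T1 - T2)"
      using op_closureE[OF T1(1) assms, of "e/2"] e by auto
    show "\<exists>T'\<in>S. bounded_by e (T - T')"
      using T2 bounded_by_add[OF T1(2) T2(2)] by auto
  qed
qed

lemma op_closure_subspace:
  assumes sub: "ops.subspace S" and B: "S \<subseteq> bounded_ops"
  shows "ops.subspace (op_closure S)"
proof (rule ops.subspaceI)
  show "0 \<in> op_closure S"
    using op_closure_incl[OF B] ops.subspace_0[OF sub] by blast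
next
  fix T U assume TU: "T \<in> op_closure S" "U \<in> op_closure S"
  show "T + U \<in> op_closure S"
  proof (rule op_closureI)
    show "T + U \<in> bounded_ops"
      using TU op_closure_bounded by blast
    fix e :: real assume e: "0 < e"
    obtain T1 where T1: "T1 \<in> S" "bounded_by (e/2) (T - T1)"
      using op_closureE[OF TU(1) B, of "e/2"] e by auto
    obtain U1 where U1: "U1 \<in> S" "bounded_by (e/2) (U - U1)"
      using op_closureE[OF TU(2) B, of "e/2"] e by auto
    show "\<exists>T'\<in>S. bounded_by e (T + U - T')"
      using bounded_by_add[OF T1(2) U1(2)] ops.subspace_add[OF sub T1(1) U1(1)]
      by (intro bexI[of _ "T1 + U1"]) (simp_all add: algebra_simps)
  qed
next
  fix c T assume T: "T \<in> op_closure S"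
  show "op_scale c T \<in> op_closure S"
  proof (rule op_closureI)
    show "op_scale c T \<in> bounded_ops"
      using T op_closure_bounded by blast
    fix e :: real assume e: "0 < e"
    have pos: "0 < cmod c + 1" by (simp add: add_nonneg_pos)
    obtain T1 where T1: "T1 \<in> S" "bounded_by (e / (cmod c + 1)) (T - T1)"
      using op_closureE[OF T B, of "e / (cmod c + 1)"] e pos by auto
    have "bounded_by (cmod c * (e / (cmod c + 1))) (op_scale c T - op_scale c T1)"
      using bounded_by_scale[OF T1(2), of c] by (simp add: ops.scale_right_diff_distrib)
    moreover have "cmod c * (e / (cmod c + 1)) \<le> e"
      using e pos by (simp add: field_simps)
    ultimately show "\<exists>T'\<in>S. bounded_by e (op_scale c T - T')"
      using ops.subspace_scale[OF sub T1(1)] bounded_by_mono by blast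
  qed
qed

text \<open>
  A map that multiplies norms by at most \<open>K\<close> takes approximations to approximations.  This reduces each
  inclusion between closures of spans below to a computation with generators.
\<close>

lemma op_closure_map:
  assumes B: "B \<subseteq> bounded_ops" and H: "H \<subseteq> bounded_ops"
    and add: "\<And>S T. S \<in> bounded_ops \<Longrightarrow> T \<in> bounded_ops \<Longrightarrow> f (S + T) = f S + f T"
    and scale: "\<And>c T. T \<in> bounded_ops \<Longrightarrow> f (op_scale c T) = op_scale c (f T)"
    and bound: "\<And>C T. bounded_by C T \<Longrightarrow> bounded_by (K * C) (f T)"
    and gen: "\<And>T. T \<in> B \<Longrightarrow> f T \<in> op_closure (ops.span H)"
    and T: "T \<in> op_closure (ops.span B)"
  shows "f T \<in> op_closure (ops.span H)"
proof -
  have fB: "f S \<in> bounded_ops" if "S \<in> bounded_ops" for S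
    using that by (meson bound bounded_byE bounded_byD(1))
  have SH: "ops.subspace (op_closure (ops.span H))"
    by (intro op_closure_subspace ops.subspace_span op_span_bounded H)
  have "S \<in> bounded_ops \<and> f S \<in> op_closure (ops.span H)" if "S \<in> ops.span B" for S
    using that
  proof (induction rule: ops.span_induct_alt)
    case base
    have "f (op_scale 0 0) = op_scale 0 (f 0)"
      by (rule scale) (rule bounded_ops_closed)
    then have "f 0 = 0"
      by simp
    then have "f 0 \<in> op_closure (ops.span H)"
      using ops.subspace_0[OF SH] by simp
    with bounded_ops_closed(6) show ?case
      by (rule conjI)
  next
    case (step c x y)
    then have xB: "x \<in> bounded_ops" using B by auto
    have "f (op_scale c x + y) = op_scale c (f x) + f y"
      using add[OF bounded_ops_closed(4)[OF xB], of y c] scale[OF xB, of c] step by simp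
    moreover have "op_scale c (f x) + f y \<in> op_closure (ops.span H)"
      using step gen[OF step(1)] by (simp add: ops.subspace_add[OF SH] ops.subspace_scale[OF SH])
    moreover have "op_scale c x + y \<in> bounded_ops"
      using xB step by (intro bounded_ops_closed) auto
    ultimately show ?case
      by (metis (no_types))
  qed
  then have span: "f S \<in> op_closure (ops.span H)" if "S \<in> ops.span B" for S
    using that by blast
  have TB: "T \<in> bounded_ops"
    using T op_closure_bounded by blast
  have "f T \<in> op_closure (op_closure (ops.span H))"
  proof (rule op_closureI)
    show "f T \<in> bounded_ops"
      by (rule fB[OF TB])
    fix e :: real assume e: "0 < e"
    have pos: "0 < \<bar>K\<bar> + 1" by simp
    obtain S where S: "S \<in> ops.span B" "bounded_by (e / (\<bar>K\<bar> + 1)) (T - S)"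
      using op_closureE[OF T op_span_bounded[OF B], of "e / (\<bar>K\<bar> + 1)"] e pos by auto
    have SB: "S \<in> bounded_ops"
      using S op_span_bounded[OF B] by blast
    have "f (T - S) + f S = f T"
      using add[of "T - S" S] TB SB by simp
    then have "bounded_by (K * (e / (\<bar>K\<bar> + 1))) (f T - f S)"
      using bound[OF S(2)] by (metis add_diff_cancel_right')
    moreover have "K * (e / (\<bar>K\<bar> + 1)) \<le> e"
    proof -
      have "K * e \<le> \<bar>K\<bar> * e"
        by (rule mult_right_mono) (use e in auto)
      then have "K * e \<le> e * (\<bar>K\<bar> + 1)"
        unfolding distrib_left mult.commute[of e] using e by linarith
      then show ?thesis
        using pos by (simp add: divide_le_eq)
    qed
    ultimately show "\<exists>T'\<in>op_closure (ops.span H). bounded_by e (f T - T')"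
      using span[OF S(1)] bounded_by_mono by blast
  qed
  then show ?thesis
    using op_closure_idem[OF op_span_bounded[OF H]] by blast
qed

text \<open>
  The product is treated as a linear map in one factor at a time.  The adjoint is only
  conjugate-linear, so that it needs an approximation argument of its own.
\<close>

lemma unital_cstar_algebra_closure:
  assumes B: "B \<subseteq> bounded_ops"
    and one: "id_op \<in> ops.span B"
    and mult: "\<And>S T. S \<in> B \<Longrightarrow> T \<in> B \<Longrightarrow> S \<circ> T \<in> ops.span B"
    and adj: "\<And>T. T \<in> B \<Longrightarrow> op_adj T \<in> ops.span B"
  shows "unital_cstar_algebra (op_closure (ops.span B))"
proof -
  let ?A = "op_closure (ops.span B)"
  have SB: "ops.span B \<subseteq> bounded_ops"
    by (rule op_span_bounded[OF B])
  have sub: "ops.subspace ?A"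
    by (intro op_closure_subspace ops.subspace_span SB)
  have incl: "ops.span B \<subseteq> ?A"
    by (rule op_closure_incl[OF SB])
  have AB: "?A \<subseteq> bounded_ops"
    by (rule op_closure_bounded)
  have comp: "S \<circ> T \<in> ?A" if S: "S \<in> ?A" and T: "T \<in> ?A" for S T
  proof -
    obtain C where C: "bounded_by C T" using T AB bounded_byE by blast
    have right: "S' \<circ> T \<in> ?A" if S': "S' \<in> B" for S'
    proof -
      obtain D where D: "bounded_by D S'" using S' B bounded_byE by blast
      have S'B: "S' \<in> bounded_ops" using S' B by blast
      show ?thesis
      proof (rule op_closure_map[where f = "\<lambda>T. S' \<circ> T" and K = D, OF B B _ _ _ _ T])
        show "S' \<circ> U \<in> ?A" if "U \<in> B" for U
          using mult[OF S' that] incl by blast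
        fix U V :: "'a op" and c d
        assume "U \<in> bounded_ops"
        then show "S' \<circ> op_scale c U = op_scale c (S' \<circ> U)"
          and "V \<in> bounded_ops \<Longrightarrow> S' \<circ> (U + V) = (S' \<circ> U) + (S' \<circ> V)"
          using S'B by (blast intro: comp_scale_right comp_add_right)+
      qed (rule bounded_by_comp[OF D])
    qed
    have bd: "bounded_by (C * c) (U \<circ> T)" if "bounded_by c U" for c U
      using bounded_by_comp[OF that C] by (simp add: mult.commute)
    show ?thesis
      by (rule op_closure_map[where f = "\<lambda>S. S \<circ> T" and K = C, OF B B _ _ _ _ S])
        (rule comp_add_left comp_scale_left bd right; assumption?)+
  qed
  have adjA: "op_adj T \<in> ?A" if T: "T \<in> ?A" for T
  proof (rule op_closureI)
    have spadj: "S \<in> bounded_ops \<and> op_adj S \<in> ops.span B" if "S \<in> ops.span B" for S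
      using that
    proof (induction rule: ops.span_induct_alt)
      case base
      have "op_adj (op_scale 0 (0 :: 'a op)) = op_scale (cnj 0) (op_adj 0)"
        by (rule op_adj_scale) simp
      then have "op_adj (0 :: 'a op) \<in> ops.span B"
        using ops.span_zero[of B] by simp
      with bounded_ops_closed(6) show ?case
        by (rule conjI)
    next
      case (step c x y)
      then have "x \<in> bounded_ops" using B by auto
      moreover have "op_adj (op_scale c x + y) = op_scale (cnj c) (op_adj x) + op_adj y"
        using calculation step by (simp add: op_adj_add op_adj_scale)
      moreover have "op_scale (cnj c) (op_adj x) + op_adj y \<in> ops.span B"
        using step adj[OF step(1)] by (simp add: ops.span_add ops.span_scale)
      moreover have "op_scale c x + y \<in> bounded_ops"
        using calculation step by (intro bounded_ops_closed) auto
      ultimately show ?case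
        by (metis (no_types))
    qed
    show "op_adj T \<in> bounded_ops"
      using T AB by blast
    fix e :: real assume "0 < e"
    then obtain S where S: "S \<in> ops.span B" "bounded_by e (T - S)"
      using op_closureE[OF T SB] by blast
    have "bounded_by e (op_adj T - op_adj S)"
      using op_adj_props(1)[OF S(2)] S(1) SB T AB by (simp add: op_adj_diff subsetD)
    then show "\<exists>T'\<in>ops.span B. bounded_by e (op_adj T - T')"
      using spadj[OF S(1)] by blast
  qed
  show ?thesis
    unfolding unital_cstar_algebra_def
    using AB one incl sub comp adjA op_closure_idem[OF SB]
    by (auto simp: ops.subspace_add ops.subspace_scale)
qed

section \<open>Ampliations of operators along a decomposition into lines\<close>

text \<open>
  A set \<open>'b\<close> fibred into lines, each of which is parametrised by the coordinate \<open>p\<close>: the point with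
  coordinate \<open>a\<close> on the line through \<open>b\<close> is \<open>l b a\<close>.  An operator on \<open>'a\<close> then acts on functions on
  \<open>'b\<close>, line by line.  The operators \<open>S \<otimes> 1\<close> and \<open>1 \<otimes> S\<close>, the comultiplication \<open>\<Delta>\<close> of the quantum group
  and the maps \<open>\<Delta> \<otimes> id\<close> and \<open>id \<otimes> \<Delta>\<close> are all of this form, so that one proof shows them to be bounded
  *-homomorphisms.
\<close>

definition line_fibration :: "('b \<Rightarrow> 'a) \<Rightarrow> ('b \<Rightarrow> 'a \<Rightarrow> 'b) \<Rightarrow> bool" where
  "line_fibration p l \<longleftrightarrow> (\<forall>b a. p (l b a) = a) \<and> (\<forall>b. l b (p b) = b) \<and> (\<forall>b a a'. l (l b a) a' = l b a')"

definition amp :: "('b \<Rightarrow> 'a) \<Rightarrow> ('b \<Rightarrow> 'a \<Rightarrow> 'b) \<Rightarrow> 'a op \<Rightarrow> 'b op" where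
  "amp p l X = (\<lambda>z. if z \<in> ell2 then (\<lambda>b. X (\<lambda>a. z (l b a)) (p b)) else 0)"

lemma line_fibrationD:
  assumes "line_fibration p l"
  shows "p (l b a) = a" "l b (p b) = b" "l (l b a) a' = l b a'"
  using assms by (auto simp: line_fibration_def)

lemma ell2_norm_power2: "(ell2_norm x)\<^sup>2 = (\<Sum>\<^sub>\<infinity>i. (cmod (x i))\<^sup>2)"
  by (simp add: ell2_norm_def infsum_nonneg)

lemma ell2_reindex:
  assumes "inj m" "z \<in> ell2"
  shows "(\<lambda>a. z (m a)) \<in> ell2"
    and "(ell2_norm (\<lambda>a. z (m a)))\<^sup>2 = (\<Sum>\<^sub>\<infinity>b\<in>range m. (cmod (z b))\<^sup>2)"
proof -
  have "(\<lambda>b. (cmod (z b))\<^sup>2) summable_on range m"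
    using assms(2) unfolding ell2_def by (blast intro: summable_on_subset_banach)
  then show "(\<lambda>a. z (m a)) \<in> ell2"
    using summable_on_reindex[OF assms(1), of "\<lambda>b. (cmod (z b))\<^sup>2"] by (simp add: ell2_def o_def)
  show "(ell2_norm (\<lambda>a. z (m a)))\<^sup>2 = (\<Sum>\<^sub>\<infinity>b\<in>range m. (cmod (z b))\<^sup>2)"
    using infsum_reindex[OF assms(1), of "\<lambda>b. (cmod (z b))\<^sup>2"] by (simp add: ell2_norm_power2 o_def)
qed

lemma line_inj: "line_fibration p l \<Longrightarrow> inj (l b)"
  by (metis injI line_fibrationD(1))

lemma line_ell2:
  assumes "line_fibration p l" "z \<in> ell2"
  shows "(\<lambda>a. z (l b a)) \<in> ell2"
  by (rule ell2_reindex(1)[OF line_inj[OF assms(1)] assms(2)])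

text \<open>Different lines are disjoint, so their contributions to the norm add up to at most the whole.\<close>

lemma sum_lines_le:
  assumes lf: "line_fibration p l" and z: "z \<in> ell2" and M: "finite M" "M \<subseteq> range l"
  shows "(\<Sum>m\<in>M. (ell2_norm (\<lambda>a. z (m a)))\<^sup>2) \<le> (ell2_norm z)\<^sup>2"
proof -
  let ?f = "\<lambda>b. (cmod (z b))\<^sup>2"
  have sm: "?f summable_on B" for B
    using z unfolding ell2_def by (blast intro: summable_on_subset_banach)
  have norm: "(ell2_norm (\<lambda>a. z (m a)))\<^sup>2 = infsum ?f (range m)" if m: "m \<in> M" for m
  proof -
    obtain b where "m = l b" using m M(2) by blast
    then show ?thesis
      using ell2_reindex(2)[OF line_inj[OF lf] z] by simp
  qed
  have "(\<Sum>m\<in>M. infsum ?f (range m)) = infsum ?f (\<Union>m\<in>M. range m)"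
    using M
  proof (induction M rule: finite_induct)
    case (insert m M)
    have "range m \<inter> (\<Union>m\<in>M. range m) = {}"
    proof -
      have False if m': "m' \<in> M" and eq: "m a = m' a'" for m' a a'
      proof -
        obtain b b' where "m = l b" "m' = l b'" using m' insert.prems by blast
        then have "m a'' = m' a''" for a''
          using eq line_fibrationD(3)[OF lf] by metis
        then show False
          using insert.hyps m' by (metis ext)
      qed
      then show ?thesis by blast
    qed
    then show ?case
      using insert infsum_Un_disjoint[OF sm sm, of "range m" "\<Union>m\<in>M. range m"] by simp
  qed simp
  also have "\<dots> \<le> infsum ?f UNIV"
    by (rule infsum_mono2) (auto intro: sm)
  finally show ?thesis
    using norm by (simp add: ell2_norm_power2)
qed

lemma bounded_by_amp:
  fixes p :: "'b \<Rightarrow> 'a"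
  assumes lf: "line_fibration p l" and X: "bounded_by C X"
  shows "bounded_by C (amp p l X)"
proof -
  have XB: "X \<in> bounded_ops" and C: "0 \<le> C"
    using X by (auto dest: bounded_byD)
  have le: "l2_on F (amp p l X z) \<le> C * ell2_norm z" if z: "z \<in> ell2" and F: "finite F" for z F
  proof -
    let ?zl = "\<lambda>m a. z (m a)"
    have "(\<Sum>b\<in>F. (cmod (amp p l X z b))\<^sup>2) = (\<Sum>b\<in>F. (cmod (X (?zl (l b)) (p b)))\<^sup>2)"
      using z by (simp add: amp_def)
    also have "\<dots> = (\<Sum>m\<in>l ` F. \<Sum>b\<in>{b \<in> F. l b = m}. (cmod (X (?zl (l b)) (p b)))\<^sup>2)"
      by (rule sum.group[symmetric]) (use F in auto)
    also have "\<dots> \<le> (\<Sum>m\<in>l ` F. C\<^sup>2 * (ell2_norm (?zl m))\<^sup>2)"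
    proof (rule sum_mono)
      fix m assume "m \<in> l ` F"
      then obtain b0 where m: "m = l b0" by blast
      have zm: "?zl m \<in> ell2"
        unfolding m by (rule line_ell2[OF lf z])
      have inj: "inj_on p {b \<in> F. l b = m}"
        by (rule inj_onI) (metis (mono_tags, lifting) mem_Collect_eq line_fibrationD(2)[OF lf])
      have "(\<Sum>b\<in>{b \<in> F. l b = m}. (cmod (X (?zl (l b)) (p b)))\<^sup>2) = (\<Sum>b\<in>{b \<in> F. l b = m}. (cmod (X (?zl m) (p b)))\<^sup>2)"
        by (rule sum.cong) auto
      also have "\<dots> = (\<Sum>a\<in>p ` {b \<in> F. l b = m}. (cmod (X (?zl m) a))\<^sup>2)"
        by (simp add: sum.reindex[OF inj])
      also have "\<dots> = (l2_on (p ` {b \<in> F. l b = m}) (X (?zl m)))\<^sup>2"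
        by (simp add: L2_set_def sum_nonneg)
      also have "\<dots> \<le> (C * ell2_norm (?zl m))\<^sup>2"
        using l2_on_le_norm[OF bounded_opsD(1)[OF XB zm], of "p ` {b \<in> F. l b = m}"] bounded_byD(3)[OF X zm] F
        by (intro power_mono) auto
      finally show "(\<Sum>b\<in>{b \<in> F. l b = m}. (cmod (X (?zl (l b)) (p b)))\<^sup>2) \<le> C\<^sup>2 * (ell2_norm (?zl m))\<^sup>2"
        by (simp add: power_mult_distrib)
    qed
    also have "\<dots> \<le> C\<^sup>2 * (ell2_norm z)\<^sup>2"
      unfolding sum_distrib_left[symmetric] using F by (intro mult_left_mono sum_lines_le[OF lf z]) auto
    finally have "(\<Sum>b\<in>F. (cmod (amp p l X z b))\<^sup>2) \<le> (C * ell2_norm z)\<^sup>2"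
      by (simp add: power_mult_distrib)
    then show ?thesis
      unfolding L2_set_def by (rule real_le_lsqrt[rotated]) (simp add: C)
  qed
  show ?thesis
  proof (rule bounded_byI)
    fix z y :: "'b \<Rightarrow> complex" and c
    show "z \<notin> ell2 \<Longrightarrow> amp p l X z = 0"
      by (simp add: amp_def)
    assume z: "z \<in> ell2"
    show "amp p l X z \<in> ell2" "ell2_norm (amp p l X z) \<le> C * ell2_norm z"
      by (rule ell2_norm_le[OF le[OF z]]; assumption)+
    show "amp p l X (\<lambda>i. c * z i) = (\<lambda>i. c * amp p l X z i)"
      using z by (simp add: amp_def ell2_scale bounded_opsD(3)[OF XB line_ell2[OF lf z]])
    assume y: "y \<in> ell2"
    have "X (\<lambda>a. z (l b a) + y (l b a)) (p b) = X (\<lambda>a. z (l b a)) (p b) + X (\<lambda>a. y (l b a)) (p b)" for b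
      using bounded_opsD(2)[OF XB line_ell2[OF lf z] line_ell2[OF lf y]] by (simp add: plus_fun_def fun_eq_iff)
    then show "amp p l X (z + y) = amp p l X z + amp p l X y"
      using ell2_add(1)[OF z y] z y by (simp add: amp_def fun_eq_iff)
  qed (rule C)
qed

lemma amp_bounded: "line_fibration p l \<Longrightarrow> X \<in> bounded_ops \<Longrightarrow> amp p l X \<in> bounded_ops"
  by (blast elim: bounded_byE dest: bounded_by_amp bounded_byD(1))

lemma amp_add: "amp p l (X + Y) = amp p l X + amp p l Y"
  by (simp add: amp_def fun_eq_iff)

lemma amp_scale: "amp p l (op_scale c X) = op_scale c (amp p l X)"
  by (simp add: amp_def op_scale_def fun_eq_iff)

lemma amp_comp:
  assumes "line_fibration p l" "X \<in> bounded_ops" "Y \<in> bounded_ops"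
  shows "amp p l (X \<circ> Y) = amp p l X \<circ> amp p l Y"
proof
  fix z
  show "amp p l (X \<circ> Y) z = (amp p l X \<circ> amp p l Y) z"
  proof (cases "z \<in> ell2")
    case True
    then have "amp p l Y z \<in> ell2"
      using amp_bounded[OF assms(1,3)] by (simp add: bounded_opsD)
    then show ?thesis
      using True by (simp add: amp_def line_fibrationD[OF assms(1)])
  next
    case False
    then have "amp p l (X \<circ> Y) z = 0" "amp p l Y z = 0"
      by (simp_all add: amp_def)
    then show ?thesis
      using op_zero(1)[OF amp_bounded[OF assms(1,2)]] by simp
  qed
qed

lemma amp_id: "line_fibration p l \<Longrightarrow> amp p l id_op = id_op"
  by (auto simp: amp_def id_op_def fun_eq_iff line_ell2 line_fibrationD)

lemma amp_entry:
  assumes "line_fibration p l" "X \<in> bounded_ops"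
  shows "amp p l X (delta b') b = (if l b (p b') = b' then X (delta (p b')) (p b) else 0)"
proof -
  have "(\<lambda>a. delta b' (l b a)) = (if l b (p b') = b' then delta (p b') else (\<lambda>_. 0))"
    by (auto simp: delta_def fun_eq_iff line_fibrationD[OF assms(1)])
  then show ?thesis
    using op_zero[OF assms(2)] by (simp add: amp_def)
qed

text \<open>
  Entries vanish between points of different lines, and lying on a common line is a symmetric relation.
\<close>

lemma amp_adj:
  assumes "line_fibration p l" "X \<in> bounded_ops"
  shows "amp p l (op_adj X) = op_adj (amp p l X)"
proof (rule op_adj_eqI[symmetric])
  fix i j
  have "l i (p j) = j \<longleftrightarrow> l j (p i) = i"
    by (metis line_fibrationD(2,3)[OF assms(1)])
  then show "amp p l (op_adj X) (delta j) i = cnj (amp p l X (delta i) j)"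
    using assms by (simp add: amp_entry op_adj_bounded op_adj_entry)
qed (use assms in \<open>auto intro: amp_bounded\<close>)

lemma amp_star_hom:
  assumes "line_fibration p l" "A \<subseteq> bounded_ops" "amp p l ` A \<subseteq> B"
  shows "unital_star_hom A B (amp p l)"
  using assms unfolding unital_star_hom_def
  by (auto simp: amp_id amp_add amp_scale amp_comp amp_adj subset_iff)

lemma amp_amp:
  assumes "line_fibration p l"
  shows "amp p l (amp p' l' X) = amp (\<lambda>b. p' (p b)) (\<lambda>b a. l b (l' (p b) a)) X"
  by (auto simp: amp_def line_ell2[OF assms])

abbreviation amp1 :: "'a op \<Rightarrow> ('a \<times> 'b) op" where
  "amp1 \<equiv> amp fst (\<lambda>b a. (a, snd b))"

abbreviation amp2 :: "'b op \<Rightarrow> ('a \<times> 'b) op" where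
  "amp2 \<equiv> amp snd (\<lambda>b a. (fst b, a))"

lemma line_fibration_coords [simp]:
  "line_fibration fst (\<lambda>b a. (a, snd b))"
  "line_fibration snd (\<lambda>b a. (fst b, a))"
  by (auto simp: line_fibration_def)

lemma op_tensor_amp:
  assumes "S \<in> bounded_ops" "T \<in> bounded_ops"
  shows "op_tensor S T = amp1 S \<circ> amp2 T"
proof
  fix z
  show "op_tensor S T z = (amp1 S \<circ> amp2 T) z"
  proof (cases "z \<in> ell2")
    case True
    then have "amp2 T z \<in> ell2"
      using assms by (simp add: bounded_opsD(1)[OF amp_bounded])
    then show ?thesis
      using True by (auto simp: op_tensor_def amp_def)
  next
    case False
    then have "op_tensor S T z = 0" "amp2 T z = 0"
      by (simp_all add: op_tensor_def amp_def)
    then show ?thesis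
      using op_zero(1)[OF amp_bounded[OF line_fibration_coords(1) assms(1)]] by simp
  qed
qed

lemma op_tensor_id_right: "S \<in> bounded_ops \<Longrightarrow> op_tensor S id_op = amp1 S"
  by (simp add: op_tensor_amp amp_id comp_id_op amp_bounded)

lemma op_tensor_id_left: "T \<in> bounded_ops \<Longrightarrow> op_tensor id_op T = amp2 T"
  by (simp add: op_tensor_amp amp_id comp_id_op amp_bounded)

lemma op_tensor_bounded [simp, intro]:
  "S \<in> bounded_ops \<Longrightarrow> T \<in> bounded_ops \<Longrightarrow> op_tensor S T \<in> bounded_ops"
  by (simp add: op_tensor_amp amp_bounded bounded_ops_closed(3))

lemma bounded_by_tensor:
  "bounded_by C S \<Longrightarrow> bounded_by D T \<Longrightarrow> bounded_by (C * D) (op_tensor S T)"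
  by (simp add: op_tensor_amp bounded_byD(1) bounded_by_comp bounded_by_amp)

lemma op_tensor_entry:
  assumes "S \<in> bounded_ops" "T \<in> bounded_ops"
  shows "op_tensor S T (delta (i', j')) (i, j) = S (delta i') i * T (delta j') j"
proof -
  have "(\<lambda>j'a. delta (i', j') (i'a, j'a)) = (\<lambda>j. delta i' i'a * delta j' j)" for i'a
    by (auto simp: delta_def)
  then have "op_tensor S T (delta (i', j')) (i, j) = S (\<lambda>i'a. T (delta j') j * delta i' i'a) i"
    using bounded_opsD(3)[OF assms(2) delta_ell2] by (simp add: op_tensor_def mult.commute)
  then show ?thesis
    by (simp add: bounded_opsD(3)[OF assms(1) delta_ell2])
qed

lemma op_tensor_add_left:
  "S \<in> bounded_ops \<Longrightarrow> S' \<in> bounded_ops \<Longrightarrow> T \<in> bounded_ops \<Longrightarrow>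
    op_tensor (S + S') T = op_tensor S T + op_tensor S' T"
  by (simp add: op_tensor_amp bounded_ops_closed(1) amp_add comp_add_left)

lemma op_tensor_scale_left:
  "S \<in> bounded_ops \<Longrightarrow> T \<in> bounded_ops \<Longrightarrow> op_tensor (op_scale c S) T = op_scale c (op_tensor S T)"
  by (simp add: op_tensor_amp bounded_ops_closed(4) amp_scale comp_scale_left)

lemma op_tensor_add_right:
  "S \<in> bounded_ops \<Longrightarrow> T \<in> bounded_ops \<Longrightarrow> T' \<in> bounded_ops \<Longrightarrow>
    op_tensor S (T + T') = op_tensor S T + op_tensor S T'"
  by (simp add: op_tensor_amp bounded_ops_closed(1) amp_add comp_add_right amp_bounded)

lemma op_tensor_scale_right:
  "S \<in> bounded_ops \<Longrightarrow> T \<in> bounded_ops \<Longrightarrow> op_tensor S (op_scale c T) = op_scale c (op_tensor S T)"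
  by (simp add: op_tensor_amp bounded_ops_closed(4) amp_scale comp_scale_right amp_bounded)

lemma op_tensor_generators_bounded:
  "A \<subseteq> bounded_ops \<Longrightarrow> B \<subseteq> bounded_ops \<Longrightarrow> {op_tensor S T | S T. S \<in> A \<and> T \<in> B} \<subseteq> bounded_ops"
  by auto

lemma op_tensor_in_cstar_tensor:
  assumes "A \<subseteq> bounded_ops" "B \<subseteq> bounded_ops" "S \<in> A" "T \<in> B"
  shows "op_tensor S T \<in> cstar_tensor A B"
  unfolding cstar_tensor_def
  by (rule subsetD[OF op_closure_incl[OF op_span_bounded[OF op_tensor_generators_bounded[OF assms(1,2)]]]])
    (use assms in \<open>auto intro: ops.span_base\<close>)

lemma op_closure_span_least:
  assumes H: "H \<subseteq> bounded_ops" and B: "B \<subseteq> op_closure (ops.span H)"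
  shows "op_closure (ops.span B) \<subseteq> op_closure (ops.span H)"
proof -
  have SH: "ops.subspace (op_closure (ops.span H))"
    by (intro op_closure_subspace ops.subspace_span op_span_bounded H)
  have "op_closure (ops.span B) \<subseteq> op_closure (op_closure (ops.span H))"
    by (intro op_closure_mono ops.span_minimal[OF B SH])
  then show ?thesis
    using op_closure_idem[OF op_span_bounded[OF H]] by blast
qed

text \<open>
  An elementary tensor of elements of the closures is approximated one factor at a time.
\<close>

lemma cstar_tensor_least:
  assumes A: "A \<subseteq> bounded_ops" and B: "B \<subseteq> bounded_ops" and H: "H \<subseteq> bounded_ops"
    and gen: "\<And>S T. S \<in> A \<Longrightarrow> T \<in> B \<Longrightarrow> op_tensor S T \<in> op_closure (ops.span H)"
  shows "cstar_tensor (op_closure (ops.span A)) (op_closure (ops.span B)) \<subseteq> op_closure (ops.span H)"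
  unfolding cstar_tensor_def
proof (intro op_closure_span_least[OF H] subsetI)
  fix X assume "X \<in> {op_tensor S T | S T. S \<in> op_closure (ops.span A) \<and> T \<in> op_closure (ops.span B)}"
  then obtain S T where X: "X = op_tensor S T"
    and S: "S \<in> op_closure (ops.span A)" and T: "T \<in> op_closure (ops.span B)" by blast
  have SB: "S \<in> bounded_ops" using S op_closure_bounded by blast
  obtain C where C: "bounded_by C S" using bounded_byE[OF SB] .
  have left: "op_tensor S U \<in> op_closure (ops.span H)" if U: "U \<in> B" for U
  proof -
    have UB: "U \<in> bounded_ops" using U B by blast
    obtain D where D: "bounded_by D U" using bounded_byE[OF UB] .
    have bd: "bounded_by (D * c) (op_tensor V U)" if "bounded_by c V" for c V
      using bounded_by_tensor[OF that D] by (simp add: mult.commute)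
    show ?thesis
      by (rule op_closure_map[where f = "\<lambda>S. op_tensor S U" and K = D, OF A H _ _ _ _ S])
        (auto intro: op_tensor_add_left op_tensor_scale_left bd gen UB U)
  qed
  show "X \<in> op_closure (ops.span H)"
    unfolding X
    by (rule op_closure_map[where f = "\<lambda>T. op_tensor S T" and K = C, OF B H _ _ _ _ T])
      (auto intro: op_tensor_add_right op_tensor_scale_right bounded_by_tensor[OF C] left SB)
qed

text \<open>
  Applied to the comultiplication, the next two lemmas show that the ampliations along lines in one of the
  factors have the values that characterise \<open>\<Delta> \<otimes> id\<close> and \<open>id \<otimes> \<Delta>\<close>.
\<close>

lemma amp_tensor_left:
  assumes lf: "line_fibration p l" and S: "S \<in> bounded_ops" and T: "T \<in> bounded_ops"
  shows "amp (\<lambda>b. (p (fst b), snd b)) (\<lambda>b a. (l (fst b) (fst a), snd a)) (op_tensor S T) = op_tensor (amp p l S) T"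
proof -
  let ?P = "\<lambda>b. (p (fst b), snd b)" and ?L = "\<lambda>b a. (l (fst b) (fst a), snd a)"
  have lf': "line_fibration ?P ?L"
    using lf by (auto simp: line_fibration_def)
  have 1: "amp ?P ?L (amp1 S) = amp1 (amp p l S)"
    by (simp add: amp_amp[OF lf'] amp_amp)
  have 2: "amp ?P ?L (amp2 T) = amp2 T"
    by (simp add: amp_amp[OF lf'] line_fibrationD[OF lf])
  show ?thesis
    unfolding op_tensor_amp[OF S T] op_tensor_amp[OF amp_bounded[OF lf S] T]
      amp_comp[OF lf' amp_bounded[OF line_fibration_coords(1) S] amp_bounded[OF line_fibration_coords(2) T]] 1 2 ..
qed

lemma amp_tensor_right:
  assumes lf: "line_fibration p l" and S: "S \<in> bounded_ops" and T: "T \<in> bounded_ops"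
  shows "amp (\<lambda>b. (fst b, p (snd b))) (\<lambda>b a. (fst a, l (snd b) (snd a))) (op_tensor S T) = op_tensor S (amp p l T)"
proof -
  let ?P = "\<lambda>b. (fst b, p (snd b))" and ?L = "\<lambda>b a. (fst a, l (snd b) (snd a))"
  have lf': "line_fibration ?P ?L"
    using lf by (auto simp: line_fibration_def)
  have 1: "amp ?P ?L (amp1 S) = amp1 S"
    by (simp add: amp_amp[OF lf'] line_fibrationD[OF lf])
  have 2: "amp ?P ?L (amp2 T) = amp2 (amp p l T)"
    by (simp add: amp_amp[OF lf'] amp_amp)
  show ?thesis
    unfolding op_tensor_amp[OF S T] op_tensor_amp[OF S amp_bounded[OF lf T]]
      amp_comp[OF lf' amp_bounded[OF line_fibration_coords(1) S] amp_bounded[OF line_fibration_coords(2) T]] 1 2 ..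
qed

lemma op_assoc_amp:
  "op_assoc (amp P L X) =
    amp (\<lambda>(i, j, k). P ((i, j), k)) (\<lambda>(i, j, k) a. (fst (fst (L ((i, j), k) a)), snd (fst (L ((i, j), k) a)), snd (L ((i, j), k) a))) X"
proof -
  let ?r = "\<lambda>((i, j), k). (i, j, k)" and ?s = "\<lambda>(i, j, k). ((i, j), k)"
  have inj: "inj ?r" "inj ?s"
    by (auto simp: inj_def)
  have iff: "(\<lambda>q. z (fst (fst q), snd (fst q), snd q)) \<in> ell2 \<longleftrightarrow> z \<in> ell2" for z :: "_ \<Rightarrow> complex"
    using ell2_reindex(1)[OF inj(1), of z] ell2_reindex(1)[OF inj(2), of "\<lambda>q. z (fst (fst q), snd (fst q), snd q)"]
    by (auto simp: case_prod_unfold)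
  show ?thesis
    by (intro ext) (auto simp: op_assoc_def amp_def iff case_prod_unfold)
qed

lemma amp_maps_closure:
  assumes lf: "line_fibration p l" and B: "B \<subseteq> bounded_ops" and H: "H \<subseteq> bounded_ops"
    and gen: "\<And>T. T \<in> B \<Longrightarrow> amp p l T \<in> op_closure (ops.span H)"
  shows "amp p l ` op_closure (ops.span B) \<subseteq> op_closure (ops.span H)"
proof (rule image_subsetI)
  fix T assume T: "T \<in> op_closure (ops.span B)"
  show "amp p l T \<in> op_closure (ops.span H)"
    by (rule op_closure_map[where f = "amp p l" and K = 1, OF B H _ _ _ _ T])
      (auto simp: amp_add amp_scale bounded_by_amp[OF lf] gen)
qed

section \<open>The dual of a discrete group, twisted by an involution\<close>

text \<open>
  \<open>'g\<close> is a discrete group, written additively though not abelian, and \<open>\<sigma>\<close> an involutive automorphism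
  of it.  The Hilbert space has the basis \<open>'g \<times> bool\<close>; the bijection \<open>dec\<close> renames it, so that the quantum group
  can be placed on any index type of the right cardinality.  Exclusive or, written \<open>a \<noteq> b\<close>, is the addition
  of \<open>\<int>/2\<close>.
\<close>

locale twisted_dual =
  fixes \<sigma> :: "'g::group_add \<Rightarrow> 'g" and dec :: "'i \<Rightarrow> 'g \<times> bool"
  assumes bij_dec: "bij dec"
    and \<sigma>_add: "\<sigma> (g + h) = \<sigma> g + \<sigma> h"
    and \<sigma>_\<sigma> [simp]: "\<sigma> (\<sigma> g) = g"
begin

definition enc :: "'g \<times> bool \<Rightarrow> 'i" where
  "enc = inv_into UNIV dec"

lemma dec_enc [simp]: "dec (enc x) = x"
  unfolding enc_def by (rule surj_f_inv_f[OF bij_is_surj[OF bij_dec]])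

lemma enc_dec [simp]: "enc (dec i) = i"
  unfolding enc_def by (rule inv_f_f[OF bij_is_inj[OF bij_dec]])

lemma enc_inject [simp]: "enc x = enc y \<longleftrightarrow> x = y"
  by (metis dec_enc)

lemma \<sigma>_zero [simp]: "\<sigma> 0 = 0"
  by (metis \<sigma>_add add_0_right add_left_cancel)

lemma \<sigma>_uminus: "\<sigma> (- g) = - \<sigma> g"
  by (metis \<sigma>_add \<sigma>_zero add.right_inverse add_eq_0_iff)

definition act :: "bool \<Rightarrow> 'g \<Rightarrow> 'g" where
  "act a g = (if a then \<sigma> g else g)"

lemma act_add: "act a (g + h) = act a g + act a h"
  by (simp add: act_def \<sigma>_add)

lemma act_uminus: "act a (- g) = - act a g"
  by (simp add: act_def \<sigma>_uminus)

lemma act_diff: "act a (g - h) = act a g - act a h"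
  by (simp add: act_add act_uminus diff_conv_add_uminus del: add_uminus_conv_diff)

lemma act_act: "act a (act b g) = act (a \<noteq> b) g"
  by (simp add: act_def)

lemma act_zero [simp]: "act a 0 = 0"
  by (simp add: act_def)

text \<open>The operator \<open>\<lambda>\<^sub>g \<delta>\<^sub>k\<close>: translation by \<open>g\<close> on the copy \<open>k\<close> of the group.\<close>

definition basis_op :: "'g \<Rightarrow> bool \<Rightarrow> 'i op" where
  "basis_op g k = (\<lambda>x. if x \<in> ell2 then (\<lambda>i. if snd (dec i) = k then x (enc (- g + fst (dec i), k)) else 0) else 0)"

lemma bounded_by_basis_op: "bounded_by 1 (basis_op g k)"
proof -
  have le: "l2_on F (basis_op g k x) \<le> ell2_norm x" if x: "x \<in> ell2" and F: "finite F" for x F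
  proof -
    let ?\<phi> = "\<lambda>i. enc (- g + fst (dec i), snd (dec i))"
    have inj: "inj_on ?\<phi> F"
      by (rule inj_onI) (metis Pair_inject add_left_cancel enc_dec enc_inject prod.collapse)
    have "l2_on F (basis_op g k x) \<le> l2_on F (\<lambda>i. x (?\<phi> i))"
      using x by (intro L2_set_mono) (auto simp: basis_op_def)
    also have "\<dots> = l2_on (?\<phi> ` F) x"
      using inj by (simp add: L2_set_def sum.reindex)
    also have "\<dots> \<le> ell2_norm x"
      using x F by (intro l2_on_le_norm) auto
    finally show ?thesis .
  qed
  show ?thesis
  proof (rule bounded_byI)
    fix x y :: "'i \<Rightarrow> complex" and c
    show "x \<notin> ell2 \<Longrightarrow> basis_op g k x = 0"
      by (simp add: basis_op_def)
    assume x: "x \<in> ell2"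
    show "basis_op g k x \<in> ell2"
      by (rule ell2_norm_le[OF le[OF x]])
    show "ell2_norm (basis_op g k x) \<le> 1 * ell2_norm x"
      using ell2_norm_le(2)[OF le[OF x]] by simp
    show "basis_op g k (\<lambda>i. c * x i) = (\<lambda>i. c * basis_op g k x i)"
      using x by (simp add: basis_op_def ell2_scale fun_eq_iff)
    assume y: "y \<in> ell2"
    show "basis_op g k (x + y) = basis_op g k x + basis_op g k y"
      using x y ell2_add(1)[OF x y] by (simp add: basis_op_def fun_eq_iff)
  qed simp
qed

lemma basis_op_bounded [simp, intro]: "basis_op g k \<in> bounded_ops"
  by (rule bounded_byD[OF bounded_by_basis_op])

lemma basis_op_entry:
  "basis_op g k (delta (enc (h, c))) (enc (h', c')) = (if c = k \<and> c' = k \<and> h' = g + h then 1 else 0)"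
proof -
  have "- g + h' = h \<longleftrightarrow> h' = g + h"
    by (metis add.assoc add_0_left left_minus minus_add_cancel)
  then show ?thesis
    by (auto simp: basis_op_def delta_apply)
qed

lemma op_eqI_enc:
  assumes "S \<in> bounded_ops" "T \<in> bounded_ops"
    and "\<And>h c h' c'. S (delta (enc (h, c))) (enc (h', c')) = T (delta (enc (h, c))) (enc (h', c'))"
  shows "S = T"
  by (rule op_eqI[OF assms(1,2)]) (metis assms(3) enc_dec surj_pair)

lemma basis_op_comp: "basis_op g k \<circ> basis_op h m = (if k = m then basis_op (g + h) k else 0)"
proof
  fix x
  show "(basis_op g k \<circ> basis_op h m) x = (if k = m then basis_op (g + h) k else 0) x"
  proof (cases "x \<in> ell2")
    case True
    then have "basis_op h m x \<in> ell2"
      using bounded_opsD(1)[OF basis_op_bounded] by blast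
    then show ?thesis
      using True by (auto simp: basis_op_def fun_eq_iff minus_add add.assoc diff_conv_add_uminus
          simp del: add_uminus_conv_diff)
  next
    case False
    then show ?thesis
      using op_zero(1)[OF basis_op_bounded, of g k] bounded_opsD(4)[OF basis_op_bounded] by simp
  qed
qed

lemma basis_op_adj: "op_adj (basis_op g k) = basis_op (- g) k"
proof (rule op_adj_eqI)
  fix i j
  obtain h c h' c' where "i = enc (h, c)" "j = enc (h', c')"
    by (metis enc_dec surj_pair)
  moreover have "h = - g + h' \<longleftrightarrow> h' = g + h"
    by (metis add.assoc add_0_left left_minus minus_add_cancel)
  ultimately show "basis_op (- g) k (delta j) i = cnj (basis_op g k (delta i) j)"
    by (auto simp: basis_op_entry)
qed auto

lemma id_op_basis: "id_op = basis_op 0 False + basis_op 0 True"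
proof (rule op_eqI_enc)
  show "id_op (delta (enc (h, c))) (enc (h', c')) = (basis_op 0 False + basis_op 0 True) (delta (enc (h, c))) (enc (h', c'))"
    for h c h' c'
    by (cases c) (auto simp: basis_op_entry id_op_def delta_apply)
qed auto

definition gens :: "'i op set" where
  "gens = {basis_op g k | g k. True}"

definition alg :: "'i op set" where
  "alg = ops.span gens"

definition cstar_alg :: "'i op set" where
  "cstar_alg = op_closure alg"

lemma gens_bounded: "gens \<subseteq> bounded_ops"
  by (auto simp: gens_def)

lemma alg_bounded: "alg \<subseteq> bounded_ops"
  unfolding alg_def by (rule op_span_bounded[OF gens_bounded])

lemma cstar_alg_bounded: "cstar_alg \<subseteq> bounded_ops"
  unfolding cstar_alg_def by (rule op_closure_bounded)

lemma alg_subset: "alg \<subseteq> cstar_alg"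
  unfolding cstar_alg_def by (rule op_closure_incl[OF alg_bounded])

lemma basis_op_alg [simp, intro]: "basis_op g k \<in> alg"
  unfolding alg_def gens_def by (intro ops.span_base) auto

lemma basis_op_cstar_alg [simp, intro]: "basis_op g k \<in> cstar_alg"
  using alg_subset by blast

lemma id_op_alg: "id_op \<in> alg"
  unfolding id_op_basis alg_def by (intro ops.span_add) (auto simp flip: alg_def)

lemma unital_cstar_algebra_cstar_alg: "unital_cstar_algebra cstar_alg"
  unfolding cstar_alg_def alg_def
proof (rule unital_cstar_algebra_closure[OF gens_bounded])
  show "id_op \<in> ops.span gens"
    using id_op_alg by (simp add: alg_def)
  show "S \<circ> T \<in> ops.span gens" if ST: "S \<in> gens" "T \<in> gens" for S T
  proof -
    obtain g k h m where "S = basis_op g k" "T = basis_op h m"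
      using ST by (auto simp: gens_def)
    then show ?thesis
      using basis_op_alg[of "g + h" k] by (cases "k = m") (simp_all add: basis_op_comp alg_def ops.span_zero)
  qed
  show "op_adj T \<in> ops.span gens" if T: "T \<in> gens" for T
  proof -
    obtain g k where "T = basis_op g k"
      using T by (auto simp: gens_def)
    then show ?thesis
      using basis_op_alg[of "- g" k] by (simp add: basis_op_adj alg_def)
  qed
qed

text \<open>
  The comultiplication \<open>\<Delta> (\<lambda>\<^sub>g \<delta>\<^sub>k) = \<Sum>a + b = k. \<lambda>\<^sub>g \<delta>\<^sub>a \<otimes> \<lambda>\<^bsub>\<sigma>\<^sup>a g\<^esub> \<delta>\<^sub>b\<close> is an ampliation: on a pair of basis vectors
  \<open>(g, a)\<close>, \<open>(g', b)\<close> the operator acts through the coordinate \<open>(g, a + b)\<close> and leaves \<open>b\<close> and \<open>- \<sigma>\<^sup>a g + g'\<close>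
  unchanged.  So the lines are given by fixing these two.
\<close>

definition mul_coord :: "'i \<times> 'i \<Rightarrow> 'i" where
  "mul_coord q = enc (fst (dec (fst q)), snd (dec (fst q)) \<noteq> snd (dec (snd q)))"

definition mul_line :: "'i \<times> 'i \<Rightarrow> 'i \<Rightarrow> 'i \<times> 'i" where
  "mul_line q m = (let h = fst (dec m); b = snd (dec (snd q)); a = (snd (dec m) \<noteq> b) in
     (enc (h, a), enc (act a h - act (snd (dec (fst q))) (fst (dec (fst q))) + fst (dec (snd q)), b)))"

definition comult :: "'i op \<Rightarrow> ('i \<times> 'i) op" where
  "comult = amp mul_coord mul_line"

lemma mul_coord_enc: "mul_coord (enc (g, a), enc (g', b)) = enc (g, a \<noteq> b)"
  by (simp add: mul_coord_def)

lemma mul_line_enc: "mul_line (enc (g, a), enc (g', b)) (enc (h, c)) =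
    (enc (h, c \<noteq> b), enc (act (c \<noteq> b) h - act a g + g', b))"
  by (simp add: mul_line_def Let_def)

lemma line_fibration_mul: "line_fibration mul_coord mul_line"
proof -
  have 1: "mul_coord (mul_line q m) = m" for q m
  proof -
    obtain g a g' b h c where "q = (enc (g, a), enc (g', b))" "m = enc (h, c)"
      by (metis enc_dec surj_pair)
    then show ?thesis
      by (auto simp: mul_coord_enc mul_line_enc)
  qed
  have 2: "mul_line q (mul_coord q) = q" for q
  proof -
    obtain g a g' b where "q = (enc (g, a), enc (g', b))"
      by (metis enc_dec surj_pair)
    then show ?thesis
      by (cases a; cases b) (simp_all add: mul_coord_enc mul_line_enc)
  qed
  have 3: "mul_line (mul_line q m) m' = mul_line q m'" for q m m'
  proof -
    obtain g a g' b h c h' c' where "q = (enc (g, a), enc (g', b))" "m = enc (h, c)" "m' = enc (h', c')"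
      by (metis enc_dec surj_pair)
    then show ?thesis
      by (simp add: mul_line_enc diff_conv_add_uminus add.assoc del: add_uminus_conv_diff)
  qed
  show ?thesis
    unfolding line_fibration_def using 1 2 3 by blast
qed

lemma comult_bounded: "X \<in> bounded_ops \<Longrightarrow> comult X \<in> bounded_ops"
  unfolding comult_def by (rule amp_bounded[OF line_fibration_mul])

lemma pair_op_eqI:
  assumes "S \<in> bounded_ops" "T \<in> bounded_ops"
    and "\<And>h c h' c' g a g' b. S (delta (enc (h, c), enc (h', c'))) (enc (g, a), enc (g', b)) =
      T (delta (enc (h, c), enc (h', c'))) (enc (g, a), enc (g', b))"
  shows "S = T"
  by (rule op_eqI[OF assms(1,2)]) (metis assms(3) enc_dec surj_pair)

lemma add_eq_cancel_group: "- x + (y :: 'g) = z \<longleftrightarrow> y = x + z"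
  by (metis add.assoc add_0_left left_minus minus_add_cancel)

lemma comult_basis_op:
  "comult (basis_op g k) = op_tensor (basis_op g False) (basis_op g k) + op_tensor (basis_op g True) (basis_op (\<sigma> g) (\<not> k))"
proof (rule pair_op_eqI)
  fix h c h' c' f a f' b
  have L: "mul_line (enc (f, a), enc (f', b)) (mul_coord (enc (h, c), enc (h', c'))) = (enc (h, c), enc (h', c')) \<longleftrightarrow>
      b = c' \<and> f' = act a f - act c h + h'"
  proof -
    have "act c h - act a f + f' = h' \<longleftrightarrow> f' = act a f - act c h + h'"
      using add_eq_cancel_group[of "act a f - act c h" f' h'] by simp
    then show ?thesis
      by (cases b; cases c; cases c') (simp_all add: mul_coord_enc mul_line_enc)
  qed
  have "comult (basis_op g k) (delta (enc (h, c), enc (h', c'))) (enc (f, a), enc (f', b)) =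
      (if b = c' \<and> f' = act a f - act c h + h' then
        basis_op g k (delta (enc (h, c \<noteq> c'))) (enc (f, a \<noteq> b)) else 0)"
    unfolding comult_def amp_entry[OF line_fibration_mul basis_op_bounded] L by (simp only: mul_coord_enc)
  also have "\<dots> = (if b = c' \<and> f' = act a f - act c h + h' \<and> (c \<noteq> c') = k \<and> (a \<noteq> b) = k \<and> f = g + h then 1 else 0)"
    by (simp add: basis_op_entry)
  also have "\<dots> = (if b = c' \<and> a = c \<and> (c \<noteq> c') = k \<and> f = g + h \<and> f' = act c g + h' then 1 else 0)"
    by (auto simp: act_add)
  also have "\<dots> = (op_tensor (basis_op g False) (basis_op g k) + op_tensor (basis_op g True) (basis_op (\<sigma> g) (\<not> k)))
      (delta (enc (h, c), enc (h', c'))) (enc (f, a), enc (f', b))"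
    by (auto simp: op_tensor_entry basis_op_entry act_def)
  finally show "comult (basis_op g k) (delta (enc (h, c), enc (h', c'))) (enc (f, a), enc (f', b)) =
    (op_tensor (basis_op g False) (basis_op g k) + op_tensor (basis_op g True) (basis_op (\<sigma> g) (\<not> k)))
      (delta (enc (h, c), enc (h', c'))) (enc (f, a), enc (f', b))" .
qed (auto intro: comult_bounded)

lemma cstar_tensor_bounded: "cstar_tensor A B \<subseteq> bounded_ops"
  unfolding cstar_tensor_def by (rule op_closure_bounded)

lemma comult_star_hom: "unital_star_hom cstar_alg (cstar_tensor cstar_alg cstar_alg) comult"
  unfolding comult_def
proof (rule amp_star_hom[OF line_fibration_mul cstar_alg_bounded])
  have "amp mul_coord mul_line T \<in> cstar_tensor cstar_alg cstar_alg" if T: "T \<in> gens" for T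
  proof -
    obtain g k where T: "T = basis_op g k"
      using T by (auto simp: gens_def)
    have sub: "ops.subspace (cstar_tensor cstar_alg cstar_alg)"
      unfolding cstar_tensor_def
      by (intro op_closure_subspace ops.subspace_span op_span_bounded op_tensor_generators_bounded cstar_alg_bounded)
    show ?thesis
      unfolding T comult_basis_op[unfolded comult_def]
      by (intro ops.subspace_add[OF sub] op_tensor_in_cstar_tensor cstar_alg_bounded basis_op_cstar_alg)
  qed
  then show "amp mul_coord mul_line ` cstar_alg \<subseteq> cstar_tensor cstar_alg cstar_alg"
    unfolding cstar_alg_def[of ] alg_def
    unfolding cstar_tensor_def cstar_alg_def[symmetric, unfolded alg_def]
    by (subst (1) cstar_alg_def[unfolded alg_def], intro amp_maps_closure[OF line_fibration_mul gens_bounded])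
      (auto intro: op_tensor_generators_bounded[OF cstar_alg_bounded cstar_alg_bounded, THEN subsetD])
qed

abbreviation mul_left_coord where "mul_left_coord \<equiv> (\<lambda>b. (mul_coord (fst b), snd b))"
abbreviation mul_left_line where "mul_left_line \<equiv> (\<lambda>b a. (mul_line (fst b) (fst a), snd a))"
abbreviation mul_right_coord where "mul_right_coord \<equiv> (\<lambda>b. (fst b, mul_coord (snd b)))"
abbreviation mul_right_line where "mul_right_line \<equiv> (\<lambda>b a. (fst a, mul_line (snd b) (snd a)))"

lemma line_fibration_mul_left: "line_fibration mul_left_coord mul_left_line"
  and line_fibration_mul_right: "line_fibration mul_right_coord mul_right_line"
  using line_fibration_mul by (auto simp: line_fibration_def)

lemma comult_mem: "T \<in> cstar_alg \<Longrightarrow> comult T \<in> cstar_tensor cstar_alg cstar_alg"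
  using comult_star_hom by (auto simp: unital_star_hom_def)

lemma mul_left_star_hom:
  "unital_star_hom (cstar_tensor cstar_alg cstar_alg)
    (cstar_tensor (cstar_tensor cstar_alg cstar_alg) cstar_alg) (amp mul_left_coord mul_left_line)"
proof (rule amp_star_hom[OF line_fibration_mul_left cstar_tensor_bounded])
  have gen: "amp mul_left_coord mul_left_line X \<in> cstar_tensor (cstar_tensor cstar_alg cstar_alg) cstar_alg"
    if X: "X \<in> {op_tensor S T | S T. S \<in> cstar_alg \<and> T \<in> cstar_alg}" for X
  proof -
    obtain S T where "X = op_tensor S T" and ST: "S \<in> cstar_alg" "T \<in> cstar_alg"
      using X by blast
    then have "amp mul_left_coord mul_left_line X = op_tensor (comult S) T"
      using amp_tensor_left[OF line_fibration_mul, of S T] cstar_alg_bounded by (auto simp: comult_def)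
    then show ?thesis
      using op_tensor_in_cstar_tensor[OF cstar_tensor_bounded cstar_alg_bounded comult_mem[OF ST(1)] ST(2)] by simp
  qed
  show "amp mul_left_coord mul_left_line ` cstar_tensor cstar_alg cstar_alg \<subseteq> cstar_tensor (cstar_tensor cstar_alg cstar_alg) cstar_alg"
    unfolding cstar_tensor_def[of cstar_alg cstar_alg] cstar_tensor_def[of "op_closure _"]
    by (rule amp_maps_closure[OF line_fibration_mul_left
          op_tensor_generators_bounded[OF cstar_alg_bounded cstar_alg_bounded]
          op_tensor_generators_bounded[OF op_closure_bounded cstar_alg_bounded]])
      (rule gen[unfolded cstar_tensor_def])
qed

lemma mul_right_star_hom:
  "unital_star_hom (cstar_tensor cstar_alg cstar_alg)
    (cstar_tensor cstar_alg (cstar_tensor cstar_alg cstar_alg)) (amp mul_right_coord mul_right_line)"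
proof (rule amp_star_hom[OF line_fibration_mul_right cstar_tensor_bounded])
  have gen: "amp mul_right_coord mul_right_line X \<in> cstar_tensor cstar_alg (cstar_tensor cstar_alg cstar_alg)"
    if X: "X \<in> {op_tensor S T | S T. S \<in> cstar_alg \<and> T \<in> cstar_alg}" for X
  proof -
    obtain S T where "X = op_tensor S T" and ST: "S \<in> cstar_alg" "T \<in> cstar_alg"
      using X by blast
    then have "amp mul_right_coord mul_right_line X = op_tensor S (comult T)"
      using amp_tensor_right[OF line_fibration_mul, of S T] cstar_alg_bounded by (auto simp: comult_def)
    then show ?thesis
      using op_tensor_in_cstar_tensor[OF cstar_alg_bounded cstar_tensor_bounded ST(1) comult_mem[OF ST(2)]] by simp
  qed
  show "amp mul_right_coord mul_right_line ` cstar_tensor cstar_alg cstar_alg \<subseteq> cstar_tensor cstar_alg (cstar_tensor cstar_alg cstar_alg)"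
    unfolding cstar_tensor_def[of cstar_alg cstar_alg] cstar_tensor_def[of _ "op_closure _"]
    by (rule amp_maps_closure[OF line_fibration_mul_right
          op_tensor_generators_bounded[OF cstar_alg_bounded cstar_alg_bounded]
          op_tensor_generators_bounded[OF cstar_alg_bounded op_closure_bounded]])
      (rule gen[unfolded cstar_tensor_def])
qed

text \<open>
  Both sides are ampliations of \<open>T\<close> itself, with the same coordinate and the same lines: at three basis
  vectors the coordinate is \<open>(g\<^sub>1, a\<^sub>1 + a\<^sub>2 + a\<^sub>3)\<close>.
\<close>

lemma comult_coassoc:
  "op_assoc (amp mul_left_coord mul_left_line (comult T)) = amp mul_right_coord mul_right_line (comult T)"
proof -
  define P1 where "P1 = (\<lambda>(i, j, k). mul_coord (mul_left_coord ((i, j), k)))"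
  define L1 where "L1 = (\<lambda>(i, j, k) a. (let r = mul_left_line ((i, j), k) (mul_line (mul_left_coord ((i, j), k)) a)
    in (fst (fst r), snd (fst r), snd r)))"
  define P2 where "P2 = (\<lambda>b. mul_coord (mul_right_coord b))"
  define L2 where "L2 = (\<lambda>b a. mul_right_line b (mul_line (mul_right_coord b) a))"
  have P: "P1 b = P2 b" and L: "L1 b m = L2 b m" for b m
  proof -
    obtain g1 a1 g2 a2 g3 a3 h c where "b = (enc (g1, a1), enc (g2, a2), enc (g3, a3))" "m = enc (h, c)"
      by (metis enc_dec surj_pair)
    then show "P1 b = P2 b" "L1 b m = L2 b m"
      by (simp_all add: P1_def P2_def L1_def L2_def Let_def mul_coord_enc mul_line_enc act_add act_diff act_act
          diff_conv_add_uminus add.assoc minus_add act_uminus del: add_uminus_conv_diff)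
        (cases a1; cases a2; cases a3; cases c; simp)+
  qed
  have "op_assoc (amp mul_left_coord mul_left_line (comult T)) = amp P1 L1 T"
    unfolding comult_def amp_amp[OF line_fibration_mul_left] op_assoc_amp P1_def L1_def Let_def by simp
  also have "\<dots> = amp P2 L2 T"
    using P L by (metis ext)
  also have "\<dots> = amp mul_right_coord mul_right_line (comult T)"
    unfolding comult_def amp_amp[OF line_fibration_mul_right] P2_def L2_def by simp
  finally show ?thesis .
qed

lemma op_tensor_zero_left: "T \<in> bounded_ops \<Longrightarrow> op_tensor 0 T = 0" for T :: "'b op"
  by (rule op_eqI) (auto simp: op_tensor_entry)

lemma op_tensor_zero_right: "S \<in> bounded_ops \<Longrightarrow> op_tensor S 0 = 0" for S :: "'b op"
  by (rule op_eqI) (auto simp: op_tensor_entry)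

text \<open>\<open>S \<otimes> 1\<close> and \<open>1 \<otimes> T\<close> commute; for \<open>T\<close> in the basis this is visible pointwise.\<close>

lemma amp1_basis_op_commute:
  fixes S :: "'b op"
  assumes S: "S \<in> bounded_ops"
  shows "amp1 S \<circ> amp2 (basis_op g k) = amp2 (basis_op g k) \<circ> amp1 S"
proof
  fix z
  show "(amp1 S \<circ> amp2 (basis_op g k)) z = (amp2 (basis_op g k) \<circ> amp1 S) z"
  proof (cases "z \<in> ell2")
    case True
    have "amp1 S z \<in> ell2" "amp2 (basis_op g k) z \<in> ell2"
      using True S by (simp_all add: bounded_opsD(1)[OF amp_bounded])
    moreover have "(\<lambda>j. z (i, j)) \<in> ell2" for i
      using line_ell2[OF line_fibration_coords(2) True, of "(i, undefined)"] by simp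
    moreover have "(\<lambda>j. S (\<lambda>i. z (i, j)) i') \<in> ell2" for i'
      using line_ell2[OF line_fibration_coords(2) calculation(1), of "(i', undefined)"] True by (simp add: amp_def)
    ultimately show ?thesis
      using True op_zero(2)[OF S] by (auto simp: amp_def basis_op_def fun_eq_iff)
  next
    case False
    then have "amp1 S z = 0" "amp2 (basis_op g k) z = 0"
      by (simp_all add: amp_def)
    moreover have "amp1 S 0 = (0 :: 'b \<times> 'i \<Rightarrow> complex)" "amp2 (basis_op g k) 0 = (0 :: 'b \<times> 'i \<Rightarrow> complex)"
      by (rule op_zero(1)[OF amp_bounded[OF line_fibration_coords(1) S]]
        op_zero(1)[OF amp_bounded[OF line_fibration_coords(2) basis_op_bounded]])+
    ultimately show ?thesis
      by (simp only: o_apply)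
  qed
qed

theorem compact_quantum_group_cstar_alg: "compact_quantum_group cstar_alg comult"
proof
  show "unital_cstar_algebra cstar_alg"
    by (rule unital_cstar_algebra_cstar_alg)
  show "unital_star_hom cstar_alg (cstar_tensor cstar_alg cstar_alg) comult"
    by (rule comult_star_hom)
  have "amp mul_left_coord mul_left_line (op_tensor S T) = op_tensor (comult S) T"
    "amp mul_right_coord mul_right_line (op_tensor S T) = op_tensor S (comult T)"
    if "S \<in> cstar_alg" "T \<in> cstar_alg" for S T
    using that cstar_alg_bounded unfolding comult_def
    by (auto intro: amp_tensor_left amp_tensor_right line_fibration_mul)
  then show "\<exists>\<Phi> \<Psi>.
      unital_star_hom (cstar_tensor cstar_alg cstar_alg) (cstar_tensor (cstar_tensor cstar_alg cstar_alg) cstar_alg) \<Phi> \<and>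
      (\<forall>S\<in>cstar_alg. \<forall>T\<in>cstar_alg. \<Phi> (op_tensor S T) = op_tensor (comult S) T) \<and>
      unital_star_hom (cstar_tensor cstar_alg cstar_alg) (cstar_tensor cstar_alg (cstar_tensor cstar_alg cstar_alg)) \<Psi> \<and>
      (\<forall>S\<in>cstar_alg. \<forall>T\<in>cstar_alg. \<Psi> (op_tensor S T) = op_tensor S (comult T)) \<and>
      (\<forall>T\<in>cstar_alg. op_assoc (\<Phi> (comult T)) = \<Psi> (comult T))"
    using mul_left_star_hom mul_right_star_hom comult_coassoc by blast
  have comp_tensor_left: "op_tensor R id_op \<circ> op_tensor S T = op_tensor (R \<circ> S) T"
    if "R \<in> bounded_ops" "S \<in> bounded_ops" "T \<in> bounded_ops" for R S T :: "'i op"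
    unfolding op_tensor_id_right[OF that(1)] op_tensor_amp[OF that(2,3)]
      op_tensor_amp[OF bounded_ops_closed(3)[OF that(1,2)] that(3)] amp_comp[OF line_fibration_coords(1) that(1,2)]
    by (rule comp_assoc[symmetric])
  have comp_tensor_right: "op_tensor id_op (basis_op g a) \<circ> op_tensor S T = op_tensor S (basis_op g a \<circ> T)"
    if ST: "S \<in> bounded_ops" "T \<in> bounded_ops" for S T :: "'i op" and g a
  proof -
    have "amp2 (basis_op g a) \<circ> (amp1 S \<circ> amp2 T) = amp1 S \<circ> (amp2 (basis_op g a) \<circ> amp2 T)"
      unfolding comp_assoc[symmetric] amp1_basis_op_commute[OF ST(1)] ..
    then show ?thesis
      unfolding op_tensor_id_left[OF basis_op_bounded] op_tensor_amp[OF ST]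
        op_tensor_amp[OF ST(1) bounded_ops_closed(3)[OF basis_op_bounded ST(2)]]
        amp_comp[OF line_fibration_coords(2) basis_op_bounded ST(2)] .
  qed
  have dense: "cstar_tensor cstar_alg cstar_alg \<subseteq> op_closure (ops.span H)"
    if H: "H \<subseteq> bounded_ops" and gen: "\<And>g a g' b. op_tensor (basis_op g a) (basis_op g' b) \<in> H" for H
    unfolding cstar_alg_def alg_def
  proof (rule cstar_tensor_least[OF gens_bounded gens_bounded H])
    fix S T assume "S \<in> gens" "T \<in> gens"
    then have "op_tensor S T \<in> H"
      using gen by (auto simp: gens_def)
    then show "op_tensor S T \<in> op_closure (ops.span H)"
      by (intro subsetD[OF op_closure_incl[OF op_span_bounded[OF H]]] ops.span_base)
  qed
  show "cstar_tensor cstar_alg cstar_alg \<subseteq>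
      op_closure (ops.span {op_tensor S id_op \<circ> comult T | S T. S \<in> cstar_alg \<and> T \<in> cstar_alg})"
  proof (rule dense)
    fix g a g' b
    (* of the two summands of the comultiplication only the one with first copy a survives, and its
       second factor is to be g', b *)
    let ?h = "act a g'" and ?c = "a \<noteq> b"
    have "op_tensor (basis_op (g - ?h) a) id_op \<circ> comult (basis_op ?h ?c) = op_tensor (basis_op g a) (basis_op g' b)"
      by (cases a) (simp_all add: comult_basis_op comp_add_right comp_tensor_left basis_op_comp act_def op_tensor_zero_left)
    then show "op_tensor (basis_op g a) (basis_op g' b) \<in> {op_tensor S id_op \<circ> comult T | S T. S \<in> cstar_alg \<and> T \<in> cstar_alg}"
      by (intro CollectI exI conjI) (rule sym, assumption, rule basis_op_cstar_alg, rule basis_op_cstar_alg)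
  qed (use cstar_alg_bounded in \<open>auto intro!: bounded_ops_closed(3) op_tensor_bounded bounded_ops_closed(5) comult_bounded\<close>)
  show "cstar_tensor cstar_alg cstar_alg \<subseteq>
      op_closure (ops.span {op_tensor id_op S \<circ> comult T | S T. S \<in> cstar_alg \<and> T \<in> cstar_alg})"
  proof (rule dense)
    fix g a g' b
    have "op_tensor id_op (basis_op (g' - act a g) b) \<circ> comult (basis_op g (a \<noteq> b)) = op_tensor (basis_op g a) (basis_op g' b)"
      by (cases a; cases b)
        (simp_all add: comult_basis_op comp_add_right comp_tensor_right basis_op_comp act_def op_tensor_zero_right)
    then show "op_tensor (basis_op g a) (basis_op g' b) \<in> {op_tensor id_op S \<circ> comult T | S T. S \<in> cstar_alg \<and> T \<in> cstar_alg}"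
      by (intro CollectI exI conjI) (rule sym, assumption, rule basis_op_cstar_alg, rule basis_op_cstar_alg)
  qed (use cstar_alg_bounded in \<open>auto intro!: bounded_ops_closed(3) op_tensor_bounded bounded_ops_closed(5) comult_bounded\<close>)
qed

end

context twisted_dual
begin

section \<open>Fourier coefficients and finite-dimensional representations\<close>

definition fourier :: "'i op \<Rightarrow> 'g \<Rightarrow> bool \<Rightarrow> complex" where
  "fourier x g k = x (delta (enc (0, k))) (enc (g, k))"

lemma fourier_add: "fourier (x + y) g k = fourier x g k + fourier y g k"
  "fourier (\<lambda>z i. x z i + y z i) g k = fourier x g k + fourier y g k"
  by (simp_all add: fourier_def)

lemma fourier_scale: "fourier (op_scale c x) g k = c * fourier x g k"
  by (simp add: fourier_def op_scale_def)

lemma fourier_zero: "fourier 0 g k = 0" "fourier (\<lambda>z i. 0) g k = 0"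
  by (simp_all add: fourier_def)

lemma fourier_sum: "fourier (sum f F) g k = (\<Sum>j\<in>F. fourier (f j) g k)"
  by (induction F rule: infinite_finite_induct) (auto simp: fourier_add fourier_zero)

lemma fourier_basis_op: "fourier (basis_op h m) g k = (if h = g \<and> k = m then 1 else 0)"
  by (auto simp: fourier_def basis_op_entry)

text \<open>Elements of the C*-algebra commute with right translations, so that one column in each copy of
  the group determines all the others.\<close>

lemma cstar_alg_entry:
  assumes x: "x \<in> cstar_alg"
  shows "x (delta (enc (h, c))) (enc (h', c')) = (if c = c' then fourier x (h' - h) c else 0)"
proof -
  define D where "D y = y (delta (enc (h, c))) (enc (h', c')) - (if c = c' then fourier y (h' - h) c else 0)" for y
  have D0: "D y = 0" if "y \<in> alg" for y
    using that unfolding alg_def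
  proof (induction rule: ops.span_induct_alt)
    case base
    show ?case by (simp add: D_def fourier_zero)
  next
    case (step a y z)
    then obtain g k where y: "y = basis_op g k"
      by (auto simp: gens_def)
    have "D y = 0"
      unfolding D_def y by (auto simp: basis_op_entry fourier_basis_op)
    moreover have "D (op_scale a y + z) = a * D y + D z"
      by (simp add: D_def fourier_add fourier_scale op_scale_apply algebra_simps)
    ultimately have "D (op_scale a y + z) = 0"
      using step.IH by simp
    then show ?case .
  qed
  have "cmod (D x) \<le> 0 + e" if "0 < e" for e
  proof -
    obtain y where y: "y \<in> alg" "bounded_by (e / 2) (x - y)"
      using op_closureE[OF x[unfolded cstar_alg_def] alg_bounded, of "e / 2"] \<open>0 < e\<close> by auto
    have "D x = D (x - y)"
      using D0[OF y(1)] by (simp add: D_def fourier_def split: if_splits)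
    moreover have "cmod (D (x - y)) \<le> e / 2 + e / 2"
      unfolding D_def fourier_def using op_entry_bound[OF y(2)] \<open>0 < e\<close>
      by (intro order_trans[OF norm_triangle_ineq4] add_mono) (auto split: if_splits)
    ultimately show ?thesis by simp
  qed
  then have "cmod (D x) \<le> 0"
    by (rule field_le_epsilon)
  then show ?thesis
    by (simp add: D_def)
qed

lemma fourier_ext:
  assumes "x \<in> cstar_alg" "y \<in> cstar_alg" "\<And>g k. fourier x g k = fourier y g k"
  shows "x = y"
  by (rule op_eqI_enc) (use assms cstar_alg_bounded in \<open>auto simp: cstar_alg_entry\<close>)

text \<open>The coefficients with a fixed \<open>k\<close> form a column, which is square-summable.\<close>

lemma fourier_finite_above:
  assumes x: "x \<in> bounded_ops" and c: "0 < c"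
  shows "finite {g. c \<le> cmod (fourier x g k)}"
proof -
  let ?v = "x (delta (enc (0, k)))"
  have v: "?v \<in> ell2"
    by (rule bounded_opsD(1)[OF x delta_ell2])
  have "card F \<le> nat \<lceil>(ell2_norm ?v / c)\<^sup>2\<rceil>" if F: "finite F" "F \<subseteq> {g. c \<le> cmod (fourier x g k)}" for F
  proof -
    have inj: "inj_on (\<lambda>g. enc (g, k)) F"
      by (auto intro: inj_onI)
    have "real (card F) * c\<^sup>2 = (\<Sum>g\<in>F. c\<^sup>2)"
      by simp
    also have "\<dots> \<le> (\<Sum>g\<in>F. (cmod (?v (enc (g, k))))\<^sup>2)"
      using F c by (intro sum_mono power_mono) (auto simp: fourier_def)
    also have "\<dots> = (l2_on ((\<lambda>g. enc (g, k)) ` F) ?v)\<^sup>2"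
      by (simp add: L2_set_def sum_nonneg sum.reindex[OF inj])
    also have "\<dots> \<le> (ell2_norm ?v)\<^sup>2"
      using l2_on_le_norm[OF v] F by (intro power_mono) auto
    finally have "real (card F) \<le> (ell2_norm ?v / c)\<^sup>2"
      using c by (simp add: power_divide field_simps)
    then show ?thesis by linarith
  qed
  then show ?thesis
    by (metis finite_if_finite_subsets_card_bdd)
qed

lemma alg_expansion:
  assumes x: "x \<in> cstar_alg" and S: "finite S" "\<And>g k. fourier x g k \<noteq> 0 \<Longrightarrow> g \<in> S"
  shows "x = (\<Sum>g\<in>S. \<Sum>k\<in>UNIV. op_scale (fourier x g k) (basis_op g k))"
    and "x \<in> alg"
proof -
  let ?y = "\<Sum>g\<in>S. \<Sum>k\<in>UNIV. op_scale (fourier x g k) (basis_op g k)"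
  have y: "?y \<in> alg"
    unfolding alg_def
    by (intro ops.span_sum ops.span_scale) (rule basis_op_alg[unfolded alg_def])
  show "x = ?y"
  proof (rule fourier_ext[OF x])
    show "?y \<in> cstar_alg"
      using y alg_subset by blast
    show "fourier x g k = fourier ?y g k" for g k
    proof -
      have "fourier ?y g k = (\<Sum>h\<in>S. if h = g then fourier x g k else 0)"
        unfolding fourier_sum
        by (intro sum.cong) (auto simp: fourier_scale fourier_basis_op UNIV_bool)
      also have "\<dots> = fourier x g k"
        using S by auto
      finally show ?thesis by simp
    qed
  qed
  with y show "x \<in> alg" by simp
qed

lemma alg_finite_support:
  assumes "x \<in> alg"
  shows "finite {g. fourier x g k \<noteq> 0}"
  using assms unfolding alg_def
proof (induction rule: ops.span_induct_alt)
  case base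
  show ?case by (simp add: fourier_zero)
next
  case (step a y z)
  then obtain h m where y: "y = basis_op h m"
    by (auto simp: gens_def)
  have "{g. fourier (op_scale a y + z) g k \<noteq> 0} \<subseteq> insert h {g. fourier z g k \<noteq> 0}"
    by (auto simp: y fourier_add fourier_scale fourier_basis_op split: if_splits)
  then show ?case
    using step by (meson finite_insert finite_subset)
qed

lemma fourier_comult:
  assumes "x \<in> bounded_ops"
  shows "comult x (delta (enc (0, a), enc (0, b))) (enc (g, a), enc (g', b)) =
    (if g' = act a g then fourier x g (a \<noteq> b) else 0)"
proof -
  have "mul_line (enc (g, a), enc (g', b)) (mul_coord (enc (0, a), enc (0, b))) = (enc (0, a), enc (0, b)) \<longleftrightarrow> g' = act a g"
    using add_eq_cancel_group[of "act a g" g' 0] by (cases a; cases b) (simp_all add: mul_coord_enc mul_line_enc)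
  then show ?thesis
    unfolding comult_def amp_entry[OF line_fibration_mul assms] fourier_def by (simp add: mul_coord_enc)
qed

lemma fd_repD:
  assumes "fd_rep cstar_alg comult u"
  shows "u \<in> carrier_mat (dim_row u) (dim_row u)" "dim_col u = dim_row u"
    and "i < dim_row u \<Longrightarrow> j < dim_row u \<Longrightarrow> u $$ (i, j) \<in> cstar_alg"
    and "i < dim_row u \<Longrightarrow> j < dim_row u \<Longrightarrow>
      comult (u $$ (i, j)) = (\<Sum>k<dim_row u. op_tensor (u $$ (i, k)) (u $$ (k, j)))"
proof -
  have car: "u \<in> carrier_mat (dim_row u) (dim_row u)" and el: "elements_mat u \<subseteq> cstar_alg"
    and co: "\<forall>i<dim_row u. \<forall>j<dim_row u. comult (u $$ (i, j)) = (\<Sum>k<dim_row u. op_tensor (u $$ (i, k)) (u $$ (k, j)))"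
    using assms unfolding fd_rep_def Let_def by blast+
  show "u \<in> carrier_mat (dim_row u) (dim_row u)"
    by (rule car)
  show "dim_col u = dim_row u"
    using car by (rule carrier_matD)
  show "u $$ (i, j) \<in> cstar_alg" if "i < dim_row u" "j < dim_row u"
    by (rule subsetD[OF el elements_matI[OF car that refl]])
  show "comult (u $$ (i, j)) = (\<Sum>k<dim_row u. op_tensor (u $$ (i, k)) (u $$ (k, j)))"
    if "i < dim_row u" "j < dim_row u"
    using co that by blast
qed

text \<open>
  Write \<open>U\<^sub>g\<^sub>,\<^sub>a\<close> for the matrix of the coefficients of a representation at \<open>(g, a)\<close>.  Comparing coefficients in
  \<open>\<Delta> u\<^sub>i\<^sub>j = \<Sum>k. u\<^sub>i\<^sub>k \<otimes> u\<^sub>k\<^sub>j\<close> shows that \<open>U\<^sub>g\<^sub>,\<^sub>a U\<^bsub>h,b\<^esub>\<close> is \<open>U\<^bsub>g,a+b\<^esub>\<close> if \<open>h = \<sigma>\<^sup>a g\<close> and zero otherwise.  In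
  particular the matrices \<open>U\<^sub>g\<^sub>,\<^sub>0\<close> are orthogonal idempotents.
\<close>

lemma rep_fourier_mult:
  assumes u: "fd_rep cstar_alg comult u" and ij: "i < dim_row u" "j < dim_row u"
  shows "(\<Sum>k<dim_row u. fourier (u $$ (i, k)) g a * fourier (u $$ (k, j)) g' b) =
    (if g' = act a g then fourier (u $$ (i, j)) g (a \<noteq> b) else 0)"
proof -
  have mem: "u $$ (i, j) \<in> bounded_ops" if "i < dim_row u" "j < dim_row u" for i j
    using fd_repD(3)[OF u that] cstar_alg_bounded by blast
  have "(\<Sum>k<dim_row u. fourier (u $$ (i, k)) g a * fourier (u $$ (k, j)) g' b) =
      (\<Sum>k<dim_row u. op_tensor (u $$ (i, k)) (u $$ (k, j)) (delta (enc (0, a), enc (0, b))) (enc (g, a), enc (g', b)))"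
    by (intro sum.cong) (auto simp: fourier_def op_tensor_entry mem ij)
  also have "\<dots> = comult (u $$ (i, j)) (delta (enc (0, a), enc (0, b))) (enc (g, a), enc (g', b))"
    by (simp add: fd_repD(4)[OF u ij] sum_apply)
  finally show ?thesis
    by (simp add: fourier_comult mem ij)
qed

text \<open>
  A nonzero idempotent matrix has an entry of absolute value at least \<open>1/n\<close>, while the coefficients of
  a bounded operator are square-summable.  So only finitely many of the idempotents \<open>U\<^sub>g\<^sub>,\<^sub>0\<close> are nonzero, and
  the other coefficients vanish along with them because \<open>U\<^sub>g\<^sub>,\<^sub>a = U\<^sub>g\<^sub>,\<^sub>0 U\<^sub>g\<^sub>,\<^sub>a\<close>.
\<close>

lemma rep_entries_alg:
  assumes u: "fd_rep cstar_alg comult u" and ij: "i < dim_row u" "j < dim_row u"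
  shows "u $$ (i, j) \<in> alg"
proof -
  define n where "n = dim_row u"
  define P where "P g i j = fourier (u $$ (i, j)) g False" for g i j
  define S where "S = {g. \<exists>i<n. \<exists>j<n. P g i j \<noteq> 0}"
  have n: "0 < n"
    using ij by (simp add: n_def)
  have mem: "u $$ (i, j) \<in> cstar_alg" "u $$ (i, j) \<in> bounded_ops" if "i < n" "j < n" for i j
    using fd_repD(3)[OF u] that cstar_alg_bounded unfolding n_def by auto
  have PP: "(\<Sum>k<n. P g i k * P g k j) = P g i j" if "i < n" "j < n" for g i j
    using rep_fourier_mult[OF u, of i j g False g False] that by (simp add: P_def n_def act_def)
  have "S \<subseteq> (\<Union>i<n. \<Union>j<n. {g. 1 / n \<le> cmod (fourier (u $$ (i, j)) g False)})"
  proof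
    fix g assume "g \<in> S"
    then obtain i0 j0 where ij0: "i0 < n" "j0 < n" "P g i0 j0 \<noteq> 0"
      by (auto simp: S_def)
    define M where "M = Max ((\<lambda>(i, j). cmod (P g i j)) ` ({..<n} \<times> {..<n}))"
    have "M \<in> (\<lambda>(i, j). cmod (P g i j)) ` ({..<n} \<times> {..<n})"
      unfolding M_def using ij0 by (intro Max_in) auto
    then obtain i j where ij: "i < n" "j < n" "M = cmod (P g i j)"
      by auto
    have le: "cmod (P g i j) \<le> M" if "i < n" "j < n" for i j
      unfolding M_def using that by (intro Max_ge) auto
    have M: "0 < M"
      using le[OF ij0(1,2)] ij0(3) by (meson less_le_trans zero_less_norm_iff)
    have "M = cmod (\<Sum>k<n. P g i k * P g k j)"
      using PP[OF ij(1,2)] ij(3) by simp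
    also have "\<dots> \<le> (\<Sum>k<n. M * M)"
      by (rule sum_norm_le) (use le ij M in \<open>auto simp: norm_mult intro!: mult_mono\<close>)
    finally have "1 \<le> n * M"
      using M by simp
    then have "1 / n \<le> M"
      using n by (simp add: field_simps)
    then show "g \<in> (\<Union>i<n. \<Union>j<n. {g. 1 / n \<le> cmod (fourier (u $$ (i, j)) g False)})"
      using ij by (auto simp: P_def)
  qed
  moreover have "finite (\<Union>i<n. \<Union>j<n. {g. 1 / n \<le> cmod (fourier (u $$ (i, j)) g False)})"
    using n mem by (auto intro!: fourier_finite_above)
  ultimately have "finite S"
    by (rule finite_subset)
  moreover have "g \<in> S" if nz: "fourier (u $$ (i, j)) g k \<noteq> 0" for g k
  proof (rule ccontr)
    assume "g \<notin> S"
    then have "P g i m = 0" if "m < n" for m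
      using ij that by (auto simp: S_def n_def)
    then have "(\<Sum>m<n. fourier (u $$ (i, m)) g False * fourier (u $$ (m, j)) g k) = 0"
      by (simp add: P_def)
    then show False
      using rep_fourier_mult[OF u ij, of g False g k] nz by (simp add: n_def act_def)
  qed
  ultimately show ?thesis
    using alg_expansion(2) mem ij by (metis n_def)
qed

text \<open>
  The two-dimensional representation supported on the orbit \<open>{g, \<sigma> g}\<close>, which the nontrivial element of
  \<open>\<int>/2\<close> permutes.  If \<open>\<sigma> g = g\<close> it is reducible.
\<close>

definition orbit_rep :: "'g \<Rightarrow> 'i op mat" where
  "orbit_rep g = mat 2 2 (\<lambda>(i, j). basis_op (act (i = 1) g) (i \<noteq> j))"

lemma lessThan_2: "{..<2::nat} = {0, 1}"
  by auto

lemma orbit_rep_unitary: "unitary_fd_rep cstar_alg comult (orbit_rep g)"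
proof -
  let ?u = "orbit_rep g"
  have dims [simp]: "dim_row ?u = 2" "dim_col ?u = 2"
    by (simp_all add: orbit_rep_def)
  have entry: "?u $$ (i, j) = basis_op (act (i = 1) g) (i \<noteq> j)" if "i < 2" "j < 2" for i j
    using that by (simp add: orbit_rep_def)
  have adj_entry: "opmat_adj ?u $$ (i, j) = basis_op (- act (j = 1) g) (i \<noteq> j)" if "i < 2" "j < 2" for i j
    using that by (auto simp: opmat_adj_def entry basis_op_adj eq_commute[of i j])
  have adj_dims [simp]: "dim_row (opmat_adj ?u) = 2" "dim_col (opmat_adj ?u) = 2"
    by (simp_all add: opmat_adj_def)
  have id: "basis_op 0 False + basis_op 0 True = id_op" "basis_op 0 True + basis_op 0 False = id_op"
    using id_op_basis by (simp_all add: add.commute)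
  have uu: "opmat_mult ?u (opmat_adj ?u) = opmat_one 2"
    by (rule eq_matI)
      (auto simp: opmat_mult_def opmat_one_def entry adj_entry basis_op_comp lessThan_2 less_2_cases_iff id)
  have uu': "opmat_mult (opmat_adj ?u) ?u = opmat_one 2"
    by (rule eq_matI)
      (auto simp: opmat_mult_def opmat_one_def entry adj_entry basis_op_comp lessThan_2 less_2_cases_iff id)
  have "\<forall>i<2. \<forall>j<2. comult (?u $$ (i, j)) = (\<Sum>k<2. op_tensor (?u $$ (i, k)) (?u $$ (k, j)))"
    by (auto simp: less_2_cases_iff entry lessThan_2 comult_basis_op act_def add.commute)
  moreover have "elements_mat ?u \<subseteq> cstar_alg" "elements_mat (opmat_adj ?u) \<subseteq> cstar_alg"
    by (auto simp: elements_mat_def entry adj_entry)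
  moreover have "?u \<in> carrier_mat 2 2" "opmat_adj ?u \<in> carrier_mat 2 2"
    by (auto intro: carrier_matI)
  ultimately show ?thesis
    unfolding unitary_fd_rep_def fd_rep_def Let_def using uu uu' by auto
qed

lemma orbit_rep_fd: "fd_rep cstar_alg comult (orbit_rep g)"
  using orbit_rep_unitary by (simp add: unitary_fd_rep_def)

lemma cqg_carrier: "carrier (cqg_algebra cstar_alg comult) = alg"
proof -
  have "ops.span (\<Union>u\<in>{u. unitary_fd_rep cstar_alg comult u}. elements_mat u) = ops.span gens"
  proof (rule ops.span_eq[THEN iffD2], intro conjI subsetI)
    fix x assume "x \<in> (\<Union>u\<in>{u. unitary_fd_rep cstar_alg comult u}. elements_mat u)"
    then obtain u where u: "fd_rep cstar_alg comult u" and x: "x \<in> elements_mat u"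
      by (auto simp: unitary_fd_rep_def)
    then obtain i j where "x = u $$ (i, j)" "i < dim_row u" "j < dim_row u"
      using elements_matD[OF x] fd_repD(2)[OF u] by auto
    then show "x \<in> ops.span gens"
      using rep_entries_alg[OF u] by (simp add: alg_def)
  next
    fix x assume "x \<in> gens"
    then obtain g k where x: "x = basis_op g k"
      by (auto simp: gens_def)
    have "orbit_rep g \<in> carrier_mat 2 2"
      by (simp add: orbit_rep_def)
    then have "x \<in> elements_mat (orbit_rep g)"
      by (rule elements_matI[of _ _ _ 0 "if k then 1 else 0"]) (simp_all add: x orbit_rep_def act_def)
    then show "x \<in> ops.span (\<Union>u\<in>{u. unitary_fd_rep cstar_alg comult u}. elements_mat u)"
      using orbit_rep_unitary by (intro ops.span_base) blast
  qed
  then show ?thesis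
    by (simp add: cqg_algebra_def alg_def)
qed

end

section \<open>Characters of representations\<close>

text \<open>
  A right inverse \<open>R\<close> of \<open>T\<close> is chosen column by column.  Then \<open>1 - R T\<close> maps into the kernel of \<open>T\<close>, which is the
  image of \<open>S\<close>, so it factors as \<open>S Q\<close>.
\<close>

lemma short_exact_split:
  fixes S T :: "complex mat"
  assumes S: "S \<in> carrier_mat n n'" and T: "T \<in> carrier_mat n'' n"
    and inj: "mat_kernel S = {0\<^sub>v n'}" and ex: "mat_image S = mat_kernel T"
    and surj: "mat_image T = carrier_vec n''"
  obtains R Q where "R \<in> carrier_mat n n''" "Q \<in> carrier_mat n' n"
    "T * R = 1\<^sub>m n''" "Q * S = 1\<^sub>m n'" "R * T + S * Q = 1\<^sub>m n"
proof -
  have "\<exists>r. r \<in> carrier_vec n \<and> T *\<^sub>v r = unit_vec n'' j" for j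
  proof -
    have "unit_vec n'' j \<in> mat_image T"
      using surj by simp
    then show ?thesis
      using T by (auto simp: mat_image_def)
  qed
  then obtain r where r: "\<And>j. r j \<in> carrier_vec n" "\<And>j. T *\<^sub>v r j = unit_vec n'' j"
    by metis
  define R where "R = mat n n'' (\<lambda>(i, j). r j $ i)"
  have R: "R \<in> carrier_mat n n''"
    by (simp add: R_def)
  have colR: "col R j = r j" if "j < n''" for j
    using that r(1)[of j] by (intro eq_vecI) (auto simp: R_def)
  have TR: "T * R = 1\<^sub>m n''"
  proof (rule mat_col_eqI)
    fix j assume j: "j < dim_col (1\<^sub>m n'' :: complex mat)"
    then have "col (T * R) j = T *\<^sub>v r j"
      by (simp add: col_mult2[OF T R] colR)
    with j show "col (T * R) j = col (1\<^sub>m n'') j"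
      unfolding r(2) by simp
  qed (use T R in auto)
  let ?W = "1\<^sub>m n - R * T"
  have W: "?W \<in> carrier_mat n n"
    using R T by auto
  have TRT: "T * (R * T) = T"
    using T R TR by (simp flip: assoc_mult_mat[OF T R T])
  have TW: "T * ?W = 0\<^sub>m n'' n"
    using T R TRT by (subst mult_minus_distrib_mat[OF T, of _ n]) auto
  have "\<exists>q. q \<in> carrier_vec n' \<and> S *\<^sub>v q = col ?W j" if j: "j < n" for j
  proof -
    have "T *\<^sub>v col ?W j = 0\<^sub>v n''"
      using j TW by (simp flip: col_mult2[OF T W j])
    moreover have "col ?W j \<in> carrier_vec n"
      using W col_dim by (metis carrier_matD(1))
    ultimately have "col ?W j \<in> mat_image S"
      using T unfolding ex mat_kernel_def by simp
    then show ?thesis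
      using S by (auto simp: mat_image_def)
  qed
  then obtain q where q: "\<And>j. j < n \<Longrightarrow> q j \<in> carrier_vec n'" "\<And>j. j < n \<Longrightarrow> S *\<^sub>v q j = col ?W j"
    by metis
  define Q where "Q = mat n' n (\<lambda>(i, j). q j $ i)"
  have Q: "Q \<in> carrier_mat n' n"
    by (simp add: Q_def)
  have colQ: "col Q j = q j" if "j < n" for j
    using that q(1)[OF that] by (intro eq_vecI) (auto simp: Q_def)
  have SQ: "S * Q = ?W"
  proof (rule mat_col_eqI)
    fix j assume "j < dim_col ?W"
    then have j: "j < n" using W by auto
    then show "col (S * Q) j = col ?W j"
      using q(2) by (simp add: col_mult2[OF S Q] colQ)
  qed (use S Q R T in auto)
  have sum: "R * T + S * Q = 1\<^sub>m n"
    unfolding SQ by (rule eq_matI) (use R T in auto)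
  have TS: "T * S = 0\<^sub>m n'' n'"
  proof (rule mat_col_eqI)
    fix j assume "j < dim_col (0\<^sub>m n'' n' :: complex mat)"
    then have j: "j < n'" by simp
    have "col S j = S *\<^sub>v unit_vec n' j"
      using S j by (intro eq_vecI) auto
    then have "col S j \<in> mat_image S"
      using S by (auto simp: mat_image_def)
    then show "col (T * S) j = col (0\<^sub>m n'' n') j"
      using T j unfolding ex mat_kernel_def by (simp add: col_mult2[OF T S])
  qed (use S T in auto)
  have QS: "Q * S \<in> carrier_mat n' n'"
    using Q S by auto
  have SQS: "S * (Q * S) = S"
  proof -
    have "S * (Q * S) = ?W * S"
      unfolding SQ[symmetric] by (rule assoc_mult_mat[OF S Q S, symmetric])
    also have "\<dots> = 1\<^sub>m n * S - (R * T) * S"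
      using R T by (intro minus_mult_distrib_mat[OF _ _ S, of _ n]) auto
    also have "(R * T) * S = R * (T * S)"
      by (rule assoc_mult_mat[OF R T S])
    also have "\<dots> = 0\<^sub>m n n'"
      unfolding TS using R by simp
    also have "1\<^sub>m n * S - 0\<^sub>m n n' = S"
      using S by auto
    finally show ?thesis .
  qed
  have "Q * S - 1\<^sub>m n' = 0\<^sub>m n' n'"
  proof (rule mat_col_eqI)
    fix j assume "j < dim_col (0\<^sub>m n' n' :: complex mat)"
    then have j: "j < n'" by simp
    have D: "Q * S - 1\<^sub>m n' \<in> carrier_mat n' n'"
      using QS by auto
    have "S * (Q * S - 1\<^sub>m n') = 0\<^sub>m n n'"
      using S QS SQS by (subst mult_minus_distrib_mat[OF S, of _ n']) auto
    then have "S *\<^sub>v col (Q * S - 1\<^sub>m n') j = 0\<^sub>v n"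
      using j by (simp flip: col_mult2[OF S D j])
    moreover have "col (Q * S - 1\<^sub>m n') j \<in> carrier_vec n'"
      using D col_dim by (metis carrier_matD(1))
    ultimately have "col (Q * S - 1\<^sub>m n') j \<in> mat_kernel S"
      using S unfolding mat_kernel_def by simp
    then show "col (Q * S - 1\<^sub>m n') j = col (0\<^sub>m n' n') j"
      using j by (simp add: inj)
  qed (use Q S in auto)
  then have diff: "(Q * S - 1\<^sub>m n') $$ (i, j) = 0" if "i < n'" "j < n'" for i j
    using that by simp
  have "Q * S = 1\<^sub>m n'"
  proof (rule eq_matI)
    fix i j assume "i < dim_row (1\<^sub>m n' :: complex mat)" "j < dim_col (1\<^sub>m n' :: complex mat)"
    then have ij: "i < n'" "j < n'" by simp_all
    then have "(Q * S - 1\<^sub>m n') $$ (i, j) = (Q * S) $$ (i, j) - 1\<^sub>m n' $$ (i, j)"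
      by (intro index_minus_mat) auto
    then show "(Q * S) $$ (i, j) = 1\<^sub>m n' $$ (i, j)"
      using diff[OF ij] by simp
  qed (use Q S in auto)
  then show ?thesis
    using that R Q TR sum by blast
qed

definition character :: "'i op mat \<Rightarrow> 'i op" where
  "character u = (\<Sum>i<dim_row u. u $$ (i, i))"

text \<open>
  Characters are additive on short exact sequences as elements of the algebra.  Split the sequence and write
  \<open>u = u R T + u S Q\<close>.  The trace of the first summand is that of \<open>T u R = u'' T R = u''\<close>, and the trace of the
  second is that of \<open>Q u S = Q S u' = u'\<close>; the cyclic rearrangement is legitimate because \<open>R\<close>, \<open>S\<close>, \<open>T\<close>, \<open>Q\<close>
  have scalar entries.
\<close>

lemma intertwiner_trace:
  fixes u v :: "'i op mat" and R T :: "complex mat"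
  assumes T: "intertwiner u v T" and n: "dim_row u = n" and m: "dim_row v = m"
    and R: "R \<in> carrier_mat n m" and TR: "T * R = 1\<^sub>m m"
  shows "(\<Sum>i<n. \<Sum>j<n. op_scale ((R * T) $$ (j, i)) (u $$ (i, j))) = character v"
proof -
  have Tc: "T \<in> carrier_mat m n"
    and TI: "\<And>i j. i < m \<Longrightarrow> j < n \<Longrightarrow>
      (\<Sum>k<n. op_scale (T $$ (i, k)) (u $$ (k, j))) = (\<Sum>k<m. op_scale (T $$ (k, j)) (v $$ (i, k)))"
    using T unfolding intertwiner_def n m by auto
  have RT: "(R * T) $$ (j, i) = (\<Sum>k<m. R $$ (j, k) * T $$ (k, i))" if "j < n" "i < n" for i j
    using that R Tc by (simp add: scalar_prod_def lessThan_atLeast0)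
  have TR': "(\<Sum>j<n. T $$ (i, j) * R $$ (j, k)) = (if i = k then 1 else 0)" if "i < m" "k < m" for i k
  proof -
    have "(T * R) $$ (i, k) = (\<Sum>j<n. T $$ (i, j) * R $$ (j, k))"
      using that R Tc by (simp add: scalar_prod_def lessThan_atLeast0)
    then show ?thesis
      using that TR by simp
  qed
  have "(\<Sum>i<n. \<Sum>j<n. op_scale ((R * T) $$ (j, i)) (u $$ (i, j))) =
      (\<Sum>i<n. \<Sum>j<n. \<Sum>k<m. op_scale (R $$ (j, k)) (op_scale (T $$ (k, i)) (u $$ (i, j))))"
    by (simp add: RT ops.scale_sum_left)
  also have "\<dots> = (\<Sum>j<n. \<Sum>i<n. \<Sum>k<m. op_scale (R $$ (j, k)) (op_scale (T $$ (k, i)) (u $$ (i, j))))"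
    by (rule sum.swap)
  also have "\<dots> = (\<Sum>j<n. \<Sum>k<m. \<Sum>i<n. op_scale (R $$ (j, k)) (op_scale (T $$ (k, i)) (u $$ (i, j))))"
    by (intro sum.cong refl sum.swap)
  also have "\<dots> = (\<Sum>j<n. \<Sum>k<m. op_scale (R $$ (j, k)) (\<Sum>i<m. op_scale (T $$ (i, j)) (v $$ (k, i))))"
    by (intro sum.cong refl) (simp only: lessThan_iff TI ops.scale_sum_right[symmetric])
  also have "\<dots> = (\<Sum>j<n. \<Sum>k<m. \<Sum>i<m. op_scale (T $$ (i, j) * R $$ (j, k)) (v $$ (k, i)))"
    by (simp add: ops.scale_sum_right mult.commute)
  also have "\<dots> = (\<Sum>k<m. \<Sum>j<n. \<Sum>i<m. op_scale (T $$ (i, j) * R $$ (j, k)) (v $$ (k, i)))"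
    by (rule sum.swap)
  also have "\<dots> = (\<Sum>k<m. \<Sum>i<m. \<Sum>j<n. op_scale (T $$ (i, j) * R $$ (j, k)) (v $$ (k, i)))"
    by (intro sum.cong refl sum.swap)
  also have "\<dots> = (\<Sum>k<m. \<Sum>i<m. op_scale (if i = k then 1 else 0) (v $$ (k, i)))"
    by (intro sum.cong refl) (simp add: TR' flip: ops.scale_sum_left)
  also have "\<dots> = (\<Sum>k<m. \<Sum>i<m. if i = k then v $$ (k, k) else 0)"
    by (intro sum.cong refl) auto
  also have "\<dots> = character v"
    by (simp add: character_def m)
  finally show ?thesis .
qed

lemma character_short_exact:
  assumes "short_exact u' u u''"
  shows "character u = character u' + character u''"
proof -
  define n n' n'' where "n = dim_row u" and "n' = dim_row u'" and "n'' = dim_row u''"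
  obtain S T where SI: "intertwiner u' u S" and TI: "intertwiner u u'' T"
    and ex: "mat_kernel S = {0\<^sub>v n'}" "mat_image S = mat_kernel T" "mat_image T = carrier_vec n''"
    using assms unfolding short_exact_def n'_def n''_def by blast
  have S: "S \<in> carrier_mat n n'" and T: "T \<in> carrier_mat n'' n"
    using SI TI unfolding intertwiner_def n_def n'_def n''_def by auto
  obtain R Q where RQ: "R \<in> carrier_mat n n''" "Q \<in> carrier_mat n' n"
    "T * R = 1\<^sub>m n''" "Q * S = 1\<^sub>m n'" "R * T + S * Q = 1\<^sub>m n"
    using short_exact_split[OF S T ex] .
  have SQ: "(\<Sum>i<n. \<Sum>j<n. op_scale ((S * Q) $$ (j, i)) (u $$ (i, j))) = character u'"
  proof -
    have SI': "(\<Sum>k<n'. op_scale (S $$ (i, k)) (u' $$ (k, j))) = (\<Sum>k<n. op_scale (S $$ (k, j)) (u $$ (i, k)))"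
      if "i < n" "j < n'" for i j
      using SI that unfolding intertwiner_def n_def n'_def by blast
    have SQe: "(S * Q) $$ (j, i) = (\<Sum>k<n'. S $$ (j, k) * Q $$ (k, i))" if "j < n" "i < n" for i j
      using that S RQ by (simp add: scalar_prod_def lessThan_atLeast0)
    have QSe: "(\<Sum>i<n. Q $$ (k, i) * S $$ (i, j)) = (if k = j then 1 else 0)" if "k < n'" "j < n'" for k j
    proof -
      have "(Q * S) $$ (k, j) = (\<Sum>i<n. Q $$ (k, i) * S $$ (i, j))"
        using that S RQ(2) by (simp add: scalar_prod_def lessThan_atLeast0)
      then show ?thesis
        unfolding RQ(4) using that by simp
    qed
    have "(\<Sum>i<n. \<Sum>j<n. op_scale ((S * Q) $$ (j, i)) (u $$ (i, j))) =
        (\<Sum>i<n. \<Sum>j<n. \<Sum>k<n'. op_scale (Q $$ (k, i)) (op_scale (S $$ (j, k)) (u $$ (i, j))))"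
      by (simp add: SQe ops.scale_sum_left mult.commute)
    also have "\<dots> = (\<Sum>i<n. \<Sum>k<n'. \<Sum>j<n. op_scale (Q $$ (k, i)) (op_scale (S $$ (j, k)) (u $$ (i, j))))"
      by (intro sum.cong refl sum.swap)
    also have "\<dots> = (\<Sum>i<n. \<Sum>k<n'. op_scale (Q $$ (k, i)) (\<Sum>j<n'. op_scale (S $$ (i, j)) (u' $$ (j, k))))"
      by (intro sum.cong refl) (simp only: lessThan_iff SI' ops.scale_sum_right[symmetric])
    also have "\<dots> = (\<Sum>i<n. \<Sum>k<n'. \<Sum>j<n'. op_scale (Q $$ (k, i) * S $$ (i, j)) (u' $$ (j, k)))"
      by (simp add: ops.scale_sum_right)
    also have "\<dots> = (\<Sum>k<n'. \<Sum>i<n. \<Sum>j<n'. op_scale (Q $$ (k, i) * S $$ (i, j)) (u' $$ (j, k)))"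
      by (rule sum.swap)
    also have "\<dots> = (\<Sum>k<n'. \<Sum>j<n'. \<Sum>i<n. op_scale (Q $$ (k, i) * S $$ (i, j)) (u' $$ (j, k)))"
      by (intro sum.cong refl sum.swap)
    also have "\<dots> = (\<Sum>k<n'. \<Sum>j<n'. op_scale (if k = j then 1 else 0) (u' $$ (j, k)))"
      by (intro sum.cong refl) (simp add: QSe flip: ops.scale_sum_left)
    also have "\<dots> = (\<Sum>k<n'. \<Sum>j<n'. if k = j then u' $$ (k, k) else 0)"
      by (intro sum.cong refl) auto
    also have "\<dots> = character u'"
      by (simp add: character_def n'_def)
    finally show ?thesis .
  qed
  have "character u = (\<Sum>i<n. \<Sum>j<n. if i = j then u $$ (i, i) else 0)"
    by (simp add: character_def n_def)
  also have "\<dots> = (\<Sum>i<n. \<Sum>j<n. op_scale ((1\<^sub>m n :: complex mat) $$ (j, i)) (u $$ (i, j)))"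
    by (intro sum.cong refl) auto
  also have "\<dots> = (\<Sum>i<n. \<Sum>j<n. op_scale ((R * T) $$ (j, i)) (u $$ (i, j))) +
      (\<Sum>i<n. \<Sum>j<n. op_scale ((S * Q) $$ (j, i)) (u $$ (i, j)))"
  proof -
    have "(1\<^sub>m n :: complex mat) $$ (j, i) = (R * T) $$ (j, i) + (S * Q) $$ (j, i)" if "i < n" "j < n" for i j
      unfolding RQ(5)[symmetric] by (subst index_add_mat) (use that RQ(1,2) S T in auto)
    then show ?thesis
      unfolding sum.distrib[symmetric] ops.scale_left_distrib[symmetric] by (intro sum.cong refl) simp
  qed
  also have "\<dots> = character u'' + character u'"
    using intertwiner_trace[OF TI n_def[symmetric] n''_def[symmetric] RQ(1) RQ(3)] SQ by simp
  finally show ?thesis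
    by (simp add: add.commute)
qed

lemma comp_sum_left: "(sum f F) \<circ> T = (\<Sum>j\<in>F. f j \<circ> T)" for T :: "'i op"
  by (induction F rule: infinite_finite_induct) (auto simp: fun_eq_iff)

lemma comp_sum_right:
  assumes "S \<in> bounded_ops"
  shows "(\<And>j. j \<in> F \<Longrightarrow> f j \<in> bounded_ops) \<Longrightarrow> S \<circ> sum f F = (\<Sum>j\<in>F. S \<circ> f j)"
proof (induction F rule: infinite_finite_induct)
  case (insert x F)
  then have "sum f F \<in> bounded_ops"
    by (intro ops.subspace_sum[OF bounded_ops_subspace]) auto
  moreover have "f x \<in> bounded_ops" "S \<circ> sum f F = (\<Sum>j\<in>F. S \<circ> f j)"
    using insert.IH insert.prems by blast+
  ultimately show ?case
    by (simp only: sum.insert[OF insert.hyps] comp_add_right[OF assms])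
qed (use op_zero(1)[OF assms] in \<open>auto simp: fun_eq_iff\<close>)

lemma sum_div_mod:
  fixes f :: "nat \<Rightarrow> nat \<Rightarrow> 'a::comm_monoid_add"
  shows "(\<Sum>p<n * m. f (p div m) (p mod m)) = (\<Sum>i<n. \<Sum>j<m. f i j)"
proof -
  have "(\<Sum>i<n. \<Sum>j<m. f i j) = (\<Sum>(i, j)\<in>{..<n} \<times> {..<m}. f i j)"
    by (simp add: sum.cartesian_product)
  also have "\<dots> = (\<Sum>p<n * m. f (p div m) (p mod m))"
  proof (rule sum.reindex_bij_witness[where i = "\<lambda>p. (p div m, p mod m)" and j = "\<lambda>(i, j). i * m + j"])
    fix p assume "p \<in> {..<n * m}"
    then show "(p div m, p mod m) \<in> {..<n} \<times> {..<m}"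
      by (cases "m = 0") (auto simp: less_mult_imp_div_less)
  next
    fix q assume "q \<in> {..<n} \<times> {..<m}"
    then obtain i j where q: "q = (i, j)" "i < n" "j < m" by auto
    have "i * m + j < Suc i * m" using q by simp
    also have "\<dots> \<le> n * m" using q by (intro mult_right_mono) auto
    finally show "(case q of (i, j) \<Rightarrow> i * m + j) \<in> {..<n * m}"
      using q by simp
  qed auto
  finally show ?thesis by simp
qed

lemma character_rep_tensor:
  assumes "\<And>i. i < dim_row u \<Longrightarrow> u $$ (i, i) \<in> bounded_ops" "\<And>i. i < dim_row v \<Longrightarrow> v $$ (i, i) \<in> bounded_ops"
  shows "character (rep_tensor u v) = character u \<circ> character v"
proof -
  let ?n = "dim_row u" and ?m = "dim_row v"
  have "character (rep_tensor u v) = (\<Sum>p<?n * ?m. u $$ (p div ?m, p div ?m) \<circ> v $$ (p mod ?m, p mod ?m))"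
    by (simp add: character_def rep_tensor_def Let_def)
  also have "\<dots> = (\<Sum>i<?n. \<Sum>j<?m. u $$ (i, i) \<circ> v $$ (j, j))"
    by (rule sum_div_mod)
  also have "\<dots> = (\<Sum>i<?n. u $$ (i, i) \<circ> (\<Sum>j<?m. v $$ (j, j)))"
    by (intro sum.cong refl comp_sum_right[symmetric]) (use assms in auto)
  also have "\<dots> = character u \<circ> character v"
    by (simp add: character_def comp_sum_left)
  finally show ?thesis .
qed

section \<open>Extending multiplicative functions to monoid algebras and quotients\<close>

text \<open>
  The fusion ring and its complexification are iterated quotients of monoid algebras.  To evaluate a
  ring homomorphism on them it is not necessary to know that they are rings: it suffices to follow the
  homomorphism through the construction, on a subset \<open>G\<close> of the elements for which it is well defined.
\<close>

definition scalar_hom :: "('k::comm_ring_1 \<Rightarrow> 'd::comm_ring_1) \<Rightarrow> bool" where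
  "scalar_hom \<kappa> \<longleftrightarrow> \<kappa> 0 = 0 \<and> \<kappa> 1 = 1 \<and> (\<forall>a b. \<kappa> (a + b) = \<kappa> a + \<kappa> b) \<and> (\<forall>a b. \<kappa> (a * b) = \<kappa> a * \<kappa> b)"

lemma scalar_homD:
  assumes "scalar_hom \<kappa>"
  shows "\<kappa> 0 = 0" "\<kappa> 1 = 1" "\<kappa> (a + b) = \<kappa> a + \<kappa> b" "\<kappa> (a * b) = \<kappa> a * \<kappa> b"
  using assms by (auto simp: scalar_hom_def)

text \<open>\<open>G\<close> is closed under the operations and \<open>h\<close> is compatible with them there; nothing is said outside of \<open>G\<close>.\<close>

definition mult_hom_on :: "('m, 'b) monoid_scheme \<Rightarrow> 'm set \<Rightarrow> ('m \<Rightarrow> 'd::comm_ring_1) \<Rightarrow> bool" where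
  "mult_hom_on M G h \<longleftrightarrow> \<one>\<^bsub>M\<^esub> \<in> G \<and> h \<one>\<^bsub>M\<^esub> = 1 \<and>
     (\<forall>a\<in>G. \<forall>b\<in>G. a \<otimes>\<^bsub>M\<^esub> b \<in> G \<and> h (a \<otimes>\<^bsub>M\<^esub> b) = h a * h b)"

definition ring_hom_on :: "('m, 'b) ring_scheme \<Rightarrow> 'm set \<Rightarrow> ('m \<Rightarrow> 'd::comm_ring_1) \<Rightarrow> bool" where
  "ring_hom_on R G h \<longleftrightarrow> mult_hom_on R G h \<and>
     (\<forall>a\<in>G. \<forall>b\<in>G. a \<oplus>\<^bsub>R\<^esub> b \<in> G \<and> h (a \<oplus>\<^bsub>R\<^esub> b) = h a + h b)"

abbreviation keys where "keys \<equiv> Poly_Mapping.keys"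
abbreviation lookup where "lookup \<equiv> Poly_Mapping.lookup"
abbreviation single where "single \<equiv> Poly_Mapping.single"

definition free_ext :: "('k::comm_ring_1 \<Rightarrow> 'v \<Rightarrow> 'v::ab_group_add) \<Rightarrow> ('m \<Rightarrow> 'v) \<Rightarrow> ('m \<Rightarrow>\<^sub>0 'k) \<Rightarrow> 'v" where
  "free_ext \<mu> h f = (\<Sum>a\<in>keys f. \<mu> (lookup f a) (h a))"

lemma keys_smult: "keys (Poly_Mapping.map ((*) c) f) \<subseteq> keys f" for c :: "'k::comm_ring_1"
  by (auto simp: in_keys_iff map.rep_eq when_def)

lemma lookup_smult: "lookup (Poly_Mapping.map ((*) c) f) a = c * lookup f a"
  for c :: "'k::comm_ring_1"
  by (auto simp: map.rep_eq when_def)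

context Modules.module
begin

lemma free_ext_superset:
  assumes "finite S" "keys f \<subseteq> S"
  shows "free_ext scale h f = (\<Sum>a\<in>S. scale (lookup f a) (h a))"
  unfolding free_ext_def using assms
  by (intro sum.mono_neutral_left) (auto simp: in_keys_iff)

lemma free_ext_add: "free_ext scale h (f + g) = free_ext scale h f + free_ext scale h g"
proof -
  let ?S = "keys f \<union> keys g"
  have S: "finite ?S"
    by simp
  show ?thesis
    unfolding free_ext_superset[OF S Un_upper1, of h] free_ext_superset[OF S Un_upper2, of h]
      free_ext_superset[OF S keys_add, of h]
    by (simp add: lookup_add scale_left_distrib sum.distrib)
qed

lemma free_ext_zero: "free_ext scale h 0 = 0"
  by (simp add: free_ext_def)

lemma free_ext_uminus: "free_ext scale h (- f) = - free_ext scale h f"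
  using free_ext_add[of h f "- f"] by (simp add: free_ext_zero eq_neg_iff_add_eq_0 add.commute)

lemma free_ext_diff: "free_ext scale h (f - g) = free_ext scale h f - free_ext scale h g"
  using free_ext_add[of h f "- g"] by (simp add: free_ext_uminus)

lemma free_ext_sum: "free_ext scale h (sum F S) = (\<Sum>j\<in>S. free_ext scale h (F j))"
  by (induction S rule: infinite_finite_induct) (auto simp: free_ext_add free_ext_zero)

lemma free_ext_single: "free_ext scale h (single a c) = scale c (h a)"
  by (simp add: free_ext_def)

lemma free_ext_smult: "free_ext scale h (Poly_Mapping.map ((*) c) f) = scale c (free_ext scale h f)"
  unfolding free_ext_superset[OF finite_keys keys_smult, of h] lookup_smult
  by (simp add: free_ext_def scale_sum_right)

end

abbreviation linear_ext :: "('k::comm_ring_1 \<Rightarrow> 'd::comm_ring_1) \<Rightarrow> ('m \<Rightarrow> 'd) \<Rightarrow> ('m \<Rightarrow>\<^sub>0 'k) \<Rightarrow> 'd" where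
  "linear_ext \<kappa> \<equiv> free_ext (\<lambda>c x. \<kappa> c * x)"

context
  fixes \<kappa> :: "'k::comm_ring_1 \<Rightarrow> 'd::comm_ring_1"
  assumes \<kappa>: "scalar_hom \<kappa>"
begin

lemma module_scalar_hom: "Modules.module (\<lambda>c x. \<kappa> c * x)"
  by standard (simp_all add: scalar_homD[OF \<kappa>] algebra_simps)

lemmas linear_ext_add = module.free_ext_add[OF module_scalar_hom]
lemmas linear_ext_zero = module.free_ext_zero[OF module_scalar_hom]
lemmas linear_ext_uminus = module.free_ext_uminus[OF module_scalar_hom]
lemmas linear_ext_diff = module.free_ext_diff[OF module_scalar_hom]
lemmas linear_ext_sum = module.free_ext_sum[OF module_scalar_hom]
lemmas linear_ext_single = module.free_ext_single[OF module_scalar_hom]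
lemmas linear_ext_smult = module.free_ext_smult[OF module_scalar_hom]

lemma ring_hom_on_monoid_algebra:
  assumes h: "mult_hom_on M G h"
  shows "ring_hom_on (monoid_algebra M :: ('k, _) module) {f. keys f \<subseteq> G} (linear_ext \<kappa> h)"
proof -
  let ?A = "monoid_algebra M :: ('k, _) module"
  have "keys (f \<otimes>\<^bsub>?A\<^esub> g) \<subseteq> G \<and> linear_ext \<kappa> h (f \<otimes>\<^bsub>?A\<^esub> g) = linear_ext \<kappa> h f * linear_ext \<kappa> h g"
    if fg: "keys f \<subseteq> G" "keys g \<subseteq> G" for f g
  proof
    have mem: "a \<otimes>\<^bsub>M\<^esub> b \<in> G" "h (a \<otimes>\<^bsub>M\<^esub> b) = h a * h b"
      if "a \<in> keys f" "b \<in> keys g" for a b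
      using that fg h by (auto simp: mult_hom_on_def)
    have "keys (f \<otimes>\<^bsub>?A\<^esub> g) \<subseteq> (\<Union>a\<in>keys f. \<Union>b\<in>keys g. {a \<otimes>\<^bsub>M\<^esub> b})"
      unfolding monoid_algebra_def
      by simp (intro order_trans[OF keys_sum] UN_mono order_refl, auto split: if_splits)
    then show "keys (f \<otimes>\<^bsub>?A\<^esub> g) \<subseteq> G"
      using mem by fast
    show "linear_ext \<kappa> h (f \<otimes>\<^bsub>?A\<^esub> g) = linear_ext \<kappa> h f * linear_ext \<kappa> h g"
      unfolding monoid_algebra_def
      by (simp add: linear_ext_sum linear_ext_single mem scalar_homD[OF \<kappa>])
        (simp add: free_ext_def sum_product algebra_simps)
  qed
  moreover have "keys (f + g) \<subseteq> G" if "keys f \<subseteq> G" "keys g \<subseteq> G" for f g :: "_ \<Rightarrow>\<^sub>0 'k"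
    using keys_add[of f g] that by blast
  moreover have "\<one>\<^bsub>M\<^esub> \<in> G" "h \<one>\<^bsub>M\<^esub> = 1"
    using h by (auto simp: mult_hom_on_def)
  ultimately show ?thesis
    unfolding ring_hom_on_def mult_hom_on_def
    by (auto simp: monoid_algebra_def linear_ext_add linear_ext_single scalar_homD[OF \<kappa>])
qed

text \<open>
  A homomorphism that vanishes on the relations vanishes on the subgroup that they generate.  The relations
  have to lie in the carrier, as inverses in the additive group are taken there.
\<close>

lemma generate_monoid_algebra:
  fixes M :: "('m, 'b) monoid_scheme" and K :: "('m \<Rightarrow>\<^sub>0 'k) set"
  assumes K: "K \<subseteq> carrier (monoid_algebra M)" "\<And>x. x \<in> K \<Longrightarrow> linear_ext \<kappa> h x = 0"
    and x: "x \<in> generate (add_monoid (monoid_algebra M)) K"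
  shows "keys x \<subseteq> carrier M \<and> linear_ext \<kappa> h x = 0"
  using x
proof (induction rule: generate.induct)
  case one
  then show ?case
    by (simp add: monoid_algebra_def linear_ext_zero)
next
  case (incl k)
  then show ?case
    using K by (auto simp: monoid_algebra_def)
next
  case (inv k)
  then have k: "keys k \<subseteq> carrier M"
    using K by (auto simp: monoid_algebra_def)
  have "inv\<^bsub>add_monoid (monoid_algebra M)\<^esub> k = - k"
    unfolding m_inv_def
    by (rule the_equality) (use k in \<open>auto simp: monoid_algebra_def eq_neg_iff_add_eq_0\<close>)
  then show ?case
    using k K(2)[OF inv] by (simp add: linear_ext_uminus)
next
  case (eng x y)
  then show ?case
    using keys_add[of x y] by (auto simp: monoid_algebra_def linear_ext_add)
qed

end

text \<open>The value of \<open>h\<close> on a coset is its value on any element, for the cosets on which \<open>h\<close> is constant.\<close>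

definition coset_good :: "'m set \<Rightarrow> ('m \<Rightarrow> 'd) \<Rightarrow> 'm set set" where
  "coset_good G h = {X. X \<noteq> {} \<and> X \<subseteq> G \<and> (\<forall>x\<in>X. \<forall>y\<in>X. h x = h y)}"

definition coset_val :: "('m \<Rightarrow> 'd) \<Rightarrow> 'm set \<Rightarrow> 'd" where
  "coset_val h X = h (SOME x. x \<in> X)"

lemma coset_val_eq:
  assumes "X \<in> coset_good G h" "x \<in> X"
  shows "coset_val h X = h x"
proof -
  have "(SOME x. x \<in> X) \<in> X"
    using assms(2) by (rule someI)
  then show ?thesis
    using assms unfolding coset_good_def coset_val_def by blast
qed

lemma coset_valI:
  assumes "X \<noteq> {}" "\<And>x. x \<in> X \<Longrightarrow> x \<in> G \<and> h x = c"
  shows "X \<in> coset_good G h \<and> coset_val h X = c"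
proof -
  have "X \<in> coset_good G h"
    using assms by (auto simp: coset_good_def)
  then show ?thesis
    using assms coset_val_eq by (metis equals0I)
qed

lemma coset_good_coset:
  assumes R: "ring_hom_on R G h" and I: "I \<noteq> {}" "\<And>i. i \<in> I \<Longrightarrow> i \<in> G \<and> h i = 0" and x: "x \<in> G"
  shows "I +>\<^bsub>R\<^esub> x \<in> coset_good G h \<and> coset_val h (I +>\<^bsub>R\<^esub> x) = h x"
  by (rule coset_valI) (use R I x in \<open>auto simp: a_r_coset_def' ring_hom_on_def\<close>)

lemma ring_hom_on_quotient:
  assumes R: "ring_hom_on R G h" and I: "I \<noteq> {}" "\<And>i. i \<in> I \<Longrightarrow> i \<in> G \<and> h i = 0"
  shows "ring_hom_on (R Quot I) (coset_good G h) (coset_val h)"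
proof -
  have M: "mult_hom_on R G h"
    using R by (simp add: ring_hom_on_def)
  have "A \<otimes>\<^bsub>R Quot I\<^esub> B \<in> coset_good G h \<and> coset_val h (A \<otimes>\<^bsub>R Quot I\<^esub> B) = coset_val h A * coset_val h B"
    if AB: "A \<in> coset_good G h" "B \<in> coset_good G h" for A B
  proof (rule coset_valI)
    have ne: "A \<noteq> {}" "B \<noteq> {}" "A \<subseteq> G" "B \<subseteq> G"
      using AB by (auto simp: coset_good_def)
    then show "A \<otimes>\<^bsub>R Quot I\<^esub> B \<noteq> {}"
      using I(1) by (auto simp: FactRing_def rcoset_mult_def a_r_coset_def')
    fix x assume "x \<in> A \<otimes>\<^bsub>R Quot I\<^esub> B"
    then obtain a b i where ab: "a \<in> A" "b \<in> B" "i \<in> I" "x = i \<oplus>\<^bsub>R\<^esub> (a \<otimes>\<^bsub>R\<^esub> b)"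
      by (auto simp: FactRing_def rcoset_mult_def a_r_coset_def')
    then show "x \<in> G \<and> h x = coset_val h A * coset_val h B"
      using M R I ne coset_val_eq[OF AB(1)] coset_val_eq[OF AB(2)]
      by (auto simp: ring_hom_on_def mult_hom_on_def subset_iff)
  qed
  moreover have "A \<oplus>\<^bsub>R Quot I\<^esub> B \<in> coset_good G h \<and> coset_val h (A \<oplus>\<^bsub>R Quot I\<^esub> B) = coset_val h A + coset_val h B"
    if AB: "A \<in> coset_good G h" "B \<in> coset_good G h" for A B
  proof (rule coset_valI)
    have ne: "A \<noteq> {}" "B \<noteq> {}" "A \<subseteq> G" "B \<subseteq> G"
      using AB by (auto simp: coset_good_def)
    then show "A \<oplus>\<^bsub>R Quot I\<^esub> B \<noteq> {}"
      by (auto simp: FactRing_def set_add_def')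
    fix x assume "x \<in> A \<oplus>\<^bsub>R Quot I\<^esub> B"
    then obtain a b where ab: "a \<in> A" "b \<in> B" "x = a \<oplus>\<^bsub>R\<^esub> b"
      by (auto simp: FactRing_def set_add_def')
    then show "x \<in> G \<and> h x = coset_val h A + coset_val h B"
      using R ne coset_val_eq[OF AB(1)] coset_val_eq[OF AB(2)]
      by (auto simp: ring_hom_on_def subset_iff)
  qed
  moreover have "\<one>\<^bsub>R Quot I\<^esub> \<in> coset_good G h \<and> coset_val h \<one>\<^bsub>R Quot I\<^esub> = 1"
    using coset_good_coset[OF R I, of "\<one>\<^bsub>R\<^esub>"] M by (auto simp: FactRing_def mult_hom_on_def)
  ultimately show ?thesis
    unfolding ring_hom_on_def mult_hom_on_def by blast
qed

lemma carrier_quotient_good: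
  assumes R: "ring_hom_on R G h" and I: "I \<noteq> {}" "\<And>i. i \<in> I \<Longrightarrow> i \<in> G \<and> h i = 0" and G: "carrier R \<subseteq> G"
  shows "carrier (R Quot I) \<subseteq> coset_good G h"
  using coset_good_coset[OF R I] G by (auto simp: FactRing_def A_RCOSETS_def')

text \<open>
  A finitely generated algebra maps into one step of any exhaustive increasing chain of subalgebras of
  the target.
\<close>

lemma not_finitely_generated_quotient:
  fixes MA :: "('k::comm_ring_1, 'm) module" and \<kappa> :: "'k \<Rightarrow> 'd::comm_ring_1" and D :: "nat \<Rightarrow> 'd set"
  assumes h: "ring_hom_on MA G h" and G: "carrier MA \<subseteq> G"
    and h_smult: "\<And>c x. x \<in> G \<Longrightarrow> c \<odot>\<^bsub>MA\<^esub> x \<in> G \<and> h (c \<odot>\<^bsub>MA\<^esub> x) = \<kappa> c * h x"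
    and J: "J \<noteq> {}" "\<And>i. i \<in> J \<Longrightarrow> i \<in> G \<and> h i = 0"
    and D_one: "\<And>N. 1 \<in> D N"
    and D_add: "\<And>N x y. x \<in> D N \<Longrightarrow> y \<in> D N \<Longrightarrow> x + y \<in> D N"
    and D_mult: "\<And>N x y. x \<in> D N \<Longrightarrow> y \<in> D N \<Longrightarrow> x * y \<in> D N"
    and D_smult: "\<And>N c x. x \<in> D N \<Longrightarrow> \<kappa> c * x \<in> D N"
    and D_mono: "\<And>N N'. N \<le> N' \<Longrightarrow> D N \<subseteq> D N'"
    and D_exhaust: "\<And>x. \<exists>N. x \<in> D N"
    and unbounded: "\<And>N. \<exists>x\<in>carrier MA. h x \<notin> D N"
  shows "\<not> finitely_generated_algebra (quotient_algebra MA J)"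
proof
  let ?B = "quotient_algebra MA J"
  assume "finitely_generated_algebra ?B"
  then obtain S where S: "finite S" "S \<subseteq> carrier ?B" and gen: "generated_subalgebra ?B S = carrier ?B"
    by (auto simp: finitely_generated_algebra_def)
  have carrier: "carrier ?B = carrier (MA Quot J)"
    by (simp add: quotient_algebra_def ring.defs)
  have ops: "\<one>\<^bsub>?B\<^esub> = \<one>\<^bsub>MA Quot J\<^esub>" "(\<otimes>\<^bsub>?B\<^esub>) = (\<otimes>\<^bsub>MA Quot J\<^esub>)" "(\<oplus>\<^bsub>?B\<^esub>) = (\<oplus>\<^bsub>MA Quot J\<^esub>)"
    "c \<odot>\<^bsub>?B\<^esub> X = (\<Union>x\<in>X. J +>\<^bsub>MA\<^esub> (c \<odot>\<^bsub>MA\<^esub> x))" for c X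
    by (simp_all add: quotient_algebra_def ring.defs)
  let ?h = "coset_val h" and ?G = "coset_good G h"
  have h': "ring_hom_on (MA Quot J) ?G ?h"
    by (rule ring_hom_on_quotient[OF h J])
  have SG: "S \<subseteq> ?G"
    using S(2) carrier_quotient_good[OF h J G] by (simp add: carrier)
  have "\<exists>N. \<forall>X\<in>S. ?h X \<in> D N"
    using S(1)
  proof (induction S rule: finite_induct)
    case (insert X S)
    then obtain N where N: "\<forall>X\<in>S. ?h X \<in> D N" by blast
    obtain N' where N': "?h X \<in> D N'" using D_exhaust by blast
    show ?case
      using N N' D_mono[of N "max N N'"] D_mono[of N' "max N N'"] by (intro exI[of _ "max N N'"]) auto
  qed simp
  then obtain N where N: "\<And>X. X \<in> S \<Longrightarrow> ?h X \<in> D N" by blast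
  have gen_le: "X \<in> ?G \<and> ?h X \<in> D N" if "X \<in> generated_subalgebra ?B S" for X
    using that
  proof (induction rule: generated_subalgebra.induct)
    case (incl X)
    then show ?case using SG N by blast
  next
    case one
    then show ?case
      using h' D_one by (auto simp: ops ring_hom_on_def mult_hom_on_def)
  next
    case (add X Y)
    then show ?case
      using h' D_add by (auto simp: ops ring_hom_on_def)
  next
    case (mult X Y)
    then show ?case
      using h' D_mult by (auto simp: ops ring_hom_on_def mult_hom_on_def)
  next
    case (smult X c)
    then have X: "X \<in> ?G" "?h X \<in> D N" by auto
    have "c \<odot>\<^bsub>?B\<^esub> X \<in> ?G \<and> ?h (c \<odot>\<^bsub>?B\<^esub> X) = \<kappa> c * ?h X"
    proof (rule coset_valI)
      have ne: "X \<noteq> {}" "X \<subseteq> G"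
        using X by (auto simp: coset_good_def)
      then show "c \<odot>\<^bsub>?B\<^esub> X \<noteq> {}"
        using J(1) by (auto simp: ops a_r_coset_def')
      fix y assume "y \<in> c \<odot>\<^bsub>?B\<^esub> X"
      then obtain x i where "x \<in> X" "i \<in> J" "y = i \<oplus>\<^bsub>MA\<^esub> (c \<odot>\<^bsub>MA\<^esub> x)"
        by (auto simp: ops a_r_coset_def')
      then show "y \<in> G \<and> h y = \<kappa> c * ?h X"
        using h J h_smult[of x c] ne coset_val_eq[OF X(1)] by (auto simp: ring_hom_on_def subset_iff)
    qed
    then show ?case
      using D_smult X by simp
  qed
  obtain x where x: "x \<in> carrier MA" "h x \<notin> D N"
    using unbounded by blast
  have "J +>\<^bsub>MA\<^esub> x \<in> carrier ?B"
    unfolding carrier using x(1) by (auto simp: FactRing_def A_RCOSETS_def')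
  then show False
    using gen_le[of "J +>\<^bsub>MA\<^esub> x"] coset_good_coset[OF h J, of x] x G gen by auto
qed

section \<open>A square-zero extension of the complex numbers\<close>

text \<open>
  The ring \<open>\<complex> \<oplus> \<complex>[s]\<close>, in which the product of two elements of \<open>\<complex>[s]\<close> is zero.  A homomorphism into it is a
  character together with infinitely many derivations at this character, one for each power of \<open>s\<close>.
\<close>

datatype sqz = Sqz (scalar_part: complex) (nil_part: "complex poly")

instantiation sqz :: comm_ring_1
begin

definition "0 = Sqz 0 0"
definition "1 = Sqz 1 0"
definition "x + y = Sqz (scalar_part x + scalar_part y) (nil_part x + nil_part y)"
definition "x - y = Sqz (scalar_part x - scalar_part y) (nil_part x - nil_part y)"
definition "- x = Sqz (- scalar_part x) (- nil_part x)"
definition "x * y = Sqz (scalar_part x * scalar_part y)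
  (Polynomial.smult (scalar_part x) (nil_part y) + Polynomial.smult (scalar_part y) (nil_part x))"

instance
  by standard
    (auto simp: zero_sqz_def one_sqz_def plus_sqz_def minus_sqz_def uminus_sqz_def times_sqz_def
      algebra_simps smult_add_right smult_add_left)

end

lemma scalar_hom_Sqz: "scalar_hom (\<lambda>c. Sqz c 0)"
  by (auto simp: scalar_hom_def zero_sqz_def one_sqz_def plus_sqz_def times_sqz_def)

lemma scalar_hom_of_int: "scalar_hom (of_int :: int \<Rightarrow> 'd::comm_ring_1)"
  by (auto simp: scalar_hom_def)

definition sqz_degree_le :: "nat \<Rightarrow> sqz set" where
  "sqz_degree_le N = {x. degree (nil_part x) \<le> N}"

lemma sqz_degree_le_closed:
  "1 \<in> sqz_degree_le N"
  "x \<in> sqz_degree_le N \<Longrightarrow> y \<in> sqz_degree_le N \<Longrightarrow> x + y \<in> sqz_degree_le N"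
  "x \<in> sqz_degree_le N \<Longrightarrow> y \<in> sqz_degree_le N \<Longrightarrow> x * y \<in> sqz_degree_le N"
  "x \<in> sqz_degree_le N \<Longrightarrow> Sqz c 0 * x \<in> sqz_degree_le N"
  "N \<le> N' \<Longrightarrow> sqz_degree_le N \<subseteq> sqz_degree_le N'"
  "\<exists>N. x \<in> sqz_degree_le N"
  by (auto simp: sqz_degree_le_def one_sqz_def plus_sqz_def times_sqz_def
      intro!: degree_add_le order_trans[OF degree_smult_le])

context twisted_dual
begin

section \<open>Evaluating characters at solutions of d'Alembert's equation\<close>

lemma alg_induct [consumes 1, case_names zero step]:
  assumes "x \<in> alg" "P 0"
    and "\<And>c g k y. y \<in> alg \<Longrightarrow> P y \<Longrightarrow> P (op_scale c (basis_op g k) + y)"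
  shows "P x"
proof -
  have "x \<in> alg \<and> P x"
    using assms(1) unfolding alg_def
  proof (induction rule: ops.span_induct_alt)
    case base
    show ?case
      using assms(2) ops.span_zero by (intro conjI)
  next
    case (step c x y)
    then obtain g k where x: "x = basis_op g k"
      by (auto simp: gens_def)
    have "op_scale c x + y \<in> ops.span gens"
      using step.IH ops.span_base[OF step.hyps] by (simp add: ops.span_add ops.span_scale)
    moreover have "P (op_scale c x + y)"
      unfolding x using step assms(3) by (auto simp: alg_def)
    ultimately show ?case
      by (rule conjI)
  qed
  then show ?thesis ..
qed

lemma alg_closed:
  "0 \<in> alg" "x \<in> alg \<Longrightarrow> y \<in> alg \<Longrightarrow> x + y \<in> alg" "x \<in> alg \<Longrightarrow> op_scale c x \<in> alg"
  "(\<And>j. j \<in> F \<Longrightarrow> f j \<in> alg) \<Longrightarrow> sum f F \<in> alg"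
  unfolding alg_def by (auto intro: ops.span_zero ops.span_add ops.span_scale ops.span_sum)

lemma alg_comp:
  assumes x: "x \<in> alg" and y: "y \<in> alg"
  shows "x \<circ> y \<in> alg"
  using x
proof (induction x rule: alg_induct)
  case zero
  have "(0 :: 'i op) \<circ> y = 0" by (simp add: fun_eq_iff)
  then show ?case by (simp only: alg_closed)
next
  case (step c g k z)
  have "basis_op g k \<circ> y \<in> alg"
    using y
  proof (induction y rule: alg_induct)
    case zero
    have "basis_op g k \<circ> (0 :: 'i op) = 0"
      using op_zero(1)[OF basis_op_bounded] by (simp only: fun_eq_iff o_apply zero_fun_apply) simp
    then show ?case by (simp only: alg_closed)
  next
    case (step c h m w)
    have "basis_op g k \<circ> (op_scale c (basis_op h m) + w) =
        op_scale c (basis_op g k \<circ> basis_op h m) + (basis_op g k \<circ> w)"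
      using step alg_bounded by (simp add: comp_add_right comp_scale_right bounded_ops_closed(4) subset_iff)
    moreover have "op_scale c (basis_op g k \<circ> basis_op h m) \<in> alg"
      by (cases "k = m") (simp_all add: basis_op_comp alg_closed(3) alg_closed(1))
    ultimately show ?case
      using step.IH by (simp only: alg_closed(2))
  qed
  then show ?case
    using step by (simp only: comp_add_left comp_scale_left alg_closed)
qed

definition \<sigma>_invariant :: "'i op \<Rightarrow> bool" where
  "\<sigma>_invariant x \<longleftrightarrow> x \<in> alg \<and> (\<forall>g. fourier x (\<sigma> g) False = fourier x g False)"

text \<open>The linear extension of \<open>E\<close>, composed with the projection to the copy \<open>k = 0\<close> of the group algebra.\<close>

definition lin :: "(complex \<Rightarrow> 'd::comm_ring_1) \<Rightarrow> ('g \<Rightarrow> 'd) \<Rightarrow> 'i op \<Rightarrow> 'd" where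
  "lin \<kappa> E x = (\<Sum>g\<in>{g. fourier x g False \<noteq> 0}. \<kappa> (fourier x g False) * E g)"

context
  fixes \<kappa> :: "complex \<Rightarrow> 'd::comm_ring_1"
  assumes \<kappa>: "scalar_hom \<kappa>"
begin

lemma lin_superset:
  assumes "finite S" "{g. fourier x g False \<noteq> 0} \<subseteq> S"
  shows "lin \<kappa> E x = (\<Sum>g\<in>S. \<kappa> (fourier x g False) * E g)"
  unfolding lin_def using assms
  by (intro sum.mono_neutral_left) (auto simp: scalar_homD[OF \<kappa>])

lemma lin_zero: "lin \<kappa> E 0 = 0"
  by (simp add: lin_def fourier_zero)

lemma lin_add:
  assumes "x \<in> alg" "y \<in> alg"
  shows "lin \<kappa> E (x + y) = lin \<kappa> E x + lin \<kappa> E y"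
proof -
  let ?S = "{g. fourier x g False \<noteq> 0} \<union> {g. fourier y g False \<noteq> 0}"
  have S: "finite ?S"
    using assms alg_finite_support by blast
  have sub: "{g. fourier (x + y) g False \<noteq> 0} \<subseteq> ?S"
    by (auto simp: fourier_add)
  show ?thesis
    unfolding lin_superset[OF S Un_upper1, of E] lin_superset[OF S Un_upper2, of E] lin_superset[OF S sub]
    by (simp add: fourier_add scalar_homD[OF \<kappa>] distrib_right sum.distrib)
qed

lemma lin_scale:
  assumes "x \<in> alg"
  shows "lin \<kappa> E (op_scale c x) = \<kappa> c * lin \<kappa> E x"
proof -
  have "lin \<kappa> E (op_scale c x) = (\<Sum>g\<in>{g. fourier x g False \<noteq> 0}. \<kappa> (fourier (op_scale c x) g False) * E g)"
    by (rule lin_superset) (use alg_finite_support[OF assms] in \<open>auto simp: fourier_scale\<close>)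
  then show ?thesis
    by (simp add: fourier_scale scalar_homD[OF \<kappa>] lin_def sum_distrib_left mult.assoc)
qed

lemma lin_basis_op: "lin \<kappa> E (basis_op g k) = (if k then 0 else E g)"
proof -
  have "lin \<kappa> E (basis_op g k) = (\<Sum>h\<in>{g}. \<kappa> (fourier (basis_op g k) h False) * E h)"
    by (rule lin_superset) (auto simp: fourier_basis_op)
  then show ?thesis
    by (simp add: fourier_basis_op scalar_homD[OF \<kappa>])
qed

lemma lin_step:
  assumes "y \<in> alg"
  shows "lin \<kappa> E (op_scale c (basis_op g k) + y) = (if k then 0 else \<kappa> c * E g) + lin \<kappa> E y"
  using assms by (simp add: lin_add lin_scale lin_basis_op alg_closed basis_op_alg)

lemma lin_fun_add: "lin \<kappa> (\<lambda>g. E g + E' g) x = lin \<kappa> E x + lin \<kappa> E' x"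
  by (simp add: lin_def distrib_left sum.distrib)

lemma lin_fun_mult: "lin \<kappa> (\<lambda>g. d * E g) x = d * lin \<kappa> E x"
  by (simp add: lin_def sum_distrib_left mult.left_commute)

lemma lin_fun_mult_right: "lin \<kappa> (\<lambda>g. E g * d) x = lin \<kappa> E x * d"
  by (simp add: lin_def sum_distrib_right mult.assoc)

text \<open>The nested extensions express \<open>\<Sum>g h. x\<^sub>g y\<^sub>h E (g + h)\<close> without an explicit double sum.\<close>

lemma lin_comp:
  assumes x: "x \<in> alg" and y: "y \<in> alg"
  shows "lin \<kappa> E (x \<circ> y) = lin \<kappa> (\<lambda>g. lin \<kappa> (\<lambda>h. E (g + h)) y) x"
  using x
proof (induction x rule: alg_induct)
  case zero
  have "(0 :: 'i op) \<circ> y = 0" by (simp add: fun_eq_iff)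
  then show ?case by (simp only: lin_zero)
next
  case (step c g k z)
  have basis: "lin \<kappa> E (basis_op g k \<circ> y) = (if k then 0 else lin \<kappa> (\<lambda>h. E (g + h)) y)"
    using y
  proof (induction y rule: alg_induct)
    case zero
    have "basis_op g k \<circ> (0 :: 'i op) = 0"
      using op_zero(1)[OF basis_op_bounded] by (simp only: fun_eq_iff o_apply zero_fun_apply) simp
    then show ?case by (simp only: lin_zero if_cancel)
  next
    case (step c h m w)
    have eq: "basis_op g k \<circ> (op_scale c (basis_op h m) + w) =
        op_scale c (basis_op g k \<circ> basis_op h m) + (basis_op g k \<circ> w)"
      using step alg_bounded by (simp add: comp_add_right comp_scale_right bounded_ops_closed(4) subset_iff)
    have "lin \<kappa> E (op_scale c (basis_op g k \<circ> basis_op h m) + (basis_op g k \<circ> w)) =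
        \<kappa> c * lin \<kappa> E (basis_op g k \<circ> basis_op h m) + lin \<kappa> E (basis_op g k \<circ> w)"
      using step by (simp only: lin_add lin_scale alg_closed alg_comp basis_op_alg)
    also have "\<dots> = (if k then 0 else lin \<kappa> (\<lambda>h. E (g + h)) (op_scale c (basis_op h m) + w))"
      unfolding step.IH lin_step[OF step.hyps] basis_op_comp
      by (cases k; cases m) (simp_all only: lin_basis_op lin_zero if_True if_False simp_thms mult_zero_right add_0)
    finally show ?case
      unfolding eq .
  qed
  have "lin \<kappa> E ((op_scale c (basis_op g k) + z) \<circ> y) = lin \<kappa> E (op_scale c (basis_op g k \<circ> y) + (z \<circ> y))"
    by (simp only: comp_add_left comp_scale_left)
  also have "\<dots> = \<kappa> c * lin \<kappa> E (basis_op g k \<circ> y) + lin \<kappa> E (z \<circ> y)"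
    using step y by (simp only: lin_add lin_scale alg_closed alg_comp basis_op_alg)
  also have "\<dots> = lin \<kappa> (\<lambda>g. lin \<kappa> (\<lambda>h. E (g + h)) y) (op_scale c (basis_op g k) + z)"
    unfolding step.IH basis lin_step[OF step.hyps] by simp
  finally show ?case .
qed

lemma lin_\<sigma>_invariant:
  assumes "\<sigma>_invariant x"
  shows "lin \<kappa> (\<lambda>g. E (\<sigma> g)) x = lin \<kappa> E x"
  unfolding lin_def
  by (rule sum.reindex_bij_witness[where i = \<sigma> and j = \<sigma>]) (use assms in \<open>auto simp: \<sigma>_invariant_def\<close>)

text \<open>
  If \<open>E\<close> satisfies \<open>E (g + h) + E (g + \<sigma> h) = 2 E g E h\<close>, then on invariant elements the linear extension
  of \<open>E\<close> is multiplicative, because there \<open>E (g + h)\<close> may be replaced by its average over \<open>h\<close> and \<open>\<sigma> h\<close>.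
\<close>

lemma lin_comp_invariant:
  assumes x: "x \<in> alg" and y: "\<sigma>_invariant y"
    and dAlembert: "\<And>g h. E (g + h) + E (g + \<sigma> h) = 2 * E g * E h"
  shows "lin \<kappa> E (x \<circ> y) = lin \<kappa> E x * lin \<kappa> E y"
proof -
  have y': "y \<in> alg"
    using y by (simp add: \<sigma>_invariant_def)
  have half: "\<kappa> (1 / 2) * (a + a) = a" for a
  proof -
    have "\<kappa> (1 / 2) * (a + a) = (\<kappa> (1 / 2) + \<kappa> (1 / 2)) * a"
      by (simp add: algebra_simps)
    also have "\<dots> = \<kappa> (1 / 2 + 1 / 2) * a"
      by (simp only: scalar_homD(3)[OF \<kappa>])
    finally show ?thesis
      by (simp add: scalar_homD(2)[OF \<kappa>])
  qed
  have inner: "lin \<kappa> (\<lambda>h. E (g + h)) y = E g * lin \<kappa> E y" for g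
  proof -
    have "lin \<kappa> (\<lambda>h. E (g + h)) y + lin \<kappa> (\<lambda>h. E (g + h)) y =
        lin \<kappa> (\<lambda>h. E (g + h)) y + lin \<kappa> (\<lambda>h. E (g + \<sigma> h)) y"
      using lin_\<sigma>_invariant[OF y, of "\<lambda>h. E (g + h)"] by simp
    also have "\<dots> = lin \<kappa> (\<lambda>h. (2 * E g) * E h) y"
      by (simp add: dAlembert flip: lin_fun_add)
    also have "\<dots> = E g * lin \<kappa> E y + E g * lin \<kappa> E y"
      by (simp only: lin_fun_mult) (simp add: algebra_simps)
    finally show ?thesis
      using half by metis
  qed
  show ?thesis
    unfolding lin_comp[OF x y'] inner by (rule lin_fun_mult_right)
qed

end

text \<open>Invariance can be tested with functions \<open>E\<close>, and for these the invariance of a product is read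
  off from \<open>\<sigma> g + \<sigma> h = \<sigma> (g + h)\<close>.\<close>

lemma \<sigma>_invariant_comp:
  assumes x: "\<sigma>_invariant x" and y: "\<sigma>_invariant y"
  shows "\<sigma>_invariant (x \<circ> y)"
proof -
  have id: "scalar_hom (\<lambda>c :: complex. c)"
    by (simp add: scalar_hom_def)
  have xy: "x \<in> alg" "y \<in> alg"
    using x y by (auto simp: \<sigma>_invariant_def)
  have indicator: "lin (\<lambda>c. c) (\<lambda>h. if h = g then 1 else 0) z = fourier z g False" if "z \<in> alg" for z g
  proof -
    have "lin (\<lambda>c. c) (\<lambda>h. if h = g then 1 else 0) z =
        (\<Sum>h\<in>insert g {g. fourier z g False \<noteq> 0}. fourier z h False * (if h = g then 1 else 0))"
      by (rule lin_superset[OF id]) (use alg_finite_support[OF that] in auto)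
    also have "\<dots> = (\<Sum>h\<in>insert g {g. fourier z g False \<noteq> 0}. if h = g then fourier z g False else 0)"
      by (rule sum.cong) auto
    finally show ?thesis
      using alg_finite_support[OF that, of False] by simp
  qed
  have inv: "lin (\<lambda>c. c) (\<lambda>h. E (\<sigma> h)) (x \<circ> y) = lin (\<lambda>c. c) E (x \<circ> y)" for E
  proof -
    have "lin (\<lambda>c. c) (\<lambda>h. E (\<sigma> h)) (x \<circ> y) =
        lin (\<lambda>c. c) (\<lambda>g. lin (\<lambda>c. c) (\<lambda>h. E (\<sigma> g + \<sigma> h)) y) x"
      by (simp add: lin_comp[OF id xy] \<sigma>_add)
    also have "\<dots> = lin (\<lambda>c. c) (\<lambda>g. lin (\<lambda>c. c) (\<lambda>h. E (\<sigma> g + h)) y) x"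
      using lin_\<sigma>_invariant[OF id y] by (intro arg_cong[where f = "\<lambda>F. lin _ F x"] ext) (rule lin_\<sigma>_invariant[OF id y])
    also have "\<dots> = lin (\<lambda>c. c) (\<lambda>g. lin (\<lambda>c. c) (\<lambda>h. E (g + h)) y) x"
      by (rule lin_\<sigma>_invariant[OF id x, of "\<lambda>g. lin (\<lambda>c. c) (\<lambda>h. E (g + h)) y"])
    finally show ?thesis
      by (simp add: lin_comp[OF id xy])
  qed
  have "fourier (x \<circ> y) (\<sigma> g) False = fourier (x \<circ> y) g False" for g
  proof -
    have "fourier (x \<circ> y) (\<sigma> g) False = lin (\<lambda>c. c) (\<lambda>h. if h = \<sigma> g then 1 else 0) (x \<circ> y)"
      by (rule indicator[OF alg_comp[OF xy], symmetric])
    also have "(\<lambda>h. if h = \<sigma> g then 1 else 0) = (\<lambda>h. if \<sigma> h = g then 1 else (0::complex))"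
      by (intro ext) (metis \<sigma>_\<sigma>)
    also have "lin (\<lambda>c. c) \<dots> (x \<circ> y) = lin (\<lambda>c. c) (\<lambda>h. if h = g then 1 else 0) (x \<circ> y)"
      by (rule inv)
    also have "\<dots> = fourier (x \<circ> y) g False"
      by (rule indicator[OF alg_comp[OF xy]])
    finally show ?thesis .
  qed
  then show ?thesis
    using alg_comp[OF xy] by (simp add: \<sigma>_invariant_def)
qed

text \<open>
  This property of representations is what the evaluation of characters uses.  It passes to tensor products
  without the construction of an inverse of the tensor product.
\<close>

definition good_rep :: "'i op mat \<Rightarrow> bool" where
  "good_rep u \<longleftrightarrow> (\<forall>i<dim_row u. \<forall>j<dim_row u. u $$ (i, j) \<in> alg) \<and> \<sigma>_invariant (character u)"

text \<open>
  The character is invariant: with \<open>s\<close> the nontrivial element of the group of order two,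
  \<open>U\<^sub>g\<^sub>,\<^sub>0\<close> and \<open>U\<^bsub>\<sigma> g,0\<^esub>\<close> are the products of \<open>U\<^sub>g\<^sub>,\<^sub>s\<close> and \<open>U\<^bsub>\<sigma> g,s\<^esub>\<close> in the two orders.
\<close>

lemma fd_rep_good:
  assumes u: "fd_rep cstar_alg comult u"
  shows "good_rep u"
proof -
  have "fourier (character u) g False =
      (\<Sum>i<dim_row u. \<Sum>k<dim_row u. fourier (u $$ (i, k)) g True * fourier (u $$ (k, i)) (\<sigma> g) True)" for g
  proof -
    have "fourier (u $$ (i, i)) g False =
        (\<Sum>k<dim_row u. fourier (u $$ (i, k)) g True * fourier (u $$ (k, i)) (\<sigma> g) True)" if "i < dim_row u" for i
      using rep_fourier_mult[OF u that that, of g True "\<sigma> g" True] by (simp add: act_def)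
    then show ?thesis
      by (simp add: character_def fourier_sum)
  qed
  then have "fourier (character u) (\<sigma> g) False = fourier (character u) g False" for g
    by (simp add: mult.commute) (rule sum.swap)
  moreover have "character u \<in> alg"
    unfolding character_def using rep_entries_alg[OF u] by (intro alg_closed) auto
  ultimately show ?thesis
    using rep_entries_alg[OF u] by (simp add: good_rep_def \<sigma>_invariant_def)
qed

lemma good_rep_tensor:
  assumes "good_rep u" "good_rep v"
  shows "good_rep (rep_tensor u v)" and "character (rep_tensor u v) = character u \<circ> character v"
proof -
  have ch: "character (rep_tensor u v) = character u \<circ> character v"
    by (rule character_rep_tensor) (use assms alg_bounded in \<open>auto simp: good_rep_def\<close>)
  then show "character (rep_tensor u v) = character u \<circ> character v" .
  have "rep_tensor u v $$ (p, q) \<in> alg" if "p < dim_row u * dim_row v" "q < dim_row u * dim_row v" for p q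
  proof -
    have "0 < dim_row v"
      using that by (cases "dim_row v = 0") auto
    then have "p div dim_row v < dim_row u" "q div dim_row v < dim_row u" "p mod dim_row v < dim_row v" "q mod dim_row v < dim_row v"
      using that by (simp_all add: less_mult_imp_div_less)
    then show ?thesis
      using that assms alg_comp by (simp add: rep_tensor_def Let_def good_rep_def)
  qed
  moreover have "dim_row (rep_tensor u v) = dim_row u * dim_row v"
    by (simp add: rep_tensor_def Let_def)
  ultimately show "good_rep (rep_tensor u v)"
    using assms \<sigma>_invariant_comp unfolding good_rep_def ch by auto
qed

lemma opmat_one_good: "good_rep (opmat_one 1)" and character_opmat_one: "character (opmat_one 1) = id_op"
proof -
  show ch: "character (opmat_one 1) = id_op"
    by (simp add: character_def opmat_one_def)
  have "\<sigma> g = 0 \<longleftrightarrow> g = 0" for g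
    by (metis \<sigma>_\<sigma> \<sigma>_zero)
  then have "\<sigma>_invariant id_op"
    using id_op_alg by (auto simp: \<sigma>_invariant_def id_op_basis fourier_add fourier_basis_op)
  then show "good_rep (opmat_one 1)"
    unfolding good_rep_def ch using id_op_alg by (simp add: opmat_one_def)
qed

lemma mult_hom_on_rep_monoid:
  assumes \<kappa>: "scalar_hom \<kappa>" and E0: "E 0 = 1"
    and dAlembert: "\<And>g h. E (g + h) + E (g + \<sigma> h) = 2 * E g * E h"
  shows "mult_hom_on (rep_monoid cstar_alg comult) {u. good_rep u} (\<lambda>u. lin \<kappa> E (character u))"
proof -
  have "lin \<kappa> E id_op = 1"
    unfolding id_op_basis using E0 by (simp add: lin_add[OF \<kappa>] lin_basis_op[OF \<kappa>] basis_op_alg)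
  moreover have "lin \<kappa> E (character (rep_tensor u v)) = lin \<kappa> E (character u) * lin \<kappa> E (character v)"
    if "good_rep u" "good_rep v" for u v
    unfolding good_rep_tensor(2)[OF that] using that
    by (intro lin_comp_invariant[OF \<kappa> _ _ dAlembert]) (auto simp: good_rep_def \<sigma>_invariant_def)
  ultimately show ?thesis
    unfolding mult_hom_on_def rep_monoid_def
    by (auto simp: opmat_one_good[simplified] character_opmat_one[simplified] good_rep_tensor(1))
qed

theorem fusion_algebra_not_finitely_generated:
  fixes E :: "'g \<Rightarrow> sqz"
  assumes E0: "E 0 = 1"
    and dAlembert: "\<And>g h. E (g + h) + E (g + \<sigma> h) = 2 * E g * E h"
    and unbounded: "\<And>N. \<exists>g. N < degree (nil_part (E g))"
  shows "\<not> finitely_generated_algebra (complexification (fusion_ring cstar_alg comult))"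
proof -
  (* The homomorphism is carried through the four stages of the construction: M and h0 are the monoid of
     representations and the evaluation of characters, MA and h1 its integral monoid algebra, R and h2 the
     fusion ring, C and h3 the monoid algebra of the fusion ring, of which the complexification is a
     quotient. *)
  let ?\<kappa> = "\<lambda>c. Sqz c 0"
  let ?M = "rep_monoid cstar_alg comult"
  let ?MA = "monoid_algebra ?M :: (int, _) module"
  let ?h0 = "\<lambda>u. lin ?\<kappa> E (character u)" and ?G0 = "{u. good_rep u}"
  let ?h1 = "linear_ext of_int ?h0 :: _ \<Rightarrow> sqz" and ?G1 = "{f :: _ \<Rightarrow>\<^sub>0 int. keys f \<subseteq> ?G0}"
  define K where "K = {single u (1::int) - single u' 1 - single u'' 1
         | u' u u''. fd_rep cstar_alg comult u' \<and> fd_rep cstar_alg comult u \<and> fd_rep cstar_alg comult u'' \<and> short_exact u' u u''}"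
  define I where "I = generate (add_monoid ?MA) K"
  have R_eq: "fusion_ring cstar_alg comult = ?MA Quot I"
    by (simp add: fusion_ring_def I_def K_def)
  note \<kappa> = scalar_hom_Sqz
  note int = scalar_hom_of_int[where ?'d = sqz]
  have h0: "mult_hom_on ?M ?G0 ?h0"
    by (rule mult_hom_on_rep_monoid[OF \<kappa> E0 dAlembert])
  have carrier_M: "carrier ?M \<subseteq> ?G0"
    by (auto simp: rep_monoid_def intro: fd_rep_good)
  have h1: "ring_hom_on ?MA ?G1 ?h1"
    by (rule ring_hom_on_monoid_algebra[OF int h0])
  have carrier_MA: "carrier ?MA \<subseteq> ?G1"
    using carrier_M by (auto simp: monoid_algebra_def)
  have K_carrier: "K \<subseteq> carrier ?MA"
  proof
    fix x assume "x \<in> K"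
    then obtain u u' u'' where x: "x = single u 1 - single u' 1 - single u'' 1"
      and u: "fd_rep cstar_alg comult u'" "fd_rep cstar_alg comult u" "fd_rep cstar_alg comult u''"
      unfolding K_def by blast
    have "keys x \<subseteq> {u, u', u''}"
      unfolding x using keys_diff[of "single u (1::int) - single u' 1" "single u'' 1"]
        keys_diff[of "single u (1::int)" "single u' 1"] by auto
    then show "x \<in> carrier ?MA"
      using u by (auto simp: monoid_algebra_def rep_monoid_def)
  qed
  have K_zero: "?h1 x = 0" if x: "x \<in> K" for x
  proof -
    obtain u u' u'' where x: "x = single u 1 - single u' 1 - single u'' 1"
      and u: "fd_rep cstar_alg comult u'" "fd_rep cstar_alg comult u''" and ex: "short_exact u' u u''"
      using x unfolding K_def by blast
    have "character u' \<in> alg" "character u'' \<in> alg"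
      using u[THEN fd_rep_good] by (auto simp: good_rep_def \<sigma>_invariant_def)
    then show ?thesis
      unfolding x by (simp add: linear_ext_diff[OF int] linear_ext_single[OF int] character_short_exact[OF ex] lin_add[OF \<kappa>])
  qed
  have I_carrier: "keys i \<subseteq> carrier ?M" and I_zero: "?h1 i = 0" if "i \<in> I" for i
    using generate_monoid_algebra[OF int K_carrier K_zero that[unfolded I_def]] by auto
  have I: "I \<noteq> {}" "\<And>i. i \<in> I \<Longrightarrow> i \<in> ?G1 \<and> ?h1 i = 0"
    using generate.one[of "add_monoid ?MA" K] I_carrier I_zero carrier_M unfolding I_def by blast+
  let ?R = "?MA Quot I"
  let ?h2 = "coset_val ?h1" and ?G2 = "coset_good ?G1 ?h1"
  have h2: "ring_hom_on ?R ?G2 ?h2"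
    by (rule ring_hom_on_quotient[OF h1 I])
  have carrier_R: "carrier ?R \<subseteq> ?G2"
    by (rule carrier_quotient_good[OF h1 I carrier_MA])
  have add_R: "x \<oplus>\<^bsub>?R\<^esub> y \<in> carrier ?R" if xy: "x \<in> carrier ?R" "y \<in> carrier ?R" for x y
  proof -
    obtain f g where f: "f \<in> carrier ?MA" "x = I +>\<^bsub>?MA\<^esub> f" and g: "g \<in> carrier ?MA" "y = I +>\<^bsub>?MA\<^esub> g"
      using xy by (auto simp: FactRing_def A_RCOSETS_def')
    have plus: "f \<oplus>\<^bsub>?MA\<^esub> g = f + g" for f g
      by (simp add: monoid_algebra_def)
    have zero: "0 \<in> I"
      using generate.one[of "add_monoid ?MA" K] by (simp add: I_def monoid_algebra_def)
    have closed: "i + j \<in> I" if "i \<in> I" "j \<in> I" for i j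
      using generate.eng[of i "add_monoid ?MA" K j] that by (simp add: I_def monoid_algebra_def)
    have "x \<oplus>\<^bsub>?R\<^esub> y = I +>\<^bsub>?MA\<^esub> (f + g)"
    proof (intro equalityI subsetI)
      fix z assume "z \<in> x \<oplus>\<^bsub>?R\<^esub> y"
      then obtain i j where "i \<in> I" "j \<in> I" "z = (i + f) + (j + g)"
        by (auto simp: f g FactRing_def set_add_def' a_r_coset_def' plus)
      then show "z \<in> I +>\<^bsub>?MA\<^esub> (f + g)"
        using closed[of i j] by (auto simp: a_r_coset_def' plus intro!: bexI[of _ "i + j"] simp: algebra_simps)
    next
      fix z assume "z \<in> I +>\<^bsub>?MA\<^esub> (f + g)"
      then obtain i where "i \<in> I" "z = (i + f) + (0 + g)"
        by (auto simp: a_r_coset_def' plus algebra_simps)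
      moreover have "z \<in> x \<oplus>\<^bsub>?R\<^esub> y \<longleftrightarrow> (\<exists>i\<in>I. \<exists>j\<in>I. z = (i + f) + (j + g))"
        by (auto simp: f g FactRing_def set_add_def' a_r_coset_def' plus)
      ultimately show "z \<in> x \<oplus>\<^bsub>?R\<^esub> y"
        using zero by blast
    qed
    moreover have "f + g \<in> carrier ?MA"
      using f(1) g(1) keys_add[of f g] by (auto simp: monoid_algebra_def)
    ultimately show ?thesis
      by (auto simp: FactRing_def A_RCOSETS_def')
  qed
  let ?C = "monoid_algebra ?R :: (complex, _) module"
  let ?h3 = "linear_ext ?\<kappa> ?h2" and ?G3 = "{f :: _ \<Rightarrow>\<^sub>0 complex. keys f \<subseteq> ?G2}"
  define L where "L = {single (x \<oplus>\<^bsub>?R\<^esub> y) c - single x c - single y c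
         | x y (c::complex). x \<in> carrier ?R \<and> y \<in> carrier ?R}"
  define J where "J = generate (add_monoid ?C) L"
  have h3: "ring_hom_on ?C ?G3 ?h3"
    by (rule ring_hom_on_monoid_algebra[OF \<kappa>]) (use h2 in \<open>simp add: ring_hom_on_def\<close>)
  have L_carrier: "L \<subseteq> carrier ?C"
  proof
    fix z assume "z \<in> L"
    then obtain x y c where z: "z = single (x \<oplus>\<^bsub>?R\<^esub> y) c - single x c - single y c"
      and xy: "x \<in> carrier ?R" "y \<in> carrier ?R"
      unfolding L_def by blast
    have "keys z \<subseteq> {x \<oplus>\<^bsub>?R\<^esub> y, x, y}"
      unfolding z using keys_diff[of "single (x \<oplus>\<^bsub>?R\<^esub> y) c - single x c" "single y c"]
        keys_diff[of "single (x \<oplus>\<^bsub>?R\<^esub> y) c" "single x c"] by (auto split: if_splits)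
    then show "z \<in> carrier ?C"
      using xy add_R[OF xy] by (auto simp: monoid_algebra_def)
  qed
  have L_zero: "?h3 z = 0" if z: "z \<in> L" for z
  proof -
    obtain x y c where z: "z = single (x \<oplus>\<^bsub>?R\<^esub> y) c - single x c - single y c"
      and xy: "x \<in> carrier ?R" "y \<in> carrier ?R"
      using z unfolding L_def by blast
    have "?h2 (x \<oplus>\<^bsub>?R\<^esub> y) = ?h2 x + ?h2 y"
      using h2 carrier_R xy unfolding ring_hom_on_def by blast
    then show ?thesis
      unfolding z by (simp add: linear_ext_diff[OF \<kappa>] linear_ext_single[OF \<kappa>] distrib_left)
  qed
  have J_both: "keys i \<subseteq> carrier ?R \<and> ?h3 i = 0" if "i \<in> J" for i
    using generate_monoid_algebra[OF \<kappa> L_carrier L_zero that[unfolded J_def]] .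
  have J: "J \<noteq> {}" "\<And>i. i \<in> J \<Longrightarrow> i \<in> ?G3 \<and> ?h3 i = 0"
    using generate.one[of "add_monoid ?C" L] J_both carrier_R unfolding J_def by blast+
  have C_eq: "complexification (fusion_ring cstar_alg comult) = quotient_algebra ?C J"
    unfolding complexification_def R_eq J_def L_def ..
  show ?thesis
    unfolding C_eq
  proof (rule not_finitely_generated_quotient[where \<kappa> = ?\<kappa> and D = sqz_degree_le, OF h3 _ _ J])
    show "carrier ?C \<subseteq> ?G3"
      using carrier_R by (auto simp: monoid_algebra_def)
    show "c \<odot>\<^bsub>?C\<^esub> x \<in> ?G3 \<and> ?h3 (c \<odot>\<^bsub>?C\<^esub> x) = Sqz c 0 * ?h3 x" if "x \<in> ?G3" for c x
      using that keys_smult[of c x] by (auto simp: monoid_algebra_def linear_ext_smult[OF \<kappa>])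
    show "\<exists>x\<in>carrier ?C. ?h3 x \<notin> sqz_degree_le N" for N
    proof -
      (* the class of the orbit representation of g is sent to E g + E (\<sigma> g) = 2 E g *)
      obtain g where g: "N < degree (nil_part (E g))"
        using unbounded by blast
      let ?f = "single (orbit_rep g) (1::int)"
      let ?X = "I +>\<^bsub>?MA\<^esub> ?f"
      have f: "?f \<in> carrier ?MA"
        using orbit_rep_fd by (simp add: monoid_algebra_def rep_monoid_def)
      have X: "?X \<in> carrier ?R"
        using f by (auto simp: FactRing_def A_RCOSETS_def')
      have "character (orbit_rep g) = basis_op g False + basis_op (\<sigma> g) False"
        by (simp add: character_def orbit_rep_def lessThan_2 act_def)
      moreover have "E g + E (\<sigma> g) = E g + E g"
        using dAlembert[of 0 g] E0 by simp
      ultimately have "?h0 (orbit_rep g) = E g + E g"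
        by (simp add: lin_add[OF \<kappa>] lin_basis_op[OF \<kappa>] basis_op_alg)
      moreover have "?h2 ?X = ?h1 ?f"
        using coset_good_coset[OF h1 I, of ?f] f carrier_MA by blast
      ultimately have "?h3 (single ?X 1) = E g + E g"
        by (simp add: linear_ext_single[OF \<kappa>] linear_ext_single[OF int] scalar_homD(2)[OF \<kappa>])
      moreover have "nil_part (E g + E g) = Polynomial.smult (1 + 1) (nil_part (E g))"
        by (simp only: plus_sqz_def sqz.sel smult_add_left smult_1_left)
      ultimately have "?h3 (single ?X 1) \<notin> sqz_degree_le N"
        using g by (simp add: sqz_degree_le_def)
      then show ?thesis
        using X by (intro bexI[of _ "single ?X 1"]) (auto simp: monoid_algebra_def)
    qed
  qed (use sqz_degree_le_closed in auto)
qed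

end

section \<open>The free product of three groups of order two\<close>

text \<open>
  Taking the reduced words themselves as the elements makes the normal form theorem for free products part
  of the definition.  The price is the associativity of the product, which is proved by letting words act on
  reduced words.
\<close>

typedef w3 = "{w :: nat list. set w \<subseteq> {..<3} \<and> distinct_adj w}"
  morphisms word_of Abs_w3
  by (rule exI[of _ "[]"]) simp

definition cons_cancel :: "nat \<Rightarrow> nat list \<Rightarrow> nat list" where
  "cons_cancel x w = (case w of [] \<Rightarrow> [x] | y # v \<Rightarrow> if x = y then v else x # w)"

lemma cons_cancel_reduced:
  assumes "x < 3" "set w \<subseteq> {..<3} \<and> distinct_adj w"
  shows "set (cons_cancel x w) \<subseteq> {..<3} \<and> distinct_adj (cons_cancel x w)"
  using assms by (auto simp: cons_cancel_def distinct_adj_Cons split: list.splits)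

lemma cons_cancel_twice: "distinct_adj w \<Longrightarrow> cons_cancel x (cons_cancel x w) = w"
  by (auto simp: cons_cancel_def distinct_adj_Cons split: list.splits)

lemma foldr_cons_cancel_reduced:
  assumes "set u \<subseteq> {..<3}" "set w \<subseteq> {..<3} \<and> distinct_adj w"
  shows "set (foldr cons_cancel u w) \<subseteq> {..<3} \<and> distinct_adj (foldr cons_cancel u w)"
  using assms(1) by (induction u) (auto simp: assms(2) dest!: cons_cancel_reduced)

lemma foldr_cons_cancel_Nil: "distinct_adj w \<Longrightarrow> foldr cons_cancel w [] = w"
  by (induction w) (auto simp: cons_cancel_def distinct_adj_Cons split: list.splits)

text \<open>
  An action of the letters by involutions does not notice cancellations, so it extends to the group.  This is
  applied to the action on reduced words and, later on, to \<open>letter_action\<close>.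
\<close>

lemma foldr_cancel_action:
  assumes "\<And>x s. s \<in> S \<Longrightarrow> f x (f x s) = s" "\<And>x s. x < 3 \<Longrightarrow> s \<in> S \<Longrightarrow> f x s \<in> S"
    and u: "set u \<subseteq> {..<3}" and v: "set v \<subseteq> {..<3}" and s: "s \<in> S"
  shows "foldr f (foldr cons_cancel u v) s = foldr f u (foldr f v s)"
proof -
  have closed: "foldr f v s \<in> S" if "set v \<subseteq> {..<3}" for v
    using that by (induction v) (auto simp: s assms(2))
  have cancel: "foldr f (cons_cancel x v) s = f x (foldr f v s)" if "set v \<subseteq> {..<3}" for x v
    using that assms(1)[OF closed] by (cases v) (auto simp: cons_cancel_def)
  have sub: "set (cons_cancel x v) \<subseteq> {..<3}" if "x < 3" "set v \<subseteq> {..<3}" for x v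
    using that by (auto simp: cons_cancel_def split: list.splits)
  have "set (foldr cons_cancel u v) \<subseteq> {..<3} \<and> foldr f (foldr cons_cancel u v) s = foldr f u (foldr f v s)"
    using u by (induction u) (use v cancel sub in auto)
  then show ?thesis ..
qed

lemma word_of_reduced: "set (word_of g) \<subseteq> {..<3}" "distinct_adj (word_of g)"
  using word_of[of g] by auto

instantiation w3 :: group_add
begin

definition "0 = Abs_w3 []"
definition "g + h = Abs_w3 (foldr cons_cancel (word_of g) (word_of h))"
definition "- g = Abs_w3 (rev (word_of g))"
definition "g - h = g + - (h :: w3)"

lemma word_of_zero: "word_of 0 = []"
  by (simp add: zero_w3_def Abs_w3_inverse)

lemma word_of_add: "word_of (g + h) = foldr cons_cancel (word_of g) (word_of h)"
  unfolding plus_w3_def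
  by (rule Abs_w3_inverse) (use foldr_cons_cancel_reduced word_of_reduced in blast)

lemma word_of_uminus: "word_of (- g) = rev (word_of g)"
  unfolding uminus_w3_def by (rule Abs_w3_inverse) (simp add: word_of_reduced)

instance
proof
  fix a b c :: w3
  let ?S = "{w. set w \<subseteq> {..<3} \<and> distinct_adj w}"
  have "foldr cons_cancel (foldr cons_cancel (word_of a) (word_of b)) (word_of c) =
      foldr cons_cancel (word_of a) (foldr cons_cancel (word_of b) (word_of c))"
    by (rule foldr_cancel_action[where S = ?S])
      (use cons_cancel_reduced in \<open>auto simp: cons_cancel_twice word_of_reduced\<close>)
  then show "a + b + c = a + (b + c)"
    by (simp add: word_of_add flip: word_of_inject)
  show "0 + a = a"
    by (simp add: word_of_add word_of_zero flip: word_of_inject)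
  show "a + 0 = a"
    by (simp add: word_of_add word_of_zero foldr_cons_cancel_Nil word_of_reduced flip: word_of_inject)
  show "- a + a = 0"
  proof -
    have "foldr cons_cancel (rev u) (foldr cons_cancel u w) = w"
      if "set u \<subseteq> {..<3}" "set w \<subseteq> {..<3} \<and> distinct_adj w" for u w
      using that(1)
    proof (induction u)
      case (Cons x u)
      then have "distinct_adj (foldr cons_cancel u w)"
        using foldr_cons_cancel_reduced[OF _ that(2), of u] by simp
      then show ?case
        using Cons by (simp add: cons_cancel_twice)
    qed simp
    from this[OF word_of_reduced(1)[of a], of "[]"] show ?thesis
      by (simp add: word_of_add word_of_zero word_of_uminus foldr_cons_cancel_Nil word_of_reduced
          flip: word_of_inject)
  qed
  show "a + - b = a - b"
    by (simp add: minus_w3_def)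
qed

end

definition letter :: "nat \<Rightarrow> w3" where
  "letter l = Abs_w3 [l]"

lemma word_of_letter: "l < 3 \<Longrightarrow> word_of (letter l) = [l]"
  unfolding letter_def by (rule Abs_w3_inverse) simp

lemma word_of_letter_add: "l < 3 \<Longrightarrow> word_of (letter l + g) = cons_cancel l (word_of g)"
  by (simp add: word_of_add word_of_letter)

definition swap_letter :: "nat \<Rightarrow> nat" where
  "swap_letter l = (if l = 0 then 1 else if l = 1 then 0 else l)"

lemma swap_letter_swap [simp]: "swap_letter (swap_letter l) = l"
  by (auto simp: swap_letter_def)

lemma swap_letter_eq [simp]: "swap_letter l = swap_letter m \<longleftrightarrow> l = m"
  by (metis swap_letter_swap)

definition swap :: "w3 \<Rightarrow> w3" where
  "swap g = Abs_w3 (map swap_letter (word_of g))"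

lemma word_of_swap: "word_of (swap g) = map swap_letter (word_of g)"
  unfolding swap_def
proof (rule Abs_w3_inverse)
  have "distinct_adj (map swap_letter (word_of g))"
    by (rule distinct_adj_mapI[OF word_of_reduced(2)]) (auto intro: inj_onI)
  moreover have "swap_letter l < 3" if "l < 3" for l
    using that by (auto simp: swap_letter_def)
  ultimately show "map swap_letter (word_of g) \<in> {w. set w \<subseteq> {..<3} \<and> distinct_adj w}"
    using word_of_reduced(1)[of g] by auto
qed

lemma swap_add: "swap (g + h) = swap g + swap h"
proof -
  have cancel: "map swap_letter (cons_cancel x w) = cons_cancel (swap_letter x) (map swap_letter w)" for x w
    by (cases w) (auto simp: cons_cancel_def)
  have "map swap_letter (foldr cons_cancel u w) = foldr cons_cancel (map swap_letter u) (map swap_letter w)" for u w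
    by (induction u) (simp_all add: cancel)
  then have "word_of (swap (g + h)) = word_of (swap g + swap h)"
    by (simp only: word_of_swap word_of_add)
  then show ?thesis
    by (simp only: word_of_inject)
qed

lemma swap_swap: "swap (swap g) = g"
  by (simp add: word_of_swap comp_def flip: word_of_inject)

section \<open>A solution of d'Alembert's equation of unbounded degree\<close>

text \<open>
  The infinite dihedral group is represented on \<open>\<complex>[s]\<^sup>2\<close> by \<open>a, b \<mapsto> diag (-1, 1)\<close> and \<open>x \<mapsto> ((s, 1 - s), (1 + s, - s))\<close>.
  A cocycle of \<open>W\<close> with values in it takes \<open>a\<close> to \<open>(1, 0)\<close>, \<open>b\<close> to \<open>(-1, 0)\<close> and \<open>x\<close> to \<open>0\<close>, so that \<open>\<sigma>\<close> changes its sign.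
  Pairing it with a row cocycle of the same kind gives a function \<open>q\<close> which differs from an additive one by
  that pairing: \<open>(q, c, d)\<close> transforms under the letters by the affine involutions \<open>letter_action\<close>, where \<open>(c, d)\<close> is
  the value of the cocycle.  The constant \<open>1\<close> and the factor \<open>2\<close> make the actions of \<open>a\<close> and \<open>b\<close> involutions.
\<close>

type_synonym state = "complex poly \<times> complex poly \<times> complex poly"

abbreviation s_poly :: "complex poly" where
  "s_poly \<equiv> [:0, 1:]"

definition letter_sign :: "nat \<Rightarrow> complex poly" where
  "letter_sign l = (if l = 0 then 1 else - 1)"

fun letter_action :: "nat \<Rightarrow> state \<Rightarrow> state" where
  "letter_action l (q, c, d) =
    (if l = 2 then (q, s_poly * c + d - s_poly * d, c + s_poly * c - s_poly * d)
     else (q + 1 - 2 * (letter_sign l * c), letter_sign l - c, d))"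

definition word_state :: "nat list \<Rightarrow> state" where
  "word_state w = foldr letter_action w (0, 0, 0)"

lemma letter_sign_mult: "letter_sign l * letter_sign l = 1" "letter_sign l * (letter_sign l * c) = c"
  by (auto simp: letter_sign_def)

lemma letter_action_twice: "letter_action l (letter_action l s) = s"
proof (cases s)
  case (fields q c d)
  have "2 * (letter_sign l * (letter_sign l - c)) = 2 - 2 * (letter_sign l * c)"
    by (simp only: right_diff_distrib letter_sign_mult) simp
  then show ?thesis
    unfolding fields by (cases "l = 2") (simp_all only: letter_action.simps if_True if_False, simp_all add: algebra_simps del: mult_pCons_left)
qed

lemma word_state_add: "word_state (word_of (g + h)) = foldr letter_action (word_of g) (word_state (word_of h))"
  unfolding word_state_def word_of_add
  by (rule foldr_cancel_action[where S = UNIV]) (auto simp: letter_action_twice word_of_reduced simp del: letter_action.simps)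

fun negate_cocycle :: "state \<Rightarrow> state" where
  "negate_cocycle (q, c, d) = (q, - c, - d)"

lemma letter_action_swap: "l < 3 \<Longrightarrow> letter_action (swap_letter l) (negate_cocycle s) = negate_cocycle (letter_action l s)"
  by (cases s) (auto simp: swap_letter_def letter_sign_def)

lemma word_state_swap: "word_state (word_of (swap h)) = negate_cocycle (word_state (word_of h))"
proof -
  have "word_state (map swap_letter w) = negate_cocycle (word_state w)" if "set w \<subseteq> {..<3}" for w
    using that
  proof (induction w)
    case (Cons l w)
    then show ?case
      using letter_action_swap[of l "word_state w"] by (simp add: word_state_def)
  qed (simp add: word_state_def)
  then show ?thesis
    using word_of_reduced(1)[of h] by (simp only: word_of_swap)
qed

text \<open>
  The letters act by affine maps that commute with translations of \<open>q\<close>.  The midpoint of \<open>(q, c, d)\<close> and \<open>(q, - c, - d)\<close>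
  is the translate of the origin by \<open>q\<close>.  With \<open>(q, c, d)\<close> the state of \<open>h\<close>, the other end is the state of
  \<open>\<sigma> h\<close>, and d'Alembert's equation results.
\<close>

lemma word_action_midpoint:
  "fst (foldr letter_action w (q, c, d)) + fst (foldr letter_action w (q, - c, - d)) =
      2 * fst (foldr letter_action w (0, 0, 0)) + 2 * q \<and>
    fst (snd (foldr letter_action w (q, c, d))) + fst (snd (foldr letter_action w (q, - c, - d))) =
      2 * fst (snd (foldr letter_action w (0, 0, 0))) \<and>
    snd (snd (foldr letter_action w (q, c, d))) + snd (snd (foldr letter_action w (q, - c, - d))) =
      2 * snd (snd (foldr letter_action w (0, 0, 0)))"
proof (induction w)
  case (Cons l w)
  obtain q1 c1 d1 q2 c2 d2 q3 c3 d3 where eqs: "foldr letter_action w (q, c, d) = (q1, c1, d1)"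
    "foldr letter_action w (q, - c, - d) = (q2, c2, d2)" "foldr letter_action w (0, 0, 0) = (q3, c3, d3)"
    by (metis prod_cases3)
  have IH: "q1 + q2 = 2 * q3 + 2 * q" "c1 + c2 = 2 * c3" "d1 + d2 = 2 * d3"
    using Cons by (simp_all add: eqs)
  have IH': "q2 = 2 * q3 + 2 * q - q1" "c2 = 2 * c3 - c1" "d2 = 2 * d3 - d1"
    using IH by (simp_all add: eq_diff_eq add.commute)
  show ?case
    unfolding foldr.simps o_apply eqs IH' letter_action.simps
    by (cases "l = 2") (simp_all only: if_True if_False fst_conv snd_conv, simp_all add: algebra_simps del: mult_pCons_left)
qed simp

definition spherical :: "w3 \<Rightarrow> sqz" where
  "spherical g = Sqz 1 (fst (word_state (word_of g)))"

lemma spherical_zero: "spherical 0 = 1"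
  by (simp add: spherical_def word_of_zero word_state_def one_sqz_def)

lemma spherical_dAlembert: "spherical (g + h) + spherical (g + swap h) = 2 * spherical g * spherical h"
proof -
  obtain q c d where h: "word_state (word_of h) = (q, c, d)"
    by (metis prod_cases3)
  have two: "(2 :: sqz) = Sqz 2 0"
    by (metis one_add_one one_sqz_def plus_sqz_def sqz.sel add_0)
  have "fst (word_state (word_of (g + h))) + fst (word_state (word_of (g + swap h))) =
      2 * fst (word_state (word_of g)) + 2 * q"
    using word_action_midpoint[of "word_of g" q c d]
    by (simp add: word_state_add word_state_swap h) (simp add: word_state_def)
  then show ?thesis
    by (simp add: spherical_def h two plus_sqz_def times_sqz_def) (simp add: numeral_poly)
qed

text \<open>
  Along the words \<open>x a x a \<dots> x a\<close> the degrees of the two polynomials of the cocycle grow by one in each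
  period.  Their leading coefficients stay equal: \<open>a\<close> changes the sign of the first one, after which the
  leading terms that \<open>x\<close> produces in both components have the same sign and cannot cancel.  One further
  letter \<open>a\<close> transfers the degree to \<open>q\<close>.
\<close>

primrec alternating :: "nat \<Rightarrow> nat list" where
  "alternating 0 = []"
| "alternating (Suc n) = 2 # 0 # alternating n"

lemma alternating_state:
  obtains q c d where "word_state (alternating (Suc n)) = (q, c, d)"
    "degree q \<le> n" "degree c \<le> Suc n" "degree d \<le> Suc n"
    "Polynomial.coeff c (Suc n) = Polynomial.coeff d (Suc n)" "Polynomial.coeff c (Suc n) \<noteq> 0"
proof -
  have "\<exists>q c d. word_state (alternating (Suc n)) = (q, c, d) \<and>
    degree q \<le> n \<and> degree c \<le> Suc n \<and> degree d \<le> Suc n \<and>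
    Polynomial.coeff c (Suc n) = Polynomial.coeff d (Suc n) \<and> Polynomial.coeff c (Suc n) \<noteq> 0"
  proof (induction n)
    case 0
    show ?case
      by (simp add: word_state_def letter_sign_def one_pCons)
  next
    case (Suc n)
    then obtain q c d where IH: "word_state (alternating (Suc n)) = (q, c, d)"
      "degree q \<le> n" "degree c \<le> Suc n" "degree d \<le> Suc n"
      "Polynomial.coeff c (Suc n) = Polynomial.coeff d (Suc n)" "Polynomial.coeff c (Suc n) \<noteq> 0"
      by blast
    define c' where "c' = 1 - c"
    have step: "word_state (alternating (Suc (Suc n))) =
        (q + 1 - 2 * c, pCons 0 c' + d - pCons 0 d, c' + pCons 0 c' - pCons 0 d)"
      using IH(1) by (simp add: word_state_def letter_sign_def c'_def)
    have c': "degree c' \<le> Suc n" "Polynomial.coeff c' (Suc n) = - Polynomial.coeff c (Suc n)"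
      unfolding c'_def using IH(3) by (auto intro!: degree_diff_le)
    have c'2: "Polynomial.coeff c' (Suc (Suc n)) = 0" and d2: "Polynomial.coeff d (Suc (Suc n)) = 0"
      using c'(1) IH(4) by (auto intro!: coeff_eq_0)
    have deg: "degree (pCons 0 c') \<le> Suc (Suc n)" "degree (pCons 0 d) \<le> Suc (Suc n)"
      using c'(1) IH(4) by (auto intro: order_trans[OF degree_pCons_le])
    have "degree (q + 1 - 2 * c) \<le> Suc n"
      using IH(2,3) by (intro degree_diff_le degree_add_le) (auto simp: numeral_poly)
    moreover have "degree (pCons 0 c' + d - pCons 0 d) \<le> Suc (Suc n)" "degree (c' + pCons 0 c' - pCons 0 d) \<le> Suc (Suc n)"
      using deg c'(1) IH(4) by (auto intro!: degree_diff_le degree_add_le)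
    ultimately show ?case
      unfolding step using c' c'2 d2 IH(5,6) by simp
  qed
  then show ?thesis
    using that by blast
qed

lemma alternating_reduced: "set (0 # alternating n) \<subseteq> {..<3} \<and> distinct_adj (0 # alternating n)"
  by (induction n) auto

lemma spherical_unbounded: "\<exists>g. N < degree (nil_part (spherical g))"
proof -
  obtain q c d where st: "word_state (alternating (Suc N)) = (q, c, d)"
    "degree q \<le> N" "Polynomial.coeff c (Suc N) \<noteq> 0"
    using alternating_state[of N] by metis
  let ?g = "Abs_w3 (0 # alternating (Suc N))"
  have "word_of ?g = 0 # alternating (Suc N)"
    by (rule Abs_w3_inverse) (simp only: mem_Collect_eq alternating_reduced)
  then have "nil_part (spherical ?g) = q + 1 - 2 * c"
    using st(1) by (simp add: spherical_def word_state_def letter_sign_def)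
  moreover have "Polynomial.coeff (q + 1 - 2 * c) (Suc N) = - 2 * Polynomial.coeff c (Suc N)"
    using st(2) by (simp add: coeff_eq_0 numeral_poly)
  ultimately have "Polynomial.coeff (nil_part (spherical ?g)) (Suc N) \<noteq> 0"
    using st(3) by simp
  then have "Suc N \<le> degree (nil_part (spherical ?g))"
    by (rule le_degree)
  then show ?thesis
    by (intro exI[of _ ?g]) simp
qed

section \<open>The monoid algebra is a ring\<close>

lemma poly_mapping_sum_single: "f = (\<Sum>a\<in>keys f. single a (lookup f a))"
  by (rule poly_mapping_eqI) (simp add: lookup_sum lookup_single when_def in_keys_iff)

context
  fixes M :: "('m, 'b) monoid_scheme"
  assumes M: "monoid M"
begin

text \<open>The multiplication of the monoid algebra, freed from the record for the sake of its additivity in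
  both arguments.\<close>

definition alg_mult :: "('m \<Rightarrow>\<^sub>0 'k::comm_ring_1) \<Rightarrow> ('m \<Rightarrow>\<^sub>0 'k) \<Rightarrow> 'm \<Rightarrow>\<^sub>0 'k" where
  "alg_mult f g = (\<Sum>a\<in>keys f. \<Sum>b\<in>keys g.
     single (a \<otimes>\<^bsub>M\<^esub> b) (lookup f a * lookup g b))"

lemma alg_mult_superset:
  assumes "finite S" "keys f \<subseteq> S" "finite T" "keys g \<subseteq> T"
  shows "alg_mult f g = (\<Sum>a\<in>S. \<Sum>b\<in>T. single (a \<otimes>\<^bsub>M\<^esub> b) (lookup f a * lookup g b))"
proof -
  have "(\<Sum>b\<in>keys g. single (a \<otimes>\<^bsub>M\<^esub> b) (lookup f a * lookup g b)) =
      (\<Sum>b\<in>T. single (a \<otimes>\<^bsub>M\<^esub> b) (lookup f a * lookup g b))" for a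
    using assms by (intro sum.mono_neutral_left) (auto simp: in_keys_iff)
  then show ?thesis
    unfolding alg_mult_def using assms by (simp only:) (intro sum.mono_neutral_left; auto simp: in_keys_iff)
qed

lemma alg_mult_add_left: "alg_mult (f + f') g = alg_mult f g + alg_mult f' g"
proof -
  let ?S = "keys f \<union> keys f'"
  have S: "finite ?S" by simp
  show ?thesis
    unfolding alg_mult_superset[OF S Un_upper1 finite_keys order_refl] alg_mult_superset[OF S Un_upper2 finite_keys order_refl]
      alg_mult_superset[OF S keys_add finite_keys order_refl]
    by (simp add: lookup_add distrib_right single_add sum.distrib)
qed

lemma alg_mult_add_right: "alg_mult f (g + g') = alg_mult f g + alg_mult f g'"
proof -
  let ?S = "keys g \<union> keys g'"
  have S: "finite ?S" by simp
  show ?thesis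
    unfolding alg_mult_superset[OF finite_keys order_refl S Un_upper1] alg_mult_superset[OF finite_keys order_refl S Un_upper2]
      alg_mult_superset[OF finite_keys order_refl S keys_add]
    by (simp add: lookup_add distrib_left single_add sum.distrib)
qed

lemma alg_mult_zero: "alg_mult 0 g = 0" "alg_mult f 0 = 0"
  by (simp_all add: alg_mult_def)

lemma alg_mult_sum_left: "alg_mult (sum F S) g = (\<Sum>j\<in>S. alg_mult (F j) g)"
  by (induction S rule: infinite_finite_induct) (auto simp: alg_mult_add_left alg_mult_zero)

lemma alg_mult_sum_right: "alg_mult f (sum F S) = (\<Sum>j\<in>S. alg_mult f (F j))"
  by (induction S rule: infinite_finite_induct) (auto simp: alg_mult_add_right alg_mult_zero)

lemma alg_mult_single_left:
  "alg_mult (single a c) g = (\<Sum>b\<in>keys g. single (a \<otimes>\<^bsub>M\<^esub> b) (c * lookup g b))"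
  by (subst alg_mult_superset[of "{a}" _ "keys g"]) (auto split: if_splits)

lemma alg_mult_single_right:
  "alg_mult f (single b c) = (\<Sum>a\<in>keys f. single (a \<otimes>\<^bsub>M\<^esub> b) (lookup f a * c))"
  by (subst alg_mult_superset[of "keys f" _ "{b}"]) (auto split: if_splits)

lemma alg_mult_single: "alg_mult (single a c) (single b d) = single (a \<otimes>\<^bsub>M\<^esub> b) (c * d)"
  by (simp add: alg_mult_def)

lemma keys_alg_mult:
  assumes "keys f \<subseteq> carrier M" "keys g \<subseteq> carrier M"
  shows "keys (alg_mult f g) \<subseteq> carrier M"
proof -
  have "keys (alg_mult f g) \<subseteq> (\<Union>a\<in>keys f. \<Union>b\<in>keys g. {a \<otimes>\<^bsub>M\<^esub> b})"
    unfolding alg_mult_def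
    by (intro order_trans[OF keys_sum] UN_mono order_refl) (auto split: if_splits)
  then show ?thesis
    using assms monoid.m_closed[OF M] by blast
qed

lemma alg_mult_assoc:
  assumes f: "keys f \<subseteq> carrier M" and g: "keys g \<subseteq> carrier M" and h: "keys h \<subseteq> carrier M"
  shows "alg_mult (alg_mult f g) h = alg_mult f (alg_mult g h)"
proof -
  have "alg_mult (alg_mult f g) h = (\<Sum>a\<in>keys f. \<Sum>b\<in>keys g. \<Sum>c\<in>keys h.
      single ((a \<otimes>\<^bsub>M\<^esub> b) \<otimes>\<^bsub>M\<^esub> c) (lookup f a * lookup g b * lookup h c))"
    unfolding alg_mult_def[of f g] by (simp only: alg_mult_sum_left alg_mult_single_left)
  also have "\<dots> = (\<Sum>a\<in>keys f. \<Sum>b\<in>keys g. \<Sum>c\<in>keys h.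
      single (a \<otimes>\<^bsub>M\<^esub> (b \<otimes>\<^bsub>M\<^esub> c)) (lookup f a * (lookup g b * lookup h c)))"
    using f g h monoid.m_assoc[OF M] by (intro sum.cong refl) (simp add: subset_iff mult.assoc)
  also have "\<dots> = (\<Sum>b\<in>keys g. \<Sum>a\<in>keys f. \<Sum>c\<in>keys h.
      single (a \<otimes>\<^bsub>M\<^esub> (b \<otimes>\<^bsub>M\<^esub> c)) (lookup f a * (lookup g b * lookup h c)))"
    by (rule sum.swap)
  also have "\<dots> = (\<Sum>b\<in>keys g. \<Sum>c\<in>keys h. \<Sum>a\<in>keys f.
      single (a \<otimes>\<^bsub>M\<^esub> (b \<otimes>\<^bsub>M\<^esub> c)) (lookup f a * (lookup g b * lookup h c)))"
    by (intro sum.cong refl sum.swap)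
  also have "\<dots> = alg_mult f (alg_mult g h)"
    unfolding alg_mult_def[of g h] by (simp only: alg_mult_sum_right alg_mult_single_right)
  finally show ?thesis .
qed

lemma alg_mult_one:
  assumes f: "keys f \<subseteq> carrier M"
  shows "alg_mult (single \<one>\<^bsub>M\<^esub> 1) f = f" "alg_mult f (single \<one>\<^bsub>M\<^esub> 1) = f"
proof -
  have "alg_mult (single \<one>\<^bsub>M\<^esub> 1) f = (\<Sum>a\<in>keys f. single a (lookup f a))"
    unfolding alg_mult_def using f monoid.l_one[OF M] by (auto intro!: sum.cong)
  then show "alg_mult (single \<one>\<^bsub>M\<^esub> 1) f = f"
    by (simp only: poly_mapping_sum_single[symmetric])
  have "alg_mult f (single \<one>\<^bsub>M\<^esub> 1) = (\<Sum>a\<in>keys f. single a (lookup f a))"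
    unfolding alg_mult_def using f monoid.r_one[OF M] by (auto intro!: sum.cong)
  then show "alg_mult f (single \<one>\<^bsub>M\<^esub> 1) = f"
    by (simp only: poly_mapping_sum_single[symmetric])
qed

lemma ring_monoid_algebra: "ring (monoid_algebra M :: ('k::comm_ring_1, _) module)"
proof -
  have A: "monoid_algebra M = \<lparr>carrier = {f. keys f \<subseteq> carrier M}, mult = alg_mult,
      one = single \<one>\<^bsub>M\<^esub> 1, zero = 0, add = (+),
      smult = (\<lambda>c. Poly_Mapping.map ((*) c))\<rparr>"
    by (simp add: monoid_algebra_def alg_mult_def fun_eq_iff)
  show ?thesis
    unfolding A
  proof (rule ringI)
    show "abelian_group \<lparr>carrier = {f. keys f \<subseteq> carrier M}, mult = alg_mult,
        one = single \<one>\<^bsub>M\<^esub> 1, zero = 0, add = (+), smult = (\<lambda>c :: 'k. Poly_Mapping.map ((*) c))\<rparr>"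
    proof (rule abelian_groupI, goal_cases)
      case (1 f g)
      then show ?case using keys_add[of f g] by auto
    next
      case (6 f)
      then show ?case by (intro bexI[of _ "- f"]) simp_all
    qed (simp_all add: add.assoc add.commute)
    show "monoid \<lparr>carrier = {f. keys f \<subseteq> carrier M}, mult = alg_mult,
        one = single \<one>\<^bsub>M\<^esub> 1, zero = 0, add = (+), smult = (\<lambda>c :: 'k. Poly_Mapping.map ((*) c))\<rparr>"
    proof (rule monoidI, goal_cases)
      case (1 f g)
      then show ?case using keys_alg_mult by simp
    qed (use monoid.one_closed[OF M] in \<open>simp_all add: alg_mult_assoc alg_mult_one\<close>)
  qed (auto simp: alg_mult_add_left alg_mult_add_right)
qed

end

context twisted_dual
begin

lemma ring_cqg_algebra: "ring (cqg_algebra cstar_alg comult)"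
proof -
  have B: "cqg_algebra cstar_alg comult = \<lparr>carrier = alg, mult = (\<circ>), one = id_op, zero = 0, add = (+), smult = op_scale\<rparr>"
    using cqg_carrier by (simp add: cqg_algebra_def)
  have neg: "- x \<in> alg" if "x \<in> alg" for x
    using alg_closed(3)[OF that, of "-1"] by (simp add: op_scale_minus1)
  show ?thesis
    unfolding B
  proof (rule ringI)
    show "abelian_group \<lparr>carrier = alg, mult = (\<circ>), one = id_op, zero = 0, add = (+), smult = op_scale\<rparr>"
    proof (rule abelian_groupI, goal_cases)
      case (6 x)
      then show ?case
        using neg[of x] by (intro bexI[of _ "- x"]) simp_all
    qed (simp_all add: alg_closed add.assoc add.commute)
    show "monoid \<lparr>carrier = alg, mult = (\<circ>), one = id_op, zero = 0, add = (+), smult = op_scale\<rparr>"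
      by (rule monoidI) (use alg_bounded in \<open>simp_all add: alg_comp id_op_alg comp_assoc comp_id_op subset_iff\<close>)
  qed (use alg_bounded in \<open>simp_all add: comp_add_left comp_add_right subset_iff\<close>)
qed

end

section \<open>Finite presentation\<close>

locale w3_dual = twisted_dual swap dec for dec :: "'i \<Rightarrow> w3 \<times> bool"
begin

text \<open>
  As an algebra, the span of the basis operators is the group algebra of the product of the free product with
  a group of order two, whose generator is \<open>\<delta>\<^sub>0 - \<delta>\<^sub>1\<close>.  The group elements are the operators \<open>group_op g e\<close>,
  and the letters \<open>0, 1, 2, 3\<close> stand for the generators of the two factors.
\<close>

definition group_op :: "w3 \<Rightarrow> bool \<Rightarrow> 'i op" where
  "group_op g e = basis_op g False + op_scale (if e then - 1 else 1) (basis_op g True)"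

primrec w3_part :: "nat list \<Rightarrow> w3" where
  "w3_part [] = 0"
| "w3_part (l # w) = (if l < 3 then letter l + w3_part w else w3_part w)"

primrec sign_part :: "nat list \<Rightarrow> bool" where
  "sign_part [] = False"
| "sign_part (l # w) = (if l < 3 then sign_part w else \<not> sign_part w)"

definition eval_word :: "nat list \<Rightarrow> 'i op" where
  "eval_word w = group_op (w3_part w) (sign_part w)"

lemma group_op_alg: "group_op g e \<in> alg"
  unfolding group_op_def by (intro alg_closed basis_op_alg)

lemma group_op_comp: "group_op g e \<circ> group_op h f = group_op (g + h) (e \<noteq> f)"
proof -
  have "basis_op g k \<circ> group_op h f =
      (if k then op_scale (if f then - 1 else 1) (basis_op (g + h) True) else basis_op (g + h) False)" for k
    unfolding group_op_def
    by (simp add: comp_add_right comp_scale_right bounded_ops_closed(4) basis_op_comp)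
  then show ?thesis
    unfolding group_op_def[of g e] comp_add_left comp_scale_left by (simp add: group_op_def)
qed

lemma w3_part_append: "w3_part (u @ v) = w3_part u + w3_part v"
  by (induction u) (auto simp: add.assoc)

lemma sign_part_append: "sign_part (u @ v) = (sign_part u \<noteq> sign_part v)"
  by (induction u) auto

lemma eval_word_append: "eval_word (u @ v) = eval_word u \<circ> eval_word v"
  by (simp add: eval_word_def group_op_comp w3_part_append sign_part_append)

lemma eval_word_Nil: "eval_word [] = id_op"
  by (simp add: eval_word_def group_op_def id_op_basis)

definition normal_word :: "w3 \<Rightarrow> bool \<Rightarrow> nat list" where
  "normal_word g e = (if e then [3] else []) @ word_of g"

lemma normal_word_lists: "normal_word g e \<in> lists {..<4}"
  using word_of_reduced(1)[of g] by (auto simp: normal_word_def)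

lemma w3_part_word_of: "w3_part (word_of g) = g"
proof -
  have "word_of (w3_part w) = foldr cons_cancel w []" if "set w \<subseteq> {..<3}" for w
    using that by (induction w) (auto simp: word_of_zero word_of_letter_add)
  then show ?thesis
    using word_of_reduced[of g] by (simp add: foldr_cons_cancel_Nil flip: word_of_inject)
qed

lemma sign_part_word_of: "sign_part (word_of g) = False"
proof -
  have "\<not> sign_part w" if "set w \<subseteq> {..<3}" for w
    using that by (induction w) auto
  then show ?thesis
    using word_of_reduced(1)[of g] by simp
qed

lemma normal_word_parts: "w3_part (normal_word g e) = g" "sign_part (normal_word g e) = e"
  by (auto simp: normal_word_def w3_part_word_of sign_part_word_of)

abbreviation eval_alg :: "(nat list \<Rightarrow>\<^sub>0 complex) \<Rightarrow> 'i op" where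
  "eval_alg \<equiv> free_ext op_scale eval_word"

abbreviation F4 :: "(complex, nat list \<Rightarrow>\<^sub>0 complex) module" where
  "F4 \<equiv> free_algebra 4"

abbreviation B4 where
  "B4 \<equiv> cqg_algebra cstar_alg comult"

abbreviation words4 :: "nat list monoid" where
  "words4 \<equiv> \<lparr>carrier = lists {..<4}, mult = (@), one = []\<rparr>"

lemma words4_monoid: "monoid words4"
  by (rule monoidI) auto

lemma ring_F4: "ring F4"
  unfolding free_algebra_def by (rule ring_monoid_algebra[OF words4_monoid])

lemma F4_simps:
  "carrier F4 = {f. keys f \<subseteq> lists {..<4}}" "(\<oplus>\<^bsub>F4\<^esub>) = (+)" "\<zero>\<^bsub>F4\<^esub> = 0"
  "\<one>\<^bsub>F4\<^esub> = single [] 1" "(\<odot>\<^bsub>F4\<^esub>) = (\<lambda>c. Poly_Mapping.map ((*) c))"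
  "f \<otimes>\<^bsub>F4\<^esub> g = (\<Sum>a\<in>keys f. \<Sum>b\<in>keys g.
     single (a @ b) (lookup f a * lookup g b))"
  by (simp_all add: free_algebra_def monoid_algebra_def)

lemma B4_simps: "carrier B4 = alg" "(\<oplus>\<^bsub>B4\<^esub>) = (+)" "\<zero>\<^bsub>B4\<^esub> = 0" "\<one>\<^bsub>B4\<^esub> = id_op" "(\<otimes>\<^bsub>B4\<^esub>) = (\<circ>)" "(\<odot>\<^bsub>B4\<^esub>) = op_scale"
  using cqg_carrier by (simp_all add: cqg_algebra_def)

lemma eval_word_alg: "eval_word w \<in> alg"
  by (simp add: eval_word_def group_op_alg)

lemma eval_alg_mem: "eval_alg f \<in> alg"
  unfolding free_ext_def by (intro alg_closed eval_word_alg)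

lemma eval_alg_mult: "eval_alg (f \<otimes>\<^bsub>F4\<^esub> g) = eval_alg f \<circ> eval_alg g"
proof -
  have bd: "eval_word w \<in> bounded_ops" for w
    using eval_word_alg alg_bounded by blast
  have "eval_alg (f \<otimes>\<^bsub>F4\<^esub> g) = (\<Sum>a\<in>keys f. \<Sum>b\<in>keys g.
      op_scale (lookup f a * lookup g b) (eval_word a \<circ> eval_word b))"
    by (simp add: F4_simps ops.free_ext_sum ops.free_ext_single eval_word_append)
  also have "\<dots> = (\<Sum>a\<in>keys f. \<Sum>b\<in>keys g.
      op_scale (lookup f a) (eval_word a \<circ> op_scale (lookup g b) (eval_word b)))"
    by (simp only: comp_scale_right[OF bd bd] ops.scale_scale)
  also have "\<dots> = (\<Sum>a\<in>keys f. op_scale (lookup f a) (eval_word a \<circ> eval_alg g))"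
    unfolding free_ext_def[of _ _ g] ops.scale_sum_right[symmetric]
    by (simp only: comp_sum_right[OF bd bounded_ops_closed(4)[OF bd]])
  also have "\<dots> = eval_alg f \<circ> eval_alg g"
    by (simp only: free_ext_def[of _ _ f] comp_sum_left comp_scale_left)
  finally show ?thesis .
qed

lemma eval_alg_hom: "eval_alg \<in> algebra_hom F4 B4"
proof -
  have "eval_alg \<in> Ring.ring_hom F4 B4"
    by (rule ring_hom_memI)
      (simp_all only: B4_simps eval_alg_mem eval_alg_mult F4_simps(2,4) ops.free_ext_add ops.free_ext_single
        eval_word_Nil ops.scale_one)
  then show ?thesis
    by (simp add: algebra_hom_def F4_simps B4_simps ops.free_ext_smult)
qed

lemma eval_alg_surj: "eval_alg ` carrier F4 = carrier B4"
proof
  show "eval_alg ` carrier F4 \<subseteq> carrier B4"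
    by (auto simp: B4_simps eval_alg_mem)
  show "carrier B4 \<subseteq> eval_alg ` carrier F4"
  proof
    fix x assume "x \<in> carrier B4"
    then have "x \<in> alg"
      by (simp add: B4_simps)
    then have "\<exists>f. keys f \<subseteq> lists {..<4} \<and> eval_alg f = x"
    proof (induction rule: alg_induct)
      case zero
      have "eval_alg 0 = 0" by (rule ops.free_ext_zero)
      then show ?case by (intro exI[of _ 0]) auto
    next
      case (step c g k y)
      then obtain f where f: "keys f \<subseteq> lists {..<4}" "eval_alg f = y" by blast
      define p where "p = single (normal_word g False) (c / 2) +
        single (normal_word g True) (if k then - c / 2 else c / 2)"
      have keys: "keys (p + f) \<subseteq> lists {..<4}"
        unfolding p_def
        by (intro order_trans[OF keys_add] Un_least f(1)) (use normal_word_lists in auto)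
      have half: "op_scale (c / 2) z + op_scale (c / 2) z = op_scale c z" for z :: "'i op"
        by (simp flip: ops.scale_left_distrib)
      have "eval_alg p = op_scale c (basis_op g k)"
        unfolding p_def
        by (cases k) (simp_all add: ops.free_ext_add ops.free_ext_single eval_word_def normal_word_parts group_op_def
            ops.scale_right_distrib half algebra_simps)
      then have "eval_alg (p + f) = op_scale c (basis_op g k) + y"
        using f(2) by (simp only: ops.free_ext_add)
      with keys show ?case by blast
    qed
    then show "x \<in> eval_alg ` carrier F4"
      by (auto simp: F4_simps)
  qed
qed

definition relations :: "(nat list \<Rightarrow>\<^sub>0 complex) set" where
  "relations = (\<lambda>l. single [l, l] 1 - single [] 1) ` {..<4} \<union>
     (\<lambda>l. single [l, 3] 1 - single [3, l] 1) ` {..<3}"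

lemma letter_twice: "l < 3 \<Longrightarrow> letter l + letter l = 0"
  by (simp add: word_of_letter_add word_of_letter word_of_zero cons_cancel_def flip: word_of_inject)

lemma relations_kernel: "relations \<subseteq> a_kernel F4 B4 eval_alg"
proof
  fix x assume "x \<in> relations"
  then consider l where "l < 4" "x = single [l, l] 1 - single [] 1"
    | l where "l < 3" "x = single [l, 3] 1 - single [3, l] 1"
    by (auto simp: relations_def)
  then show "x \<in> a_kernel F4 B4 eval_alg"
  proof cases
    case (1 l)
    have "keys x \<subseteq> {[l, l], []}"
      unfolding 1(2) by (rule order_trans[OF keys_diff]) auto
    moreover have "eval_word [l, l] = eval_word []"
      using letter_twice by (auto simp: eval_word_def)
    then have "eval_alg x = 0"
      unfolding 1(2) by (simp add: ops.free_ext_diff ops.free_ext_single)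
    ultimately show ?thesis
      using 1(1) unfolding a_kernel_def' F4_simps B4_simps by auto
  next
    case (2 l)
    have "keys x \<subseteq> {[3, l], [l, 3]}"
      unfolding 2(2) by (rule order_trans[OF keys_diff]) auto
    moreover have "eval_word [3, l] = eval_word [l, 3]"
      by (auto simp: eval_word_def)
    then have "eval_alg x = 0"
      unfolding 2(2) by (simp add: ops.free_ext_diff ops.free_ext_single)
    ultimately show ?thesis
      using 2(1) unfolding a_kernel_def' F4_simps B4_simps by fastforce
  qed
qed

text \<open>
  The relations let a word be rewritten to its normal word, and the normal words are linearly independent in
  the algebra.  So modulo any ideal containing the relations, an element of the kernel is congruent to a
  combination of normal words that is zero.
\<close>

context
  fixes I :: "(nat list \<Rightarrow>\<^sub>0 complex) set"
  assumes I: "ideal I F4" and rel: "relations \<subseteq> I"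
begin

lemma ideal_add: "x \<in> I \<Longrightarrow> y \<in> I \<Longrightarrow> x + y \<in> I"
  using additive_subgroup.a_closed[OF ideal.axioms(1)[OF I], of x y] by (simp add: F4_simps)

lemma ideal_zero: "0 \<in> I"
  using additive_subgroup.zero_closed[OF ideal.axioms(1)[OF I]] by (simp add: F4_simps)

lemma ideal_sum: "(\<And>j. j \<in> S \<Longrightarrow> f j \<in> I) \<Longrightarrow> sum f S \<in> I"
  by (induction S rule: infinite_finite_induct) (auto intro: ideal_add ideal_zero)

lemma ideal_mult:
  assumes x: "single u 1 - single v 1 \<in> I" (is "?x \<in> I")
    and pq: "p \<in> lists {..<4}" "q \<in> lists {..<4}"
  shows "single (p @ u @ q) c - single (p @ v @ q) c \<in> I"
proof -
  let ?p = "single p c" and ?q = "single q (1 :: complex)"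
  have mem: "?p \<in> carrier F4" "?q \<in> carrier F4"
    using pq by (auto simp: F4_simps)
  have F4_mult: "f \<otimes>\<^bsub>F4\<^esub> g = alg_mult words4 f g" for f g
    by (simp add: F4_simps alg_mult_def[OF words4_monoid])
  have "?p \<otimes>\<^bsub>F4\<^esub> (?x \<otimes>\<^bsub>F4\<^esub> ?q) \<in> I"
    using ideal.I_l_closed[OF I ideal.I_r_closed[OF I x mem(2)] mem(1)] .
  moreover have "?p \<otimes>\<^bsub>F4\<^esub> (?x \<otimes>\<^bsub>F4\<^esub> ?q) = single (p @ u @ q) c - single (p @ v @ q) c"
  proof -
    have minus: "single w (- d) = - single w d" for w :: "nat list" and d :: complex
      by (rule single_uminus)
    have x_eq: "?x = single u 1 + single v (- 1)"
      by (simp add: minus)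
    show ?thesis
      unfolding F4_mult x_eq
      by (simp only: alg_mult_add_left[OF words4_monoid] alg_mult_add_right[OF words4_monoid]
          alg_mult_single[OF words4_monoid]) (simp add: minus)
  qed
  ultimately show ?thesis by simp
qed

definition cong_words :: "nat list \<Rightarrow> nat list \<Rightarrow> bool" where
  "cong_words u v \<longleftrightarrow> single u 1 - single v 1 \<in> I"

lemma cong_words_refl: "cong_words u u"
  by (simp add: cong_words_def ideal_zero)

lemma cong_words_trans [trans]: "cong_words u v \<Longrightarrow> cong_words v w \<Longrightarrow> cong_words u w"
  unfolding cong_words_def by (drule (1) ideal_add) simp

lemma cong_words_context:
  "cong_words u v \<Longrightarrow> p \<in> lists {..<4} \<Longrightarrow> q \<in> lists {..<4} \<Longrightarrow> cong_words (p @ u @ q) (p @ v @ q)"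
  unfolding cong_words_def by (rule ideal_mult)

lemma cong_square: "l < 4 \<Longrightarrow> q \<in> lists {..<4} \<Longrightarrow> cong_words (l # l # q) q"
  using cong_words_context[of "[l, l]" "[]" "[]" q] rel
  by (auto simp: cong_words_def relations_def)

lemma cong_central: "l < 3 \<Longrightarrow> q \<in> lists {..<4} \<Longrightarrow> cong_words (l # 3 # q) (3 # l # q)"
  using cong_words_context[of "[l, 3]" "[3, l]" "[]" q] rel
  by (auto simp: cong_words_def relations_def)

lemma cong_normal_word:
  "w \<in> lists {..<4} \<Longrightarrow> cong_words w (normal_word (w3_part w) (sign_part w))"
proof (induction w)
  case Nil
  show ?case
    by (simp add: normal_word_def word_of_zero cong_words_refl)
next
  case (Cons l w)
  define r e where "r = word_of (w3_part w)" and "e = sign_part w"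
  define p where "p = (if e then [3] else [] :: nat list)"
  have l: "l < 4" and w: "w \<in> lists {..<4}"
    using Cons.prems by auto
  have r: "r \<in> lists {..<4}" and p: "p \<in> lists {..<4}"
    using word_of_reduced(1)[of "w3_part w"] by (auto simp: r_def p_def)
  have "cong_words ([l] @ w @ []) ([l] @ (p @ r) @ [])"
    using cong_words_context[OF Cons.IH[OF w], of "[l]" "[]"] l by (simp add: normal_word_def r_def p_def e_def)
  then have start: "cong_words (l # w) (l # p @ r)"
    by simp
  show ?case
  proof (cases "l < 3")
    case True
    note start
    also have "cong_words (l # p @ r) (p @ l # r)"
      using cong_central[OF True r] by (simp add: p_def cong_words_refl)
    also have "cong_words (l # r) (cons_cancel l r)"
    proof (cases "\<exists>r'. r = l # r'")
      case True
      then obtain r' where r': "r = l # r'" by blast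
      then have "r' \<in> lists {..<4}"
        using r by simp
      then show ?thesis
        using cong_square[OF l] by (simp add: r' cons_cancel_def)
    next
      case False
      then have "cons_cancel l r = l # r"
        by (auto simp: cons_cancel_def split: list.splits)
      then show ?thesis
        by (simp add: cong_words_refl)
    qed
    then have "cong_words (p @ l # r) (p @ cons_cancel l r)"
      using cong_words_context[of "l # r" "cons_cancel l r" p "[]"] p by simp
    finally show ?thesis
      using True by (simp add: normal_word_def word_of_letter_add p_def r_def e_def)
  next
    case False
    then have l3: "l = 3" using l by simp
    have "cong_words (l # p @ r) ((if e then [] else [3]) @ r)"
      using cong_square[OF l r] by (simp add: p_def l3 cong_words_refl)
    with start have "cong_words (l # w) ((if e then [] else [3]) @ r)"
      by (rule cong_words_trans)
    then show ?thesis
      by (simp add: normal_word_def l3 r_def e_def split: if_splits)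
  qed
qed

lemma kernel_in_ideal:
  assumes f: "f \<in> carrier F4" and zero: "eval_alg f = 0"
  shows "f \<in> I"
proof -
  let ?c = "lookup f" and ?K = "keys f"
  let ?nf = "\<lambda>w. normal_word (w3_part w) (sign_part w)"
  define C where "C g e = (\<Sum>w\<in>?K. if w3_part w = g \<and> sign_part w = e then ?c w else 0)" for g e
  have fourier_word: "fourier (eval_word w) g k = (if w3_part w = g then if k \<and> sign_part w then - 1 else 1 else 0)" for w g k
    by (auto simp: eval_word_def group_op_def fourier_add fourier_scale fourier_basis_op)
  have "fourier (eval_alg f) g k = C g False + (if k then - C g True else C g True)" for g k
  proof -
    have "fourier (eval_alg f) g k = (\<Sum>w\<in>?K. ?c w * fourier (eval_word w) g k)"
      by (simp add: free_ext_def fourier_sum fourier_scale)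
    also have "\<dots> = (\<Sum>w\<in>?K. (if w3_part w = g \<and> sign_part w = False then ?c w else 0) +
        (if k then - 1 else 1) * (if w3_part w = g \<and> sign_part w = True then ?c w else 0))"
      by (intro sum.cong refl) (auto simp: fourier_word)
    also have "\<dots> = C g False + (if k then - 1 else 1) * C g True"
      by (simp only: sum.distrib C_def sum_distrib_left)
    finally show ?thesis by simp
  qed
  from this[of _ False] this[of _ True] have sum: "C g False + C g True = 0" and diff: "C g False - C g True = 0" for g
    by (simp_all add: zero fourier_zero(1))
  have eq: "C g False = C g True" for g
    using diff[of g] by simp
  have "C g True = 0" for g
    using sum[of g] by (simp add: eq)
  then have C: "C g e = 0" for g e
    using eq[of g] by (cases e) simp_all
  have "(\<Sum>w\<in>?K. single (?nf w) (?c w)) = 0"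
  proof (rule poly_mapping_eqI)
    fix v
    have "lookup (\<Sum>w\<in>?K. single (?nf w) (?c w)) v = (\<Sum>w\<in>?K. if ?nf w = v then ?c w else 0)"
      by (simp add: lookup_sum lookup_single when_def)
    also have "\<dots> = (\<Sum>w\<in>?K. if v = normal_word (w3_part v) (sign_part v) \<and> w3_part w = w3_part v \<and> sign_part w = sign_part v then ?c w else 0)"
      by (intro sum.cong refl) (auto simp: normal_word_parts)
    also have "\<dots> = (if v = normal_word (w3_part v) (sign_part v) then C (w3_part v) (sign_part v) else 0)"
      by (simp add: C_def)
    finally show "lookup (\<Sum>w\<in>?K. single (?nf w) (?c w)) v = lookup 0 v"
      by (simp add: C)
  qed
  then have "f = (\<Sum>w\<in>?K. single w (?c w) - single (?nf w) (?c w))"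
    using poly_mapping_sum_single[of f] by (simp add: sum_subtractf)
  also have "\<dots> \<in> I"
  proof (rule ideal_sum)
    fix w assume "w \<in> ?K"
    then have "w \<in> lists {..<4}"
      using f by (auto simp: F4_simps)
    then show "single w (?c w) - single (?nf w) (?c w) \<in> I"
      using ideal_mult[of w "?nf w" "[]" "[]" "?c w"] cong_normal_word[of w] by (simp add: cong_words_def)
  qed
  finally show ?thesis .
qed

end

theorem finitely_presented_cqg_algebra: "finitely_presented_algebra B4"
proof -
  have hom: "ring_hom_ring F4 B4 eval_alg"
    using eval_alg_hom by (intro ring_hom_ringI2 ring_F4 ring_cqg_algebra) (simp add: algebra_hom_def)
  have sub: "relations \<subseteq> carrier F4"
    using relations_kernel by (auto simp: a_kernel_def')
  have "a_kernel F4 B4 eval_alg = Idl\<^bsub>F4\<^esub> relations"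
  proof
    show "Idl\<^bsub>F4\<^esub> relations \<subseteq> a_kernel F4 B4 eval_alg"
      by (rule ring.genideal_minimal[OF ring_F4 ring_hom_ring.kernel_is_ideal[OF hom] relations_kernel])
    show "a_kernel F4 B4 eval_alg \<subseteq> Idl\<^bsub>F4\<^esub> relations"
      unfolding genideal_def using kernel_in_ideal by (auto simp: a_kernel_def' B4_simps)
  qed
  moreover have "finite relations"
    by (simp add: relations_def)
  ultimately show ?thesis
    unfolding finitely_presented_algebra_def
    using eval_alg_hom eval_alg_surj sub by blast
qed

end

section \<open>The example\<close>

text \<open>The group is infinite because \<open>spherical\<close> takes infinitely many values.\<close>

lemma countably_infinite_w3: "\<exists>dec :: nat \<Rightarrow> w3 \<times> bool. bij dec"
proof -
  have "infinite (UNIV :: w3 set)"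
  proof
    assume "finite (UNIV :: w3 set)"
    then have fin: "finite ((\<lambda>g. degree (nil_part (spherical g))) ` UNIV)"
      by (rule finite_imageI)
    obtain g where "Max ((\<lambda>g. degree (nil_part (spherical g))) ` UNIV) < degree (nil_part (spherical g))"
      using spherical_unbounded by blast
    then show False
      using Max_ge[OF fin, of "degree (nil_part (spherical g))"] by simp
  qed
  then have "infinite (UNIV :: (w3 \<times> bool) set)"
    by (simp add: finite_prod)
  moreover have "countable (UNIV :: w3 set)"
    by (rule countableI[of "\<lambda>g. to_nat (word_of g)"]) (auto intro!: inj_onI simp: word_of_inject)
  then have "countable (UNIV :: (w3 \<times> bool) set)"
    unfolding UNIV_Times_UNIV[symmetric] by (intro countable_SIGMA) (auto intro: countable_finite)
  ultimately show ?thesis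
    using bij_betw_from_nat_into by blast
qed

theorem corollary4p5:
  shows "\<exists>(A :: nat op set) \<Delta>. compact_quantum_group A \<Delta> \<and>
    finitely_presented_algebra (cqg_algebra A \<Delta>) \<and>
    \<not> finitely_generated_algebra (complexification (fusion_ring A \<Delta>))"
proof -
  obtain dec :: "nat \<Rightarrow> w3 \<times> bool" where dec: "bij dec"
    using countably_infinite_w3 by blast
  interpret w3_dual dec
    by standard (use dec in \<open>auto simp: swap_add swap_swap\<close>)
  show ?thesis
    using compact_quantum_group_cstar_alg finitely_presented_cqg_algebra
      fusion_algebra_not_finitely_generated[OF spherical_zero spherical_dAlembert spherical_unbounded] by blast
qed

end
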